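(* For any principally directed ordered groupoid $G$, any $G$-module $\mathcal{A}$, and any $n\geqslant 0$, the homology groups $H_n(G,\mathcal{A})$ and $H_n(G/\beta,\operatorname{colim}^{E(G)}\mathcal{A})$ are isomorphic.
   Context: A groupoid $G$ is a small category in which every morphism is invertible, regarded as the set of its morphisms with a partial composition; $E(G)$ is its set of identities. For $g\in G$, write $g\mathbf{d}=gg^{-1}$ (domain identity) and $g\mathbf{r}=g^{-1}g$ (range identity); composition is written left to right, so $gh$ is defined iff $g\mathbf{r}=h\mathbf{d}$. Maps are written on the right of their arguments. An ordered groupoid is a groupoid $G$ with a partial order $\leqslant$ such that: (OG1) $x\leqslant y \Rightarrow x^{-1}\leqslant y^{-1}$; (OG2) if $x\leqslant y$ and $u\leqslant v$ then $xu\leqslant yv$ whenever $xu$ and $yv$ are defined; (OG3) if $e\in E(G)$ and $e\leqslant x\mathbf{d}$, there is a unique element $(e|x)$ (restriction) with $(e|x)\mathbf{d}=e$ and $(e|x)\leqslant x$; (OG4) if $e\in E(G)$ and $e\leqslant x\mathbf{r}$, there is a unique element $(x|e)$ (corestriction) with $(x|e)\mathbf{r}=e$ and $(x|e)\leqslant x$. The relation $\beta$ on $G$: $g\,\beta\,h$ iff there is $k\in G$ with $k\leqslant g$ and $k\leqslant h$. $G$ is principally directed if every principal order ideal $\{g\in G: g\leqslant t\}$, $t \in G$, is a directed set (any two of its elements have a common lower bound in it); equivalently, $\beta$ is transitive. Then the set $G/\beta$ of $\beta$-classes $g\beta$ is a groupoid, with composition $(g\beta)(h\beta)=[(g|f)(f|h)]\beta$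 defined when $g^{-1}g\,\beta\,hh^{-1}$, where $f\in E(G)$ is any common lower bound of $g^{-1}g$ and $hh^{-1}$; its identities are the classes $e\beta$, $e\in E(G)$. $G/\beta$ is regarded as trivially ordered. The category $\mathfrak{L}(G)$ has object set $E(G)$ and morphisms the pairs $(e,g)\in E(G)\times G$ with $g\mathbf{d}\leqslant e$; $(e,g)$ goes from $e$ to $g\mathbf{r}$, and $(e,g)(f,h)=(e,(g|h\mathbf{d})h)$ when $g\mathbf{r}=f$. A $G$-module is a functor $\mathcal{A}$ from $\mathfrak{L}(G)$ to abelian groups: abelian groups $A_e$ ($e\in E(G)$) and homomorphisms $\alpha_{(e,g)}:A_e\to A_{g^{-1}g}$; write $a\lhd(e,g)=a\alpha_{(e,g)}$, and $a \lhd g$ for $a\lhd(g\mathbf{d},g)$. $G$-maps are natural transformations, and $\operatorname{Mod}_G=\operatorname{Mod}_{\mathfrak{L}(G)}$ is the resulting category. Since $G/\beta$ is trivially ordered, $\mathfrak{L}(G/\beta)=G/\beta$, and a $G/\beta$-module is a functor from $G/\beta$ to abelian groups. The $G/\beta$-module $\operatorname{colim}^{E(G)}\mathcal{A}$: given a $G$-module $\mathcal{A}$, restrict it to the poset $E(G)$, using only the maps $\alpha_{(e,f)}:A_e\to A_f$ for $f\leqslant e$. The colimit of this restricted diagram of abelian groups is a direct sum $\bigoplus_{x\in E(G)/\beta}L_x$, where $L_x$ is the colimit over the $\beta$-class $x$; let $\alpha_e:A_e\to L_{e\beta}$ be the canonical maps. The family $(L_x)$ is regarded as a $G/\beta$-module,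 still denoted $\operatorname{colim}^{E(G)}\mathcal{A}$, with action as follows: if $\overline{a}=a\alpha_e\in L_{e\beta}$ with $a\in A_e$, and $g\in G$ with $gg^{-1}\,\beta\,e$, choose a common lower bound $\ell\in E(G)$ of $gg^{-1}$ and $e$, and set $\overline{a}\lhd g\beta=(a\alpha_{(e,\ell)}\lhd(\ell|g))\alpha_z\in L_{(g^{-1}g)\beta}$, where $z=(\ell|g)\mathbf{r}$ (this is well defined). Homology: for an ordered groupoid $G$, the functors $H_n(G,-):\operatorname{Mod}_G\to\mathbf{Ab}$, $n\geqslant 0$, are the left derived functors of $\operatorname{colim}^{\mathfrak{L}(G)}$. That is, they are characterized by: (a) $H_0(G,\mathcal{A})=\operatorname{colim}^{\mathfrak{L}(G)}\mathcal{A}$, and each short exact sequence $\mathcal{A}\to\mathcal{B}\to\mathcal{C}$ of $G$-modules yields natural connecting homomorphisms $H_{n+1}(G,\mathcal{C})\to H_n(G,\mathcal{A})$ giving a long exact sequence; (b) $H_n(G,\mathcal{P})=0$ for all $n>0$ and all projective modules $\mathcal{P}$. For $G/\beta$ this uses $\mathfrak{L}(G/\beta)=G/\beta$. *)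

theory Defs
  imports "HOL-Algebra.Free_Abelian_Groups"
begin

section \<open>Small categories and modules over them\<close>

text \<open>Composition is written in diagrammatic order: \<open>cmp C m n\<close> is first \<open>m\<close>, then \<open>n\<close>.\<close>

record ('o, 'm) cat =
  objs :: "'o set"
  mors :: "'m set"
  src :: "'m \<Rightarrow> 'o"
  tgt :: "'m \<Rightarrow> 'o"
  ident :: "'o \<Rightarrow> 'm"
  cmp :: "'m \<Rightarrow> 'm \<Rightarrow> 'm"

locale category =
  fixes C :: "('o, 'm) cat"
  assumes src_in: "m \<in> mors C \<Longrightarrow> src C m \<in> objs C"
    and tgt_in: "m \<in> mors C \<Longrightarrow> tgt C m \<in> objs C"
    and ident_in: "x \<in> objs C \<Longrightarrow> ident C x \<in> mors C"
    and src_ident: "x \<in> objs C \<Longrightarrow> src C (ident C x) = x"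
    and tgt_ident: "x \<in> objs C \<Longrightarrow> tgt C (ident C x) = x"
    and cmp_in: "\<lbrakk>m \<in> mors C; n \<in> mors C; tgt C m = src C n\<rbrakk> \<Longrightarrow> cmp C m n \<in> mors C"
    and src_cmp: "\<lbrakk>m \<in> mors C; n \<in> mors C; tgt C m = src C n\<rbrakk> \<Longrightarrow> src C (cmp C m n) = src C m"
    and tgt_cmp: "\<lbrakk>m \<in> mors C; n \<in> mors C; tgt C m = src C n\<rbrakk> \<Longrightarrow> tgt C (cmp C m n) = tgt C n"
    and ident_cmp: "m \<in> mors C \<Longrightarrow> cmp C (ident C (src C m)) m = m"
    and cmp_ident: "m \<in> mors C \<Longrightarrow> cmp C m (ident C (tgt C m)) = m"
    and cmp_assoc: "\<lbrakk>m \<in> mors C; n \<in> mors C; p \<in> mors C; tgt C m = src C n; tgt C n = src C p\<rbrakk>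
          \<Longrightarrow> cmp C (cmp C m n) p = cmp C m (cmp C n p)"

text \<open>Functors from \<open>C\<close> to abelian groups (which are written multiplicatively, as everywhere in
  HOL-Algebra).\<close>

record ('o, 'm, 'a) cmod =
  fib :: "'o \<Rightarrow> 'a monoid"
  act :: "'m \<Rightarrow> 'a \<Rightarrow> 'a"

definition cat_module :: "('o, 'm) cat \<Rightarrow> ('o, 'm, 'a) cmod \<Rightarrow> bool" where
  "cat_module C A \<longleftrightarrow>
     (\<forall>x\<in>objs C. comm_group (fib A x)) \<and>
     (\<forall>m\<in>mors C. act A m \<in> hom (fib A (src C m)) (fib A (tgt C m))) \<and>
     (\<forall>x\<in>objs C. \<forall>a\<in>carrier (fib A x). act A (ident C x) a = a) \<and>
     (\<forall>m\<in>mors C. \<forall>n\<in>mors C. tgt C m = src C n \<longrightarrow>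
        (\<forall>a\<in>carrier (fib A (src C m)). act A (cmp C m n) a = act A n (act A m a)))"

definition nat_trans ::
  "('o, 'm) cat \<Rightarrow> ('o, 'm, 'a) cmod \<Rightarrow> ('o, 'm, 'b) cmod \<Rightarrow> ('o \<Rightarrow> 'a \<Rightarrow> 'b) \<Rightarrow> bool" where
  "nat_trans C A B \<phi> \<longleftrightarrow>
     (\<forall>x\<in>objs C. \<phi> x \<in> hom (fib A x) (fib B x)) \<and>
     (\<forall>m\<in>mors C. \<forall>a\<in>carrier (fib A (src C m)).
        \<phi> (tgt C m) (act A m a) = act B m (\<phi> (src C m) a))"

definition surjective ::
  "('o, 'm) cat \<Rightarrow> ('o, 'm, 'a) cmod \<Rightarrow> ('o, 'm, 'b) cmod \<Rightarrow> ('o \<Rightarrow> 'a \<Rightarrow> 'b) \<Rightarrow> bool" where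
  "surjective C A B \<phi> \<longleftrightarrow> (\<forall>x\<in>objs C. \<phi> x ` carrier (fib A x) = carrier (fib B x))"

text \<open>Epimorphisms of modules are the componentwise surjective maps.  A definition cannot quantify
  over all types, so the lifting property is required for test modules \<open>M\<close>, \<open>N\<close> over two fixed
  types.  The type of \<open>M\<close> accommodates the standard free module covering \<open>P\<close>, so that this
  implies the lifting property against epimorphisms over arbitrary types: see lemma
  \<open>projective_lifts\<close> below.\<close>

definition projective :: "('o, 'm) cat \<Rightarrow> ('o, 'm, 'p) cmod \<Rightarrow> bool" where
  "projective C P \<longleftrightarrow> cat_module C P \<and>
     (\<forall>(M :: ('o, 'm, 'm \<times> 'p \<Rightarrow>\<^sub>0 int) cmod) (N :: ('o, 'm, 'p) cmod) \<pi> \<phi>.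
        cat_module C M \<and> cat_module C N \<and>
        nat_trans C M N \<pi> \<and> surjective C M N \<pi> \<and> nat_trans C P N \<phi> \<longrightarrow>
        (\<exists>\<psi>. nat_trans C P M \<psi> \<and>
           (\<forall>x\<in>objs C. \<forall>p\<in>carrier (fib P x). \<pi> x (\<psi> x p) = \<phi> x p)))"

text \<open>\<open>d n\<close> goes from \<open>P (n + 1)\<close> to \<open>P n\<close>.\<close>

definition projective_resolution ::
  "('o, 'm) cat \<Rightarrow> ('o, 'm, 'a) cmod \<Rightarrow> (nat \<Rightarrow> ('o, 'm, 'p) cmod) \<Rightarrow>
   (nat \<Rightarrow> 'o \<Rightarrow> 'p \<Rightarrow> 'p) \<Rightarrow> ('o \<Rightarrow> 'p \<Rightarrow> 'a) \<Rightarrow> bool" where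
  "projective_resolution C A P d \<epsilon> \<longleftrightarrow>
     (\<forall>n. projective C (P n)) \<and>
     (\<forall>n. nat_trans C (P (Suc n)) (P n) (d n)) \<and>
     nat_trans C (P 0) A \<epsilon> \<and> surjective C (P 0) A \<epsilon> \<and>
     (\<forall>x\<in>objs C. d 0 x ` carrier (fib (P 1) x) = kernel (fib (P 0) x) (fib A x) (\<epsilon> x)) \<and>
     (\<forall>n. \<forall>x\<in>objs C. d (Suc n) x ` carrier (fib (P (Suc (Suc n))) x) =
        kernel (fib (P (Suc n)) x) (fib (P n) x) (d n x))"


section \<open>Colimits of abelian groups\<close>

definition colim_sum :: "('o, 'm) cat \<Rightarrow> ('o, 'm, 'a) cmod \<Rightarrow> ('o \<Rightarrow> 'a) monoid" where
  "colim_sum C A = sum_group (objs C) (fib A)"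

definition sum_in :: "('o, 'm) cat \<Rightarrow> ('o, 'm, 'a) cmod \<Rightarrow> 'o \<Rightarrow> 'a \<Rightarrow> 'o \<Rightarrow> 'a" where
  "sum_in C A x a = (\<lambda>y\<in>objs C. if y = x then a else \<one>\<^bsub>fib A y\<^esub>)"

definition colim_rel :: "('o, 'm) cat \<Rightarrow> ('o, 'm, 'a) cmod \<Rightarrow> ('o \<Rightarrow> 'a) set" where
  "colim_rel C A = generate (colim_sum C A)
     {sum_in C A (src C m) a \<otimes>\<^bsub>colim_sum C A\<^esub>
        inv\<^bsub>colim_sum C A\<^esub> (sum_in C A (tgt C m) (act A m a)) |
      m a. m \<in> mors C \<and> a \<in> carrier (fib A (src C m))}"

definition colim :: "('o, 'm) cat \<Rightarrow> ('o, 'm, 'a) cmod \<Rightarrow> ('o \<Rightarrow> 'a) set monoid" where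
  "colim C A = colim_sum C A Mod colim_rel C A"

definition colim_in :: "('o, 'm) cat \<Rightarrow> ('o, 'm, 'a) cmod \<Rightarrow> 'o \<Rightarrow> 'a \<Rightarrow> ('o \<Rightarrow> 'a) set" where
  "colim_in C A x a = colim_rel C A #>\<^bsub>colim_sum C A\<^esub> sum_in C A x a"

text \<open>The induced map on cosets: all the cosets in the union are equal.\<close>

definition colim_map ::
  "('o, 'm) cat \<Rightarrow> ('o, 'm, 'a) cmod \<Rightarrow> ('o, 'm, 'b) cmod \<Rightarrow> ('o \<Rightarrow> 'a \<Rightarrow> 'b) \<Rightarrow>
   ('o \<Rightarrow> 'a) set \<Rightarrow> ('o \<Rightarrow> 'b) set" where
  "colim_map C A B \<phi> X =
     (\<Union>u\<in>X. colim_rel C B #>\<^bsub>colim_sum C B\<^esub> (\<lambda>x\<in>objs C. \<phi> x (u x)))"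


section \<open>Left derived functors of the colimit\<close>

definition chain_homology ::
  "(nat \<Rightarrow> 'a monoid) \<Rightarrow> (nat \<Rightarrow> 'a \<Rightarrow> 'a) \<Rightarrow> nat \<Rightarrow> 'a set monoid" where
  "chain_homology K d n = (case n of
       0 \<Rightarrow> K 0 Mod (d 0 ` carrier (K 1))
     | Suc k \<Rightarrow> (K n)\<lparr>carrier := kernel (K n) (K k) (d k)\<rparr> Mod (d n ` carrier (K (Suc n))))"

text \<open>Names for free generators.  In the standard free resolution of \<open>A\<close>, the free generators in
  degree 0 are the pairs of a morphism \<open>m\<close> and an element of \<open>A\<close> at the source of \<open>m\<close>, and those
  in degree \<open>n + 1\<close> are the pairs of a morphism \<open>m\<close> and a cycle of degree \<open>n\<close> at the source of
  \<open>m\<close>, which is given by a list of generators and coefficients.  Hence every module has a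
  projective resolution over the type \<open>('m, 'a) gen \<Rightarrow>\<^sub>0 int\<close>: see lemma
  \<open>projective_resolution_exists\<close> below.\<close>

datatype ('m, 'a) gen = Base 'm 'a | Step 'm "(('m, 'a) gen \<times> int) list"

definition some_resolution ::
  "('o, 'm) cat \<Rightarrow> ('o, 'm, 'a) cmod \<Rightarrow>
   (nat \<Rightarrow> ('o, 'm, ('m, 'a) gen \<Rightarrow>\<^sub>0 int) cmod) \<times>
   (nat \<Rightarrow> 'o \<Rightarrow> (('m, 'a) gen \<Rightarrow>\<^sub>0 int) \<Rightarrow> (('m, 'a) gen \<Rightarrow>\<^sub>0 int))" where
  "some_resolution C A = (SOME (P, d). \<exists>\<epsilon>. projective_resolution C A P d \<epsilon>)"

text \<open>The value at \<open>A\<close> of the \<open>n\<close>-th left derived functor of the colimit over \<open>C\<close>.\<close>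

definition cat_homology ::
  "nat \<Rightarrow> ('o, 'm) cat \<Rightarrow> ('o, 'm, 'a) cmod \<Rightarrow> ('o \<Rightarrow> ('m, 'a) gen \<Rightarrow>\<^sub>0 int) set set monoid" where
  "cat_homology n C A = (case some_resolution C A of (P, d) \<Rightarrow>
     chain_homology (\<lambda>k. colim C (P k)) (\<lambda>k. colim_map C (P (Suc k)) (P k) (d k)) n)"


section \<open>Ordered groupoids\<close>

record 'g ogpd =
  elts :: "'g set"
  gmul :: "'g \<Rightarrow> 'g \<Rightarrow> 'g"
  ginv :: "'g \<Rightarrow> 'g"
  gle :: "'g \<Rightarrow> 'g \<Rightarrow> bool"

definition gdom :: "'g ogpd \<Rightarrow> 'g \<Rightarrow> 'g" where
  "gdom G g = gmul G g (ginv G g)"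

definition gran :: "'g ogpd \<Rightarrow> 'g \<Rightarrow> 'g" where
  "gran G g = gmul G (ginv G g) g"

definition idents :: "'g ogpd \<Rightarrow> 'g set" where
  "idents G = {e \<in> elts G. gdom G e = e}"

text \<open>\<open>gmul G g h\<close> is meaningful only if \<open>gran G g = gdom G h\<close>.\<close>

locale groupoid =
  fixes G :: "'g ogpd"
  assumes ginv_in: "g \<in> elts G \<Longrightarrow> ginv G g \<in> elts G"
    and gdom_in: "g \<in> elts G \<Longrightarrow> gdom G g \<in> elts G"
    and gran_in: "g \<in> elts G \<Longrightarrow> gran G g \<in> elts G"
    and gdom_gdom: "g \<in> elts G \<Longrightarrow> gdom G (gdom G g) = gdom G g"
    and gran_gdom: "g \<in> elts G \<Longrightarrow> gran G (gdom G g) = gdom G g"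
    and gdom_gran: "g \<in> elts G \<Longrightarrow> gdom G (gran G g) = gran G g"
    and gran_gran: "g \<in> elts G \<Longrightarrow> gran G (gran G g) = gran G g"
    and gdom_ginv: "g \<in> elts G \<Longrightarrow> gdom G (ginv G g) = gran G g"
    and gran_ginv: "g \<in> elts G \<Longrightarrow> gran G (ginv G g) = gdom G g"
    and gmul_in: "\<lbrakk>g \<in> elts G; h \<in> elts G; gran G g = gdom G h\<rbrakk> \<Longrightarrow> gmul G g h \<in> elts G"
    and gdom_gmul: "\<lbrakk>g \<in> elts G; h \<in> elts G; gran G g = gdom G h\<rbrakk> \<Longrightarrow> gdom G (gmul G g h) = gdom G g"
    and gran_gmul: "\<lbrakk>g \<in> elts G; h \<in> elts G; gran G g = gdom G h\<rbrakk> \<Longrightarrow> gran G (gmul G g h) = gran G h"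
    and gdom_gmul_left: "g \<in> elts G \<Longrightarrow> gmul G (gdom G g) g = g"
    and gran_gmul_right: "g \<in> elts G \<Longrightarrow> gmul G g (gran G g) = g"
    and gmul_assoc: "\<lbrakk>g \<in> elts G; h \<in> elts G; k \<in> elts G; gran G g = gdom G h; gran G h = gdom G k\<rbrakk>
          \<Longrightarrow> gmul G (gmul G g h) k = gmul G g (gmul G h k)"

locale ordered_groupoid = groupoid +
  assumes gle_refl: "x \<in> elts G \<Longrightarrow> gle G x x"
    and gle_antisym: "\<lbrakk>x \<in> elts G; y \<in> elts G; gle G x y; gle G y x\<rbrakk> \<Longrightarrow> x = y"
    and gle_trans: "\<lbrakk>x \<in> elts G; y \<in> elts G; z \<in> elts G; gle G x y; gle G y z\<rbrakk> \<Longrightarrow> gle G x z"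
    and OG1: "\<lbrakk>x \<in> elts G; y \<in> elts G; gle G x y\<rbrakk> \<Longrightarrow> gle G (ginv G x) (ginv G y)"
    and OG2: "\<lbrakk>x \<in> elts G; y \<in> elts G; u \<in> elts G; v \<in> elts G; gle G x y; gle G u v;
          gran G x = gdom G u; gran G y = gdom G v\<rbrakk> \<Longrightarrow> gle G (gmul G x u) (gmul G y v)"
    and OG3: "\<lbrakk>x \<in> elts G; e \<in> idents G; gle G e (gdom G x)\<rbrakk>
          \<Longrightarrow> \<exists>!y. y \<in> elts G \<and> gdom G y = e \<and> gle G y x"
    and OG4: "\<lbrakk>x \<in> elts G; e \<in> idents G; gle G e (gran G x)\<rbrakk>
          \<Longrightarrow> \<exists>!y. y \<in> elts G \<and> gran G y = e \<and> gle G y x"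

definition restriction :: "'g ogpd \<Rightarrow> 'g \<Rightarrow> 'g \<Rightarrow> 'g" where
  "restriction G e x = (THE y. y \<in> elts G \<and> gdom G y = e \<and> gle G y x)"

definition corestriction :: "'g ogpd \<Rightarrow> 'g \<Rightarrow> 'g \<Rightarrow> 'g" where
  "corestriction G x e = (THE y. y \<in> elts G \<and> gran G y = e \<and> gle G y x)"

definition beta :: "'g ogpd \<Rightarrow> ('g \<times> 'g) set" where
  "beta G = {(g, h). g \<in> elts G \<and> h \<in> elts G \<and> (\<exists>k\<in>elts G. gle G k g \<and> gle G k h)}"

definition principally_directed :: "'g ogpd \<Rightarrow> bool" where
  "principally_directed G \<longleftrightarrow>
     (\<forall>t\<in>elts G. \<forall>x\<in>elts G. \<forall>y\<in>elts G. gle G x t \<and> gle G y t \<longrightarrow>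
        (\<exists>z\<in>elts G. gle G z t \<and> gle G z x \<and> gle G z y))"

text \<open>The elements of the quotient are the \<open>beta\<close>-classes, as sets.\<close>

definition beta_quotient :: "'g ogpd \<Rightarrow> 'g set ogpd" where
  "beta_quotient G =
     \<lparr>elts = elts G // beta G,
      gmul = (\<lambda>X Y. THE Z. \<exists>g\<in>X. \<exists>h\<in>Y. \<exists>f\<in>idents G.
                gle G f (gran G g) \<and> gle G f (gdom G h) \<and>
                Z = beta G `` {gmul G (corestriction G g f) (restriction G f h)}),
      ginv = (\<lambda>X. ginv G ` X),
      gle = (=)\<rparr>"


section \<open>Modules over ordered groupoids\<close>

definition LL :: "'g ogpd \<Rightarrow> ('g, 'g \<times> 'g) cat" where
  "LL G =
     \<lparr>objs = idents G,
      mors = {(e, g). e \<in> idents G \<and> g \<in> elts G \<and> gle G (gdom G g) e},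
      src = fst,
      tgt = (\<lambda>(e, g). gran G g),
      ident = (\<lambda>e. (e, e)),
      cmp = (\<lambda>(e, g) (f, h). (e, gmul G (corestriction G g (gdom G h)) h))\<rparr>"

abbreviation G_module :: "'g ogpd \<Rightarrow> ('g, 'g \<times> 'g, 'a) cmod \<Rightarrow> bool" where
  "G_module G A \<equiv> cat_module (LL G) A"

definition homology :: "nat \<Rightarrow> 'g ogpd \<Rightarrow> ('g, 'g \<times> 'g, 'a) cmod \<Rightarrow>
    ('g \<Rightarrow> ('g \<times> 'g, 'a) gen \<Rightarrow>\<^sub>0 int) set set monoid" where
  "homology n G A = cat_homology n (LL G) A"

text \<open>The poset of identities in a \<open>beta\<close>-class \<open>x\<close>, with a morphism \<open>(e, f)\<close> from \<open>e\<close> to \<open>f\<close>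
  whenever \<open>f \<le> e\<close>.  As its objects and morphisms are also objects and morphisms of \<open>LL G\<close>, a
  \<open>G\<close>-module needs no change to be regarded as a functor on it.\<close>

definition class_poset :: "'g ogpd \<Rightarrow> 'g set \<Rightarrow> ('g, 'g \<times> 'g) cat" where
  "class_poset G x =
     \<lparr>objs = x \<inter> idents G,
      mors = {(e, f). e \<in> x \<inter> idents G \<and> f \<in> x \<inter> idents G \<and> gle G f e},
      src = fst,
      tgt = snd,
      ident = (\<lambda>e. (e, e)),
      cmp = (\<lambda>(e, f) (f', h). (e, h))\<rparr>"

text \<open>A morphism of \<open>LL (beta_quotient G)\<close> is a pair \<open>(x, \<gamma>)\<close> where \<open>x\<close> is the domain of the
  class \<open>\<gamma>\<close>, since \<open>beta_quotient G\<close> is trivially ordered.\<close>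

definition colimE :: "'g ogpd \<Rightarrow> ('g, 'g \<times> 'g, 'a) cmod \<Rightarrow>
    ('g set, 'g set \<times> 'g set, ('g \<Rightarrow> 'a) set) cmod" where
  "colimE G A =
     \<lparr>fib = (\<lambda>x. colim (class_poset G x) A),
      act = (\<lambda>(x, \<gamma>) abar. THE b. \<exists>g\<in>\<gamma>. \<exists>e\<in>x \<inter> idents G. \<exists>a\<in>carrier (fib A e). \<exists>l\<in>idents G.
               gle G l (gdom G g) \<and> gle G l e \<and>
               abar = colim_in (class_poset G x) A e a \<and>
               b = colim_in (class_poset G (gran (beta_quotient G) \<gamma>)) A
                     (gran G (restriction G l g))
                     (act A (l, restriction G l g) (act A (e, l) a)))\<rparr>"


section \<open>Projective modules and existence of resolutions\<close>

lemma free_hom_eqI: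
  assumes "comm_group H" "f \<in> hom (free_Abelian_group S) H" "g \<in> hom (free_Abelian_group S) H"
    and "\<And>s. s \<in> S \<Longrightarrow> f (frag_of s) = g (frag_of s)"
    and "Poly_Mapping.keys c \<subseteq> S"
  shows "f c = g c"
proof -
  interpret H: comm_group H by fact
  interpret f: group_hom "free_Abelian_group S" H f
    using assms by (simp add: group_hom_def group_hom_axioms_def H.is_group)
  interpret g: group_hom "free_Abelian_group S" H g
    using assms by (simp add: group_hom_def group_hom_axioms_def H.is_group)
  show ?thesis
  proof (rule free_Abelian_group_induct[OF assms(5), where P = "\<lambda>c. f c = g c"])
    show "f 0 = g 0" using f.hom_one g.hom_one by simp
    fix x y assume xy: "Poly_Mapping.keys x \<subseteq> S" "Poly_Mapping.keys y \<subseteq> S" "f x = g x" "f y = g y"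
    have "f (x + - y) = g (x + - y)"
      using f.hom_mult[of x "- y"] g.hom_mult[of x "- y"] f.hom_inv[of y] g.hom_inv[of y] xy
      by simp
    then show "f (x - y) = g (x - y)" by simp
  qed (use assms in auto)
qed

text \<open>\<open>free_cover C K j\<close> is the standard free module covering \<open>K\<close>.  Its generator \<open>j (m, k)\<close> at
  the target of \<open>m\<close> is to be mapped to \<open>act K m k\<close>; the injection \<open>j\<close> embeds the generators into
  a prescribed type.\<close>

definition gens :: "('o, 'm) cat \<Rightarrow> ('o, 'm, 'k) cmod \<Rightarrow> ('m \<times> 'k \<Rightarrow> 't) \<Rightarrow> 'o \<Rightarrow> 't set" where
  "gens C K j x = {j (m, k) | m k. m \<in> mors C \<and> tgt C m = x \<and> k \<in> carrier (fib K (src C m))}"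

definition free_cover :: "('o, 'm) cat \<Rightarrow> ('o, 'm, 'k) cmod \<Rightarrow> ('m \<times> 'k \<Rightarrow> 't) \<Rightarrow>
    ('o, 'm, 't \<Rightarrow>\<^sub>0 int) cmod" where
  "free_cover C K j =
     \<lparr>fib = (\<lambda>x. free_Abelian_group (gens C K j x)),
      act = (\<lambda>n. frag_extend (\<lambda>t. frag_of (j (cmp C (fst (inv_into UNIV j t)) n, snd (inv_into UNIV j t)))))\<rparr>"

lemma hom_frag_extend:
  assumes "\<And>s. s \<in> S \<Longrightarrow> Poly_Mapping.keys (f s) \<subseteq> T"
  shows "frag_extend f \<in> hom (free_Abelian_group S) (free_Abelian_group T)"
proof (rule homI)
  fix x assume "x \<in> carrier (free_Abelian_group S)"
  then have x: "Poly_Mapping.keys x \<subseteq> S" by simp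
  have "Poly_Mapping.keys (frag_extend f x) \<subseteq> (\<Union>s \<in> Poly_Mapping.keys x. Poly_Mapping.keys (f s))"
    by (rule keys_frag_extend)
  then show "frag_extend f x \<in> carrier (free_Abelian_group T)" using assms x by force
next
  fix x y
  show "frag_extend f (x \<otimes>\<^bsub>free_Abelian_group S\<^esub> y) =
    frag_extend f x \<otimes>\<^bsub>free_Abelian_group T\<^esub> frag_extend f y"
    by (simp add: frag_extend_add)
qed

context category begin

lemma nat_trans_in:
  "\<lbrakk>nat_trans C A B \<phi>; x \<in> objs C; a \<in> carrier (fib A x)\<rbrakk> \<Longrightarrow> \<phi> x a \<in> carrier (fib B x)"
  by (auto simp: nat_trans_def hom_def)

lemma cat_module_act_in:
  "\<lbrakk>cat_module C A; m \<in> mors C; a \<in> carrier (fib A (src C m))\<rbrakk> \<Longrightarrow> act A m a \<in> carrier (fib A (tgt C m))"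
  by (auto simp: cat_module_def hom_def)

lemma nat_trans_comp:
  assumes f: "nat_trans C L M f" and g: "nat_trans C M N g"
  shows "nat_trans C L N (\<lambda>x. g x \<circ> f x)"
  unfolding nat_trans_def
proof (intro conjI ballI)
  show "g x \<circ> f x \<in> hom (fib L x) (fib N x)" if "x \<in> objs C" for x
    using hom_compose[of "f x" _ "fib M x" "g x"] f g that unfolding nat_trans_def by blast
  fix m a assume m: "m \<in> mors C" and a: "a \<in> carrier (fib L (src C m))"
  have "f (src C m) a \<in> carrier (fib M (src C m))"
    using nat_trans_in[OF f src_in[OF m] a] .
  then show "(g (tgt C m) \<circ> f (tgt C m)) (act L m a) = act N m ((g (src C m) \<circ> f (src C m)) a)"
    using f g m a by (simp add: nat_trans_def)
qed

lemma gensI: "\<lbrakk>m \<in> mors C; k \<in> carrier (fib K (src C m))\<rbrakk> \<Longrightarrow> j (m, k) \<in> gens C K j (tgt C m)"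
  unfolding gens_def by blast

lemma act_free_cover_of:
  assumes "inj j"
  shows "act (free_cover C K j) n (frag_of (j (m, k))) = frag_of (j (cmp C m n, k))"
  using assms by (simp add: free_cover_def)

lemma act_free_cover_hom:
  assumes "inj j" "n \<in> mors C"
  shows "act (free_cover C K j) n \<in>
     hom (free_Abelian_group (gens C K j (src C n))) (free_Abelian_group (gens C K j (tgt C n)))"
  unfolding free_cover_def
  apply simp
  apply (rule hom_frag_extend)
  using assms apply (auto simp: gens_def cmp_in src_cmp tgt_cmp)
  by (metis cmp_in src_cmp tgt_cmp)

lemma fib_free_cover [simp]: "fib (free_cover C K j) x = free_Abelian_group (gens C K j x)"
  by (simp add: free_cover_def)

lemma cat_module_free_cover:
  assumes j: "inj j"
  shows "cat_module C (free_cover C K j)"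
  unfolding cat_module_def
proof (intro conjI ballI impI)
  show "comm_group (fib (free_cover C K j) x)" for x
    by (simp add: abelian_free_Abelian_group)
  show "act (free_cover C K j) m \<in> hom (fib (free_cover C K j) (src C m)) (fib (free_cover C K j) (tgt C m))"
    if "m \<in> mors C" for m
    using act_free_cover_hom[OF j that] by simp
next
  fix x a assume x: "x \<in> objs C" and a: "a \<in> carrier (fib (free_cover C K j) x)"
  have "act (free_cover C K j) (ident C x) a = id a"
  proof (rule free_hom_eqI[where f = "act (free_cover C K j) (ident C x)" and g = id,
        OF abelian_free_Abelian_group])
    show "act (free_cover C K j) (ident C x) \<in>
      hom (free_Abelian_group (gens C K j x)) (free_Abelian_group (gens C K j x))"
      using act_free_cover_hom[OF j ident_in[OF x]] by (simp add: x src_ident tgt_ident)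
    show "id \<in> hom (free_Abelian_group (gens C K j x)) (free_Abelian_group (gens C K j x))"
      by (auto simp: hom_def)
    fix s assume "s \<in> gens C K j x"
    then show "act (free_cover C K j) (ident C x) (frag_of s) = id (frag_of s)"
      by (auto simp: gens_def act_free_cover_of[OF j] cmp_ident)
  qed (use a in simp)
  then show "act (free_cover C K j) (ident C x) a = a" by simp
next
  fix m n a assume m: "m \<in> mors C" and n: "n \<in> mors C" and mn: "tgt C m = src C n"
    and a: "a \<in> carrier (fib (free_cover C K j) (src C m))"
  have "act (free_cover C K j) (cmp C m n) a = (act (free_cover C K j) n \<circ> act (free_cover C K j) m) a"
  proof (rule free_hom_eqI[where f = "act (free_cover C K j) (cmp C m n)"
        and g = "act (free_cover C K j) n \<circ> act (free_cover C K j) m", OF abelian_free_Abelian_group])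
    show "act (free_cover C K j) (cmp C m n) \<in>
      hom (free_Abelian_group (gens C K j (src C m))) (free_Abelian_group (gens C K j (tgt C n)))"
      using act_free_cover_hom[OF j cmp_in[OF m n mn], of K] by (simp add: m n mn src_cmp tgt_cmp)
    show "act (free_cover C K j) n \<circ> act (free_cover C K j) m \<in>
      hom (free_Abelian_group (gens C K j (src C m))) (free_Abelian_group (gens C K j (tgt C n)))"
      using hom_compose[OF act_free_cover_hom[OF j m, of K]] act_free_cover_hom[OF j n, of K]
      by (simp add: mn)
    fix s assume "s \<in> gens C K j (src C m)"
    then show "act (free_cover C K j) (cmp C m n) (frag_of s) =
        (act (free_cover C K j) n \<circ> act (free_cover C K j) m) (frag_of s)"
      by (auto simp: gens_def act_free_cover_of[OF j] cmp_assoc m n mn)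
  qed (use a in simp)
  then show "act (free_cover C K j) (cmp C m n) a = act (free_cover C K j) n (act (free_cover C K j) m a)"
    by simp
qed

lemma free_cover_extend:
  assumes j: "inj j" and M: "cat_module C M"
    and u: "\<And>x k. \<lbrakk>x \<in> objs C; k \<in> carrier (fib K x)\<rbrakk> \<Longrightarrow> u x k \<in> carrier (fib M x)"
  obtains \<psi> where "nat_trans C (free_cover C K j) M \<psi>"
    and "\<And>m k. \<lbrakk>m \<in> mors C; k \<in> carrier (fib K (src C m))\<rbrakk> \<Longrightarrow>
          \<psi> (tgt C m) (frag_of (j (m, k))) = act M m (u (src C m) k)"
proof -
  define v where "v t = act M (fst (inv_into UNIV j t)) (u (src C (fst (inv_into UNIV j t))) (snd (inv_into UNIV j t)))" for t
  have v [simp]: "v (j (m, k)) = act M m (u (src C m) k)" for m k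
    using j by (simp add: v_def)
  have "\<exists>h. h \<in> hom (free_Abelian_group (gens C K j x)) (fib M x) \<and> (\<forall>s\<in>gens C K j x. h (frag_of s) = v s)"
    if x: "x \<in> objs C" for x
  proof -
    interpret comm_group "fib M x" using M x by (auto simp: cat_module_def)
    have "v ` gens C K j x \<subseteq> carrier (fib M x)"
    proof (clarsimp simp: gens_def)
      fix m k assume "m \<in> mors C" "k \<in> carrier (fib K (src C m))" "x = tgt C m"
      then show "act M m (u (src C m) k) \<in> carrier (fib M (tgt C m))"
        using cat_module_act_in[OF M] u[OF src_in] by blast
    qed
    then show ?thesis using free_Abelian_group_universal[of v "gens C K j x"] by metis
  qed
  then obtain \<psi> where \<psi>: "\<And>x. x \<in> objs C \<Longrightarrow> \<psi> x \<in> hom (free_Abelian_group (gens C K j x)) (fib M x)"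
    and \<psi>v: "\<And>x s. \<lbrakk>x \<in> objs C; s \<in> gens C K j x\<rbrakk> \<Longrightarrow> \<psi> x (frag_of s) = v s"
    by metis
  show ?thesis
  proof
    fix m k assume "m \<in> mors C" "k \<in> carrier (fib K (src C m))"
    then show "\<psi> (tgt C m) (frag_of (j (m, k))) = act M m (u (src C m) k)"
      using \<psi>v[OF tgt_in gensI] by simp
  next
    show "nat_trans C (free_cover C K j) M \<psi>"
      unfolding nat_trans_def
    proof (intro conjI ballI)
      show "\<psi> x \<in> hom (fib (free_cover C K j) x) (fib M x)" if "x \<in> objs C" for x
        using \<psi>[OF that] by simp
      fix m c assume m: "m \<in> mors C" and c: "c \<in> carrier (fib (free_cover C K j) (src C m))"
      have "(\<psi> (tgt C m) \<circ> act (free_cover C K j) m) c = (act M m \<circ> \<psi> (src C m)) c"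
      proof (rule free_hom_eqI[where S = "gens C K j (src C m)" and H = "fib M (tgt C m)"])
        show "comm_group (fib M (tgt C m))" using M tgt_in[OF m] by (auto simp: cat_module_def)
        show "\<psi> (tgt C m) \<circ> act (free_cover C K j) m \<in> hom (free_Abelian_group (gens C K j (src C m))) (fib M (tgt C m))"
          by (rule hom_compose[OF act_free_cover_hom[OF j m] \<psi>[OF tgt_in[OF m]]])
        show "act M m \<circ> \<psi> (src C m) \<in> hom (free_Abelian_group (gens C K j (src C m))) (fib M (tgt C m))"
          by (rule hom_compose[OF \<psi>[OF src_in[OF m]]]) (use M m in \<open>auto simp: cat_module_def\<close>)
        fix s assume s: "s \<in> gens C K j (src C m)"
        then obtain n k where n: "n \<in> mors C" "k \<in> carrier (fib K (src C n))"
          and nm: "tgt C n = src C m" and [simp]: "s = j (n, k)"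
          by (auto simp: gens_def)
        have "u (src C n) k \<in> carrier (fib M (src C n))" using n u src_in by blast
        moreover have "j (cmp C n m, k) \<in> gens C K j (tgt C m)"
          using gensI[OF cmp_in[OF n(1) m nm], of k K j] n m nm by (simp add: src_cmp tgt_cmp)
        ultimately show "(\<psi> (tgt C m) \<circ> act (free_cover C K j) m) (frag_of s) = (act M m \<circ> \<psi> (src C m)) (frag_of s)"
          using \<psi>v[OF tgt_in[OF m]] M \<psi>v[OF src_in[OF m] s] n m nm
          by (auto simp: act_free_cover_of[OF j] src_cmp tgt_cmp cat_module_def)
      qed (use c in simp)
      then show "\<psi> (tgt C m) (act (free_cover C K j) m c) = act M m (\<psi> (src C m) c)" by simp
    qed
  qed
qed

text \<open>Two maps out of a free module agree if they agree on the basis elements \<open>j (ident x, k)\<close>.\<close>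

lemma free_cover_eqI:
  assumes j: "inj j" and N: "cat_module C N"
    and f: "nat_trans C (free_cover C K j) N f" and g: "nat_trans C (free_cover C K j) N g"
    and eq: "\<And>x k. \<lbrakk>x \<in> objs C; k \<in> carrier (fib K x)\<rbrakk> \<Longrightarrow>
        f x (frag_of (j (ident C x, k))) = g x (frag_of (j (ident C x, k)))"
    and x: "x \<in> objs C" and c: "c \<in> carrier (fib (free_cover C K j) x)"
  shows "f x c = g x c"
proof (rule free_hom_eqI[where S = "gens C K j x" and H = "fib N x"])
  show "comm_group (fib N x)" using N x by (auto simp: cat_module_def)
  fix s assume "s \<in> gens C K j x"
  then obtain m k where m: "m \<in> mors C" "tgt C m = x" "k \<in> carrier (fib K (src C m))" "s = j (m, k)"
    by (auto simp: gens_def)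
  have s: "frag_of s = act (free_cover C K j) m (frag_of (j (ident C (src C m), k)))"
    by (simp add: act_free_cover_of[OF j] m ident_cmp)
  have in': "frag_of (j (ident C (src C m), k)) \<in> carrier (fib (free_cover C K j) (src C m))"
    using gensI[OF ident_in[OF src_in[OF m(1)]], of k K j] m by (simp add: src_in src_ident tgt_ident)
  show "f x (frag_of s) = g x (frag_of s)"
    using f g m(1) in' eq[OF src_in[OF m(1)] m(3)]
    by (simp add: s nat_trans_def flip: m(2))
qed (use f g x c in \<open>auto simp: nat_trans_def\<close>)

lemma free_cover_lifts:
  assumes j: "inj j" and M: "cat_module C M" and N: "cat_module C N"
    and \<pi>: "nat_trans C M N \<pi>" "surjective C M N \<pi>" and \<phi>: "nat_trans C (free_cover C K j) N \<phi>"
  obtains \<psi> where "nat_trans C (free_cover C K j) M \<psi>"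
    and "\<And>x c. \<lbrakk>x \<in> objs C; c \<in> carrier (fib (free_cover C K j) x)\<rbrakk> \<Longrightarrow> \<pi> x (\<psi> x c) = \<phi> x c"
proof -
  have base: "frag_of (j (ident C x, k)) \<in> carrier (fib (free_cover C K j) x)"
    if "x \<in> objs C" "k \<in> carrier (fib K x)" for x k
    using gensI[OF ident_in[OF that(1)], of k K j] that by (simp add: src_ident tgt_ident)
  have "\<exists>y. y \<in> carrier (fib M x) \<and> \<pi> x y = \<phi> x (frag_of (j (ident C x, k)))"
    if x: "x \<in> objs C" and k: "k \<in> carrier (fib K x)" for x k
  proof -
    have "\<phi> x (frag_of (j (ident C x, k))) \<in> carrier (fib N x)"
      using nat_trans_in[OF \<phi> x base[OF x k]] .
    then show ?thesis using \<pi>(2) x by (force simp: surjective_def)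
  qed
  then obtain u where u: "\<And>x k. \<lbrakk>x \<in> objs C; k \<in> carrier (fib K x)\<rbrakk> \<Longrightarrow> u x k \<in> carrier (fib M x)"
    and \<pi>u: "\<And>x k. \<lbrakk>x \<in> objs C; k \<in> carrier (fib K x)\<rbrakk> \<Longrightarrow> \<pi> x (u x k) = \<phi> x (frag_of (j (ident C x, k)))"
    by metis
  obtain \<psi> where \<psi>: "nat_trans C (free_cover C K j) M \<psi>"
    and \<psi>u: "\<And>m k. \<lbrakk>m \<in> mors C; k \<in> carrier (fib K (src C m))\<rbrakk> \<Longrightarrow>
          \<psi> (tgt C m) (frag_of (j (m, k))) = act M m (u (src C m) k)"
    using free_cover_extend[where K = K and u = u, OF j M u] by blast
  show ?thesis
  proof
    show "nat_trans C (free_cover C K j) M \<psi>" by fact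
    fix x c assume x: "x \<in> objs C" and c: "c \<in> carrier (fib (free_cover C K j) x)"
    have "(\<lambda>x. \<pi> x \<circ> \<psi> x) x c = \<phi> x c"
    proof (rule free_cover_eqI[OF j N _ \<phi> _ x c])
      show "nat_trans C (free_cover C K j) N (\<lambda>x. \<pi> x \<circ> \<psi> x)"
        by (rule nat_trans_comp[OF \<psi> \<pi>(1)])
      fix y k assume y: "y \<in> objs C" "k \<in> carrier (fib K y)"
      then have "\<psi> y (frag_of (j (ident C y, k))) = u y k"
        using \<psi>u[OF ident_in, of y k] M u[OF y] by (simp add: src_ident tgt_ident cat_module_def)
      then show "(\<lambda>x. \<pi> x \<circ> \<psi> x) y (frag_of (j (ident C y, k))) = \<phi> y (frag_of (j (ident C y, k)))"
        by (simp add: \<pi>u y)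
    qed
    then show "\<pi> x (\<psi> x c) = \<phi> x c" by simp
  qed
qed

lemma projective_free_cover:
  fixes j :: "'m \<times> 'k \<Rightarrow> 't"
  assumes j: "inj j"
  shows "projective C (free_cover C K j)"
  unfolding projective_def
proof (intro conjI allI impI)
  show "cat_module C (free_cover C K j)" by (rule cat_module_free_cover[OF j])
  fix M :: "('o, 'm, 'm \<times> ('t \<Rightarrow>\<^sub>0 int) \<Rightarrow>\<^sub>0 int) cmod" and N :: "('o, 'm, 't \<Rightarrow>\<^sub>0 int) cmod" and \<pi> \<phi>
  assume *: "cat_module C M \<and> cat_module C N \<and> nat_trans C M N \<pi> \<and> surjective C M N \<pi> \<and>
       nat_trans C (free_cover C K j) N \<phi>"
  show "\<exists>\<psi>. nat_trans C (free_cover C K j) M \<psi> \<and>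
     (\<forall>x\<in>objs C. \<forall>p\<in>carrier (fib (free_cover C K j) x). \<pi> x (\<psi> x p) = \<phi> x p)"
    using free_cover_lifts[OF j, of M N \<pi> K \<phi>] * by metis
qed

lemma free_cover_onto:
  assumes j: "inj j" and K: "cat_module C K"
  obtains \<epsilon> where "nat_trans C (free_cover C K j) K \<epsilon>" "surjective C (free_cover C K j) K \<epsilon>"
proof -
  obtain \<epsilon> where \<epsilon>: "nat_trans C (free_cover C K j) K \<epsilon>"
    and \<epsilon>k: "\<And>m k. \<lbrakk>m \<in> mors C; k \<in> carrier (fib K (src C m))\<rbrakk> \<Longrightarrow>
          \<epsilon> (tgt C m) (frag_of (j (m, k))) = act K m k"
    using free_cover_extend[where K = K and u = "\<lambda>x k. k", OF j K] by blast
  have "surjective C (free_cover C K j) K \<epsilon>"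
    unfolding surjective_def
  proof (intro ballI equalityI subsetI)
    fix x k assume x: "x \<in> objs C"
    { assume "k \<in> \<epsilon> x ` carrier (fib (free_cover C K j) x)"
      then show "k \<in> carrier (fib K x)"
        using \<epsilon> x by (auto simp: nat_trans_def hom_def) }
    assume k: "k \<in> carrier (fib K x)"
    have "\<epsilon> x (frag_of (j (ident C x, k))) = k"
      using \<epsilon>k[OF ident_in[OF x], of k] k K x by (simp add: src_ident tgt_ident cat_module_def)
    moreover have "frag_of (j (ident C x, k)) \<in> carrier (fib (free_cover C K j) x)"
      using gensI[OF ident_in[OF x], of k K j] x k by (simp add: src_ident tgt_ident)
    ultimately show "k \<in> \<epsilon> x ` carrier (fib (free_cover C K j) x)" by (metis image_eqI)
  qed
  with \<epsilon> show ?thesis using that by blast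
qed

lemma projective_lifts:
  fixes P :: "('o, 'm, 'p) cmod"
  assumes P: "projective C P" and M: "cat_module C M" and N: "cat_module C N"
    and \<pi>: "nat_trans C M N \<pi>" "surjective C M N \<pi>" and \<phi>: "nat_trans C P N \<phi>"
  obtains \<psi> where "nat_trans C P M \<psi>"
    and "\<And>x p. \<lbrakk>x \<in> objs C; p \<in> carrier (fib P x)\<rbrakk> \<Longrightarrow> \<pi> x (\<psi> x p) = \<phi> x p"
proof -
  have P': "cat_module C P" using P by (simp add: projective_def)
  let ?F = "free_cover C P (\<lambda>z. z)"
  have inj: "inj (\<lambda>z :: 'm \<times> 'p. z)" by simp
  obtain \<epsilon> where \<epsilon>: "nat_trans C ?F P \<epsilon>" "surjective C ?F P \<epsilon>"
    using free_cover_onto[of "\<lambda>z. z" P] P' by auto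
  have "nat_trans C P P (\<lambda>x p. p)"
    by (auto simp: nat_trans_def hom_def)
  then obtain \<sigma> where \<sigma>: "nat_trans C P ?F \<sigma>" "\<And>x p. \<lbrakk>x \<in> objs C; p \<in> carrier (fib P x)\<rbrakk> \<Longrightarrow> \<epsilon> x (\<sigma> x p) = p"
    using that P[unfolded projective_def, THEN conjunct2, rule_format, of ?F P \<epsilon> "\<lambda>x p. p"]
      \<epsilon> P' cat_module_free_cover[of "\<lambda>z. z" P] inj by blast
  obtain \<psi> where \<psi>: "nat_trans C ?F M \<psi>"
    "\<And>x c. \<lbrakk>x \<in> objs C; c \<in> carrier (fib ?F x)\<rbrakk> \<Longrightarrow> \<pi> x (\<psi> x c) = (\<phi> x \<circ> \<epsilon> x) c"
    using free_cover_lifts[OF inj M N \<pi> nat_trans_comp[OF \<epsilon>(1) \<phi>]] by blast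
  show ?thesis
  proof
    show "nat_trans C P M (\<lambda>x. \<psi> x \<circ> \<sigma> x)" by (rule nat_trans_comp[OF \<sigma>(1) \<psi>(1)])
    fix x p assume x: "x \<in> objs C" "p \<in> carrier (fib P x)"
    then have "\<sigma> x p \<in> carrier (fib ?F x)" using nat_trans_in[OF \<sigma>(1)] by blast
    then show "\<pi> x ((\<psi> x \<circ> \<sigma> x) p) = \<phi> x p" using \<psi>(2)[OF x(1)] \<sigma>(2)[OF x] by simp
  qed
qed

end

definition ker_module :: "('o, 'm, 'a) cmod \<Rightarrow> ('o, 'm, 'b) cmod \<Rightarrow> ('o \<Rightarrow> 'a \<Rightarrow> 'b) \<Rightarrow> ('o, 'm, 'a) cmod" where
  "ker_module A B \<phi> = A\<lparr>fib := (\<lambda>x. (fib A x)\<lparr>carrier := kernel (fib A x) (fib B x) (\<phi> x)\<rparr>)\<rparr>"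

context category begin

lemma nat_trans_group_hom:
  assumes "cat_module C A" "cat_module C B" "nat_trans C A B \<phi>" "x \<in> objs C"
  shows "group_hom (fib A x) (fib B x) (\<phi> x)"
  using assms by (auto simp: cat_module_def nat_trans_def group_hom_def group_hom_axioms_def comm_group_def)

lemma cat_module_ker_module:
  assumes A: "cat_module C A" and B: "cat_module C B" and \<phi>: "nat_trans C A B \<phi>"
  shows "cat_module C (ker_module A B \<phi>)"
  unfolding cat_module_def
proof (intro conjI ballI impI)
  fix x assume x: "x \<in> objs C"
  interpret group_hom "fib A x" "fib B x" "\<phi> x" by (rule nat_trans_group_hom[OF A B \<phi> x])
  interpret comm_group "fib A x" using A x by (simp add: cat_module_def)
  show "comm_group (fib (ker_module A B \<phi>) x)"
    using group.group_comm_groupI[OF subgroup.subgroup_is_group[OF subgroup_kernel]]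
    by (auto simp: ker_module_def kernel_def m_comm)
next
  fix m assume m: "m \<in> mors C"
  interpret s: group_hom "fib A (src C m)" "fib B (src C m)" "\<phi> (src C m)"
    by (rule nat_trans_group_hom[OF A B \<phi> src_in[OF m]])
  interpret b: group_hom "fib B (src C m)" "fib B (tgt C m)" "act B m"
    using B m src_in[OF m] tgt_in[OF m]
    by (auto simp: cat_module_def group_hom_def group_hom_axioms_def comm_group_def)
  have h: "act A m \<in> hom (fib A (src C m)) (fib A (tgt C m))" using A m by (auto simp: cat_module_def)
  have n: "\<phi> (tgt C m) (act A m a) = act B m (\<phi> (src C m) a)" if "a \<in> carrier (fib A (src C m))" for a
    using \<phi> m that by (auto simp: nat_trans_def)
  show "act (ker_module A B \<phi>) m \<in> hom (fib (ker_module A B \<phi>) (src C m)) (fib (ker_module A B \<phi>) (tgt C m))"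
    using h n by (auto simp: ker_module_def hom_def kernel_def Pi_iff)
next
  have sub: "a \<in> carrier (fib (ker_module A B \<phi>) x) \<Longrightarrow> a \<in> carrier (fib A x)" for a x
    by (simp add: ker_module_def kernel_def)
  have act: "act (ker_module A B \<phi>) = act A" by (simp add: ker_module_def)
  show "act (ker_module A B \<phi>) (ident C x) a = a"
    if "x \<in> objs C" "a \<in> carrier (fib (ker_module A B \<phi>) x)" for x a
    using A that(1) sub[OF that(2)] unfolding act cat_module_def by blast
  show "act (ker_module A B \<phi>) (cmp C m n) a = act (ker_module A B \<phi>) n (act (ker_module A B \<phi>) m a)"
    if "m \<in> mors C" "n \<in> mors C" "tgt C m = src C n" "a \<in> carrier (fib (ker_module A B \<phi>) (src C m))"
    for m n a
    using A that(1-3) sub[OF that(4)] unfolding act cat_module_def by blast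
qed

lemma projective_resolution_exists:
  fixes A :: "('o, 'm, 'a) cmod"
  assumes A: "cat_module C A"
  shows "\<exists>(P :: nat \<Rightarrow> ('o, 'm, ('m, 'a) gen \<Rightarrow>\<^sub>0 int) cmod) d \<epsilon>. projective_resolution C A P d \<epsilon>"
proof -
  define j0 :: "'m \<times> 'a \<Rightarrow> ('m, 'a) gen" where "j0 = (\<lambda>(m, k). Base m k)"
  define code :: "(('m, 'a) gen \<Rightarrow>\<^sub>0 int) \<Rightarrow> (('m, 'a) gen \<times> int) list" where
    "code c = (SOME xs. set xs = (\<lambda>t. (t, Poly_Mapping.lookup c t)) ` Poly_Mapping.keys c)" for c
  define j :: "'m \<times> (('m, 'a) gen \<Rightarrow>\<^sub>0 int) \<Rightarrow> ('m, 'a) gen" where "j = (\<lambda>(m, k). Step m (code k))"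
  have code: "set (code c) = (\<lambda>t. (t, Poly_Mapping.lookup c t)) ` Poly_Mapping.keys c" for c
    unfolding code_def by (rule someI_ex) (simp add: finite_list)
  have "c = d" if "code c = code d" for c d
  proof (rule poly_mapping_eqI)
    fix t
    have "(\<lambda>t. (t, Poly_Mapping.lookup c t)) ` Poly_Mapping.keys c = (\<lambda>t. (t, Poly_Mapping.lookup d t)) ` Poly_Mapping.keys d"
      using code that by metis
    then show "Poly_Mapping.lookup c t = Poly_Mapping.lookup d t"
      by (cases "t \<in> Poly_Mapping.keys c"; cases "t \<in> Poly_Mapping.keys d")
        (auto simp: set_eq_iff image_iff in_keys_iff)
  qed
  then have j: "inj j" by (auto simp: j_def inj_def)
  have j0: "inj j0" by (auto simp: j0_def inj_def)
  obtain \<epsilon> where \<epsilon>: "nat_trans C (free_cover C A j0) A \<epsilon>" "surjective C (free_cover C A j0) A \<epsilon>"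
    using free_cover_onto[OF j0 A] by blast
  define e where "e K = (SOME \<epsilon>. nat_trans C (free_cover C K j) K \<epsilon> \<and> surjective C (free_cover C K j) K \<epsilon>)"
    for K :: "('o, 'm, ('m, 'a) gen \<Rightarrow>\<^sub>0 int) cmod"
  have e: "nat_trans C (free_cover C K j) K (e K) \<and> surjective C (free_cover C K j) K (e K)"
    if "cat_module C K" for K
    unfolding e_def using free_cover_onto[OF j that] by (metis (mono_tags, lifting) someI_ex)
  define s where "s = (\<lambda>(P, K). (free_cover C K j, ker_module (free_cover C K j) P (e K)))"
  define PK where "PK n = (s ^^ n) (free_cover C A j0, ker_module (free_cover C A j0) A \<epsilon>)" for n
  define P where "P n = fst (PK n)" for n
  define K where "K n = snd (PK n)" for n
  have P0: "P 0 = free_cover C A j0" and K0: "K 0 = ker_module (P 0) A \<epsilon>"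
    by (simp_all add: P_def K_def PK_def)
  have PS: "P (Suc n) = free_cover C (K n) j" and KS: "K (Suc n) = ker_module (P (Suc n)) (P n) (e (K n))" for n
    by (simp_all add: P_def K_def PK_def s_def case_prod_beta)
  have proj: "projective C (P n)" for n
    by (cases n) (simp_all add: P0 PS projective_free_cover j j0)
  then have modP: "cat_module C (P n)" for n by (simp add: projective_def)
  define sub where "sub n \<longleftrightarrow> cat_module C (K n) \<and> act (K n) = act (P n) \<and>
     (\<forall>x. \<exists>S \<subseteq> carrier (fib (P n) x). fib (K n) x = (fib (P n) x)\<lparr>carrier := S\<rparr>)" for n
  have incl: "nat_trans C (P (Suc n)) (P n) (e (K n))" if "sub n" for n
  proof -
    have "nat_trans C (P (Suc n)) (K n) (e (K n))" using that e by (simp add: sub_def PS)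
    moreover have "nat_trans C (K n) (P n) (\<lambda>x k. k)"
      unfolding nat_trans_def
    proof (intro conjI ballI)
      fix x
      have "\<exists>S \<subseteq> carrier (fib (P n) x). fib (K n) x = (fib (P n) x)\<lparr>carrier := S\<rparr>"
        using that unfolding sub_def by (elim conjE) (erule spec)
      then obtain S where "S \<subseteq> carrier (fib (P n) x)" "fib (K n) x = (fib (P n) x)\<lparr>carrier := S\<rparr>"
        by (elim exE conjE)
      then show "(\<lambda>k. k) \<in> hom (fib (K n) x) (fib (P n) x)" by (auto simp: hom_def)
    qed (use that in \<open>simp add: sub_def\<close>)
    ultimately show ?thesis using nat_trans_comp[of "P (Suc n)" "K n" "e (K n)" "P n" "\<lambda>x k. k"]
      by (simp add: comp_def)
  qed
  have sub: "sub n" for n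
  proof (induction n)
    case 0
    have "cat_module C (K 0)"
      unfolding K0 using cat_module_ker_module[OF modP[of 0] A] \<epsilon>(1) by (simp add: P0)
    moreover have "fib (K 0) x = (fib (P 0) x)\<lparr>carrier := kernel (fib (P 0) x) (fib A x) (\<epsilon> x)\<rparr>" for x
      by (simp add: K0 ker_module_def)
    moreover have "kernel (fib (P 0) x) (fib A x) (\<epsilon> x) \<subseteq> carrier (fib (P 0) x)" for x
      by (auto simp: kernel_def)
    moreover have "act (K 0) = act (P 0)" by (simp add: K0 ker_module_def)
    ultimately show ?case unfolding sub_def by (intro conjI allI exI)
  next
    case (Suc n)
    have "cat_module C (K (Suc n))"
      unfolding KS by (rule cat_module_ker_module[OF modP modP incl[OF Suc]])
    moreover have "fib (K (Suc n)) x =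
        (fib (P (Suc n)) x)\<lparr>carrier := kernel (fib (P (Suc n)) x) (fib (P n) x) (e (K n) x)\<rparr>" for x
      by (simp add: KS ker_module_def)
    moreover have "kernel (fib (P (Suc n)) x) (fib (P n) x) (e (K n) x) \<subseteq> carrier (fib (P (Suc n)) x)" for x
      by (auto simp: kernel_def)
    moreover have "act (K (Suc n)) = act (P (Suc n))" by (simp add: KS ker_module_def)
    ultimately show ?case unfolding sub_def by (intro conjI allI exI)
  qed
  have im: "e (K n) x ` carrier (fib (P (Suc n)) x) = carrier (fib (K n) x)" if "x \<in> objs C" for n x
    using e[of "K n"] sub[of n] that unfolding sub_def surjective_def PS by blast
  have "projective_resolution C A P (\<lambda>n. e (K n)) \<epsilon>"
    unfolding projective_resolution_def
  proof (intro conjI allI ballI)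
    show "nat_trans C (P 0) A \<epsilon>" "surjective C (P 0) A \<epsilon>" using \<epsilon> by (simp_all add: P0)
  next
    fix x assume x: "x \<in> objs C"
    show "e (K 0) x ` carrier (fib (P 1) x) = kernel (fib (P 0) x) (fib A x) (\<epsilon> x)"
      using im[OF x, of 0] by (simp add: K0 ker_module_def)
    show "e (K (Suc n)) x ` carrier (fib (P (Suc (Suc n))) x) =
        kernel (fib (P (Suc n)) x) (fib (P n) x) (e (K n) x)" for n
      using im[OF x, of "Suc n"] by (simp add: KS ker_module_def)
  qed (use proj incl sub in auto)
  then show ?thesis by blast
qed

end


section \<open>The category \<open>LL G\<close> and the quotient groupoid\<close>

context ordered_groupoid begin


lemma gdom_mono: "\<lbrakk>x \<in> elts G; y \<in> elts G; gle G x y\<rbrakk> \<Longrightarrow> gle G (gdom G x) (gdom G y)"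
  unfolding gdom_def by (rule OG2) (auto simp: OG1 ginv_in gdom_ginv[unfolded gdom_def] gdom_ginv)

lemma gran_mono: "\<lbrakk>x \<in> elts G; y \<in> elts G; gle G x y\<rbrakk> \<Longrightarrow> gle G (gran G x) (gran G y)"
  unfolding gran_def[of G] by (rule OG2) (auto simp: OG1 ginv_in gran_ginv)

lemma ident_gran: "e \<in> idents G \<Longrightarrow> gran G e = e" and ident_gdom: "e \<in> idents G \<Longrightarrow> gdom G e = e"
  and ident_in_elts: "e \<in> idents G \<Longrightarrow> e \<in> elts G"
  unfolding idents_def using gran_gdom by (metis (mono_tags) mem_Collect_eq)+

lemma gdom_idents [simp]: "g \<in> elts G \<Longrightarrow> gdom G g \<in> idents G" and gran_idents [simp]: "g \<in> elts G \<Longrightarrow> gran G g \<in> idents G"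
  by (auto simp: idents_def gdom_in gran_in gdom_gdom gdom_gran)

lemma restr:
  assumes "x \<in> elts G" "e \<in> idents G" "gle G e (gdom G x)"
  shows "restriction G e x \<in> elts G" "gdom G (restriction G e x) = e" "gle G (restriction G e x) x"
  using theI'[OF OG3[OF assms]] by (simp_all add: restriction_def)

lemma restr_eq: "\<lbrakk>x \<in> elts G; y \<in> elts G; gle G y x\<rbrakk> \<Longrightarrow> restriction G (gdom G y) x = y"
  using OG3[of x "gdom G y"] gdom_mono unfolding restriction_def by (intro the1_equality) auto

lemma corestr:
  assumes "x \<in> elts G" "e \<in> idents G" "gle G e (gran G x)"
  shows "corestriction G x e \<in> elts G" "gran G (corestriction G x e) = e" "gle G (corestriction G x e) x"
  using theI'[OF OG4[OF assms]] by (simp_all add: corestriction_def)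

lemma corestr_eq: "\<lbrakk>x \<in> elts G; y \<in> elts G; gle G y x\<rbrakk> \<Longrightarrow> corestriction G x (gran G y) = y"
  using OG4[of x "gran G y"] gran_mono unfolding corestriction_def by (intro the1_equality) auto

lemma restr_unique: "\<lbrakk>x \<in> elts G; y \<in> elts G; z \<in> elts G; gle G y x; gle G z x; gdom G y = gdom G z\<rbrakk> \<Longrightarrow> y = z"
  by (metis restr_eq)
lemma corestr_unique: "\<lbrakk>x \<in> elts G; y \<in> elts G; z \<in> elts G; gle G y x; gle G z x; gran G y = gran G z\<rbrakk> \<Longrightarrow> y = z"
  by (metis corestr_eq)

lemma ident_below: "\<lbrakk>e \<in> idents G; k \<in> elts G; gle G k e\<rbrakk> \<Longrightarrow> k \<in> idents G"
proof -
  assume a: "e \<in> idents G" "k \<in> elts G" "gle G k e"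
  have "gle G (gdom G k) e" using gdom_mono[of k e] a by (simp add: ident_gdom ident_in_elts)
  then have "k = gdom G k" using restr_unique[of e k "gdom G k"] a by (simp add: ident_in_elts gdom_in gdom_gdom)
  then show ?thesis using gdom_idents[OF a(2)] by simp
qed

lemma category_LL: "category (LL G)"
proof
  fix m n p
  { assume "m \<in> mors (LL G)"
    then obtain e g where m: "m = (e, g)" "e \<in> idents G" "g \<in> elts G" "gle G (gdom G g) e" by (auto simp: LL_def)
    then show "src (LL G) m \<in> objs (LL G)" "tgt (LL G) m \<in> objs (LL G)"
      by (auto simp: LL_def)
    show "cmp (LL G) (ident (LL G) (src (LL G) m)) m = m"
      using m corestr_eq[of e "gdom G g"] by (simp add: LL_def ident_in_elts gdom_in gran_gdom gdom_gmul_left)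
    show "cmp (LL G) m (ident (LL G) (tgt (LL G) m)) = m"
      using m corestr_eq[of g g] by (simp add: LL_def gdom_gran gle_refl gran_gmul_right)
    assume n: "n \<in> mors (LL G)" "tgt (LL G) m = src (LL G) n"
    then obtain h where n: "n = (gran G g, h)" "h \<in> elts G" "gle G (gdom G h) (gran G g)" using m by (auto simp: LL_def)
    note c = corestr[OF m(3) gdom_idents[OF n(2)] n(3)]
    have "gle G (gdom G (corestriction G g (gdom G h))) e"
      by (rule gle_trans[of _ "gdom G g"]) (use c m in \<open>auto simp: gdom_in ident_in_elts intro: gdom_mono\<close>)
    then show 1: "cmp (LL G) m n \<in> mors (LL G)" "src (LL G) (cmp (LL G) m n) = src (LL G) m"
       "tgt (LL G) (cmp (LL G) m n) = tgt (LL G) n"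
      using m n c by (auto simp: LL_def gmul_in gdom_gmul gran_gmul)
    assume p: "p \<in> mors (LL G)" "tgt (LL G) n = src (LL G) p"
    then obtain k where p: "p = (gran G h, k)" "k \<in> elts G" "gle G (gdom G k) (gran G h)" using n by (auto simp: LL_def)
    note d = corestr[OF n(2) gdom_idents[OF p(2)] p(3)]
    let ?h = "corestriction G h (gdom G k)"
    have l: "gle G (gdom G ?h) (gdom G h)" using d n by (auto intro: gdom_mono)
    have l': "gle G (gdom G ?h) (gran G g)" by (rule gle_trans[OF _ _ _ l n(3)]) (use m n d in \<open>auto simp: gdom_in gran_in\<close>)
    have l'': "gle G (gdom G ?h) (gran G (corestriction G g (gdom G h)))" using c l by simp
    note a = corestr[OF m(3) gdom_idents[OF d(1)] l']
    note b = corestr[OF c(1) gdom_idents[OF d(1)] l'']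
    have ab: "corestriction G (corestriction G g (gdom G h)) (gdom G ?h) = corestriction G g (gdom G ?h)"
      by (rule corestr_unique[of g]) (use a b c m gle_trans[OF b(1) c(1) m(3)] in auto)
    have "corestriction G (gmul G (corestriction G g (gdom G h)) h) (gdom G k) = gmul G (corestriction G g (gdom G ?h)) ?h"
    proof (rule corestr_unique[of "gmul G (corestriction G g (gdom G h)) h"])
      show gh: "gmul G (corestriction G g (gdom G h)) h \<in> elts G" using c n by (simp add: gmul_in)
      have k: "gle G (gdom G k) (gran G (gmul G (corestriction G g (gdom G h)) h))" using c n p by (simp add: gran_gmul)
      note q = corestr[OF gh gdom_idents[OF p(2)] k]
      show "corestriction G (gmul G (corestriction G g (gdom G h)) h) (gdom G k) \<in> elts G"
        "gle G (corestriction G (gmul G (corestriction G g (gdom G h)) h) (gdom G k)) (gmul G (corestriction G g (gdom G h)) h)"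
        using q by auto
      show "gmul G (corestriction G g (gdom G ?h)) ?h \<in> elts G" using a d by (simp add: gmul_in)
      show "gle G (gmul G (corestriction G g (gdom G ?h)) ?h) (gmul G (corestriction G g (gdom G h)) h)"
        by (rule OG2) (use a b c d n ab in auto)
      show "gran G (corestriction G (gmul G (corestriction G g (gdom G h)) h) (gdom G k)) = gran G (gmul G (corestriction G g (gdom G ?h)) ?h)"
        using q a d by (simp add: gran_gmul)
    qed
    then show "cmp (LL G) (cmp (LL G) m n) p = cmp (LL G) m (cmp (LL G) n p)"
      using m n p a d by (simp add: LL_def gmul_assoc gdom_gmul)
  }
  fix x assume "x \<in> objs (LL G)"
  then show "ident (LL G) x \<in> mors (LL G)" "src (LL G) (ident (LL G) x) = x" "tgt (LL G) (ident (LL G) x) = x"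
    by (auto simp: LL_def ident_gdom ident_gran ident_in_elts gle_refl)
qed

lemma betaI: "\<lbrakk>g \<in> elts G; h \<in> elts G; k \<in> elts G; gle G k g; gle G k h\<rbrakk> \<Longrightarrow> (g, h) \<in> beta G"
  by (auto simp: beta_def)

lemma beta_gdom: "(g, h) \<in> beta G \<Longrightarrow> (gdom G g, gdom G h) \<in> beta G"
  by (force simp: beta_def gdom_in intro: gdom_mono)
lemma beta_gran: "(g, h) \<in> beta G \<Longrightarrow> (gran G g, gran G h) \<in> beta G"
  by (force simp: beta_def gran_in intro: gran_mono)
lemma beta_ginv: "(g, h) \<in> beta G \<Longrightarrow> (ginv G g, ginv G h) \<in> beta G"
  by (force simp: beta_def ginv_in intro: OG1)

lemma corestr_mono: "\<lbrakk>g \<in> elts G; k \<in> elts G; gle G k g; f \<in> idents G; w \<in> idents G; gle G w f; gle G f (gran G g); gle G w (gran G k)\<rbrakk>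
  \<Longrightarrow> gle G (corestriction G k w) (corestriction G g f)"
proof -
  assume a: "g \<in> elts G" "k \<in> elts G" "gle G k g" "f \<in> idents G" "w \<in> idents G" "gle G w f" "gle G f (gran G g)" "gle G w (gran G k)"
  note k = corestr[OF a(2,5,8)] and g = corestr[OF a(1,4,7)]
  note gw = corestr[OF g(1) a(5)]
  have "corestriction G k w = corestriction G (corestriction G g f) w"
    by (rule corestr_unique[of g]) (use a k g gw gle_trans[OF k(1) a(2,1)] gle_trans[OF gw(1) g(1) a(1)] in auto)
  then show ?thesis using gw a g by simp
qed

lemma restr_mono: "\<lbrakk>g \<in> elts G; k \<in> elts G; gle G k g; f \<in> idents G; w \<in> idents G; gle G w f; gle G f (gdom G g); gle G w (gdom G k)\<rbrakk>
  \<Longrightarrow> gle G (restriction G w k) (restriction G f g)"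
proof -
  assume a: "g \<in> elts G" "k \<in> elts G" "gle G k g" "f \<in> idents G" "w \<in> idents G" "gle G w f" "gle G f (gdom G g)" "gle G w (gdom G k)"
  note k = restr[OF a(2,5,8)] and g = restr[OF a(1,4,7)]
  note gw = restr[OF g(1) a(5)]
  have "restriction G w k = restriction G w (restriction G f g)"
    by (rule restr_unique[of g]) (use a k g gw gle_trans[OF k(1) a(2,1)] gle_trans[OF gw(1) g(1) a(1)] in auto)
  then show ?thesis using gw a g by simp
qed

end

locale principally_directed_groupoid = ordered_groupoid +
  assumes pd: "principally_directed G"
begin

lemma dirD: "\<lbrakk>t \<in> elts G; x \<in> elts G; y \<in> elts G; gle G x t; gle G y t\<rbrakk> \<Longrightarrow> \<exists>z\<in>elts G. gle G z x \<and> gle G z y"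
  using pd unfolding principally_directed_def by blast

lemma equiv_beta: "equiv (elts G) (beta G)"
proof (rule equivI)
  show "beta G \<subseteq> elts G \<times> elts G" by (auto simp: beta_def)
  show "refl_on (elts G) (beta G)" by (auto simp: refl_on_def intro: betaI gle_refl)
  show "sym (beta G)" by (auto simp: sym_def beta_def)
  show "trans (beta G)"
  proof (rule transI)
    fix x y z assume "(x, y) \<in> beta G" "(y, z) \<in> beta G"
    then obtain k l where "x \<in> elts G" "y \<in> elts G" "z \<in> elts G" "k \<in> elts G" "l \<in> elts G" "gle G k x" "gle G k y" "gle G l y" "gle G l z"
      by (auto simp: beta_def)
    then show "(x, z) \<in> beta G" using dirD[of y k l] by (meson betaI gle_trans)
  qed
qed

abbreviation Q where "Q \<equiv> beta_quotient G"

abbreviation cl where "cl g \<equiv> beta G `` {g}"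

lemma cl_eq: "(g, h) \<in> beta G \<Longrightarrow> cl g = cl h" using equiv_beta equiv_class_eq by metis
lemma cl_eqD: "\<lbrakk>cl g = cl h; h \<in> elts G\<rbrakk> \<Longrightarrow> (g, h) \<in> beta G"
  using equiv_beta eq_equiv_class by metis

lemma gmul_Q:
  assumes g: "g \<in> elts G" and h: "h \<in> elts G" and f: "f \<in> idents G" "gle G f (gran G g)" "gle G f (gdom G h)"
  shows "gmul Q (cl g) (cl h) = cl (gmul G (corestriction G g f) (restriction G f h))"
  unfolding beta_quotient_def ogpd.simps
proof (rule the_equality)
  have "g \<in> cl g" "h \<in> cl h" using g h by (auto intro: betaI gle_refl)
  then show "\<exists>g'\<in>cl g. \<exists>h'\<in>cl h. \<exists>f'\<in>idents G. gle G f' (gran G g') \<and> gle G f' (gdom G h') \<and>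
     cl (gmul G (corestriction G g f) (restriction G f h)) = cl (gmul G (corestriction G g' f') (restriction G f' h'))"
    using f by blast
  fix Z assume "\<exists>g'\<in>cl g. \<exists>h'\<in>cl h. \<exists>f'\<in>idents G. gle G f' (gran G g') \<and> gle G f' (gdom G h') \<and>
     Z = cl (gmul G (corestriction G g' f') (restriction G f' h'))"
  then obtain g' h' f' where gh: "(g, g') \<in> beta G" "(h, h') \<in> beta G" and f': "f' \<in> idents G" "gle G f' (gran G g')" "gle G f' (gdom G h')"
    and Z: "Z = cl (gmul G (corestriction G g' f') (restriction G f' h'))" by auto
  obtain k where k: "k \<in> elts G" "gle G k g" "gle G k g'" "g' \<in> elts G" using gh by (auto simp: beta_def)
  obtain l where l: "l \<in> elts G" "gle G l h" "gle G l h'" "h' \<in> elts G" using gh by (auto simp: beta_def)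
  note i = ident_in_elts[OF f(1)] ident_in_elts[OF f'(1)]
  obtain u where u: "u \<in> elts G" "gle G u (gran G k)" "gle G u f"
    using dirD[of "gran G g" "gran G k" f] gran_mono[OF k(1) g k(2)] f g k i gran_in by auto
  obtain v where v: "v \<in> elts G" "gle G v (gdom G l)" "gle G v f'"
    using dirD[of "gdom G h'" "gdom G l" f'] gdom_mono[OF l(1) l(4) l(3)] f' l i gdom_in by auto
  have "(u, f) \<in> beta G" using u i by (auto intro: betaI gle_refl)
  moreover have "(f, gran G g) \<in> beta G" using f g i by (auto intro: betaI gle_refl simp: gran_in)
  moreover have "(gran G g, gran G g') \<in> beta G" using gh beta_gran by simp
  moreover have "(gran G g', f') \<in> beta G" using f' k i by (auto intro!: betaI[of _ _ f'] gle_refl simp: gran_in)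
  moreover have "(f', v) \<in> beta G" using v i by (auto intro!: betaI[of _ _ v] gle_refl)
  ultimately have "(u, v) \<in> beta G" using equiv_beta by (meson equivE transD)
  then obtain w where w: "w \<in> elts G" "gle G w u" "gle G w v" by (auto simp: beta_def)
  have wf: "gle G w f" using gle_trans[OF w(1) u(1) i(1)] w u by blast
  have wf': "gle G w f'" using gle_trans[OF w(1) v(1) i(2)] w v by blast
  have wk: "gle G w (gran G k)" using gle_trans[OF w(1) u(1) gran_in[OF k(1)]] w u by blast
  have wl: "gle G w (gdom G l)" using gle_trans[OF w(1) v(1) gdom_in[OF l(1)]] w v by blast
  have wi: "w \<in> idents G" using ident_below[OF f(1) w(1) wf] .
  note c = corestr[OF g f(1,2)] restr[OF h f(1,3)] corestr[OF k(4) f'(1,2)] restr[OF l(4) f'(1,3)]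
    corestr[OF k(1) wi wk] restr[OF l(1) wi wl]
  let ?z = "gmul G (corestriction G k w) (restriction G w l)"
  have "?z \<in> elts G" using c by (simp add: gmul_in)
  moreover have "gle G ?z (gmul G (corestriction G g f) (restriction G f h))"
    by (rule OG2) (use c corestr_mono[OF g k(1,2) f(1) wi wf f(2) wk] restr_mono[OF h l(1,2) f(1) wi wf f(3) wl] in auto)
  moreover have "gle G ?z (gmul G (corestriction G g' f') (restriction G f' h'))"
    by (rule OG2) (use c corestr_mono[OF k(4,1,3) f'(1) wi wf' f'(2) wk] restr_mono[OF l(4,1,3) f'(1) wi wf' f'(3) wl] in auto)
  ultimately show "Z = cl (gmul G (corestriction G g f) (restriction G f h))"
    unfolding Z using c by (intro cl_eq betaI[of _ _ ?z]) (auto simp: gmul_in)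
qed

lemma gmul_Q': "\<lbrakk>g \<in> elts G; h \<in> elts G; gran G g = gdom G h\<rbrakk> \<Longrightarrow> gmul Q (cl g) (cl h) = cl (gmul G g h)"
  using gmul_Q[of g h "gran G g"] corestr_eq[of g g] restr_eq[of h h] by (simp add: gle_refl gran_in gdom_in)

lemma ginv_ginv: "g \<in> elts G \<Longrightarrow> ginv G (ginv G g) = g"
proof -
  assume g: "g \<in> elts G"
  let ?i = "ginv G g"
  have i: "?i \<in> elts G" "ginv G ?i \<in> elts G" using g ginv_in by auto
  have "ginv G ?i = gmul G (gmul G g ?i) (ginv G ?i)"
    using gdom_gmul_left[OF i(2)] g i by (metis gdom_def gdom_ginv gran_ginv)
  also have "\<dots> = gmul G g (gmul G ?i (ginv G ?i))"
    by (rule gmul_assoc) (use g i in \<open>auto simp: gdom_ginv gran_ginv\<close>)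
  also have "gmul G ?i (ginv G ?i) = gran G g" using gdom_ginv[OF g] by (simp add: gdom_def)
  finally show ?thesis using g by (simp add: gran_gmul_right)
qed

lemma ginv_Q: "g \<in> elts G \<Longrightarrow> ginv Q (cl g) = cl (ginv G g)"
proof -
  assume g: "g \<in> elts G"
  have "ginv G ` cl g = cl (ginv G g)"
  proof (intro equalityI subsetI)
    fix x assume "x \<in> ginv G ` cl g" then show "x \<in> cl (ginv G g)" using beta_ginv by auto
  next
    fix x assume x: "x \<in> cl (ginv G g)"
    then have "x \<in> elts G" "(g, ginv G x) \<in> beta G" using beta_ginv[of "ginv G g" x] ginv_ginv[OF g] by (auto simp: beta_def)
    then show "x \<in> ginv G ` cl g" using ginv_ginv by (metis Image_singleton_iff imageI)
  qed
  then show ?thesis by (simp add: beta_quotient_def)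
qed

lemma gdom_Q: "g \<in> elts G \<Longrightarrow> gdom Q (cl g) = cl (gdom G g)"
  using gmul_Q'[of g "ginv G g"] unfolding gdom_def[of Q] by (simp add: ginv_Q ginv_in gdom_ginv flip: gdom_def)
lemma gran_Q: "g \<in> elts G \<Longrightarrow> gran Q (cl g) = cl (gran G g)"
  using gmul_Q'[of "ginv G g" g] unfolding gran_def[of Q] by (simp add: ginv_Q ginv_in gran_ginv flip: gran_def)

lemma elts_Q: "X \<in> elts Q \<longleftrightarrow> (\<exists>g\<in>elts G. X = cl g)" by (auto simp: beta_quotient_def quotient_def)

lemma composable:
  assumes "g \<in> elts G" "h \<in> elts G" "cl (gran G g) = cl (gdom G h)"
  obtains g' h' where "g' \<in> elts G" "h' \<in> elts G" "gle G g' g" "gle G h' h" "cl g' = cl g" "cl h' = cl h" "gran G g' = gdom G h'"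
proof -
  have "(gran G g, gdom G h) \<in> beta G" using cl_eqD assms gdom_in by blast
  then obtain f where f: "f \<in> elts G" "gle G f (gran G g)" "gle G f (gdom G h)" by (auto simp: beta_def)
  then have fi: "f \<in> idents G" using ident_below[of "gran G g" f] assms by simp
  note c = corestr[OF assms(1) fi f(2)] restr[OF assms(2) fi f(3)]
  show thesis
  proof (rule that)
    show "corestriction G g f \<in> elts G" "restriction G f h \<in> elts G" "gle G (corestriction G g f) g"
      "gle G (restriction G f h) h" "gran G (corestriction G g f) = gdom G (restriction G f h)"
      using c by auto
    show "cl (corestriction G g f) = cl g" "cl (restriction G f h) = cl h"
      using c assms by (auto intro!: cl_eq intro: betaI gle_refl simp del: Image_singleton_iff)
  qed
qed

lemma ordered_groupoid_Q: "ordered_groupoid Q"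
proof -
  have g: "groupoid Q"
  proof
    fix X Y Z
    { assume "X \<in> elts Q" then obtain x where x: "x \<in> elts G" "X = cl x" using elts_Q by auto
      show "ginv Q X \<in> elts Q" "gdom Q X \<in> elts Q" "gran Q X \<in> elts Q"
        "gdom Q (gdom Q X) = gdom Q X" "gran Q (gdom Q X) = gdom Q X"
        "gdom Q (gran Q X) = gran Q X" "gran Q (gran Q X) = gran Q X"
        "gdom Q (ginv Q X) = gran Q X" "gran Q (ginv Q X) = gdom Q X"
        "gmul Q (gdom Q X) X = X" "gmul Q X (gran Q X) = X"
        using x unfolding elts_Q x(2)
        by (auto simp: ginv_Q gdom_Q gran_Q ginv_in gdom_in gran_in gdom_gdom gran_gdom gdom_gran gran_gran
            gdom_ginv gran_ginv gmul_Q' gdom_gmul_left gran_gmul_right)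
      assume "Y \<in> elts Q" "gran Q X = gdom Q Y"
      then obtain y where y: "y \<in> elts G" "Y = cl y" "cl (gran G x) = cl (gdom G y)" using elts_Q x by (auto simp: gran_Q gdom_Q)
      obtain x' y' where xy: "x' \<in> elts G" "y' \<in> elts G" "X = cl x'" "Y = cl y'" "gran G x' = gdom G y'"
        using composable[OF x(1) y(1,3)] x y by metis
      show "gmul Q X Y \<in> elts Q" "gdom Q (gmul Q X Y) = gdom Q X" "gran Q (gmul Q X Y) = gran Q Y"
        using xy by (auto simp: elts_Q gmul_Q' gmul_in gdom_Q gran_Q gdom_gmul gran_gmul)
      assume "Z \<in> elts Q" "gran Q Y = gdom Q Z"
      then obtain z where z: "z \<in> elts G" "Z = cl z" "cl (gran G y') = cl (gdom G z)" using elts_Q xy by (auto simp: gran_Q gdom_Q)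
      obtain y'' z' where yz: "y'' \<in> elts G" "z' \<in> elts G" "Y = cl y''" "gle G y'' y'" "Z = cl z'" "gran G y'' = gdom G z'"
        using composable[OF xy(2) z(1,3)] xy z by metis
      have l: "gle G (gdom G y'') (gran G x')" using gdom_mono[OF yz(1) xy(2) yz(4)] xy by simp
      note c = corestr[OF xy(1) gdom_idents[OF yz(1)] l]
      let ?x = "corestriction G x' (gdom G y'')"
      have "X = cl ?x" using c xy by (auto intro!: cl_eq betaI[of _ _ ?x] gle_refl)
      then show "gmul Q (gmul Q X Y) Z = gmul Q X (gmul Q Y Z)"
        using c yz xy(1) by (simp add: gmul_Q' gmul_in gran_gmul gdom_gmul gmul_assoc)
    }
  qed
  have [simp]: "gle Q = (=)" by (simp add: beta_quotient_def)
  interpret Q: groupoid Q by (rule g)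
  show ?thesis
    by unfold_locales (auto simp: idents_def)
qed

lemma idents_Q: "idents Q = {cl e | e. e \<in> idents G}"
proof (intro equalityI subsetI)
  fix X assume X: "X \<in> idents Q"
  then obtain g where "g \<in> elts G" "X = cl g" by (auto simp: idents_def elts_Q)
  then have "X = cl (gdom G g)" using X gdom_Q by (auto simp: idents_def)
  then show "X \<in> {cl e | e. e \<in> idents G}" using \<open>g \<in> elts G\<close> by auto
next
  fix X assume "X \<in> {cl e | e. e \<in> idents G}"
  then obtain e where e: "e \<in> idents G" "X = cl e" by blast
  then have "gdom Q X = X" using gdom_Q[OF ident_in_elts[OF e(1)]] by (simp add: ident_gdom)
  then show "X \<in> idents Q" using e ident_in_elts[OF e(1)] elts_Q[of X] unfolding idents_def[of Q] by blast
qed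

end

end

theory Submission
  imports Defs
begin

text \<open>The functor \<open>colimE\<close> is left adjoint to the restriction of modules along \<open>LL G \<rightarrow> LL (G/\<beta>)\<close>, which
  is exact, so it preserves projectives.  As \<open>G\<close> is principally directed, each \<open>\<beta>\<close>-class of
  identities is a downward directed poset, and directed colimits of abelian groups are exact; hence
  \<open>colimE\<close> takes a projective resolution of \<open>A\<close> to a projective resolution of \<open>colimE G A\<close>.  Finally
  the colimit over \<open>LL G\<close> is the colimit over \<open>LL (G/\<beta>)\<close> of \<open>colimE\<close>, so both homologies are computed
  by isomorphic complexes.\<close>

section \<open>Colimits\<close>

text \<open>Homology is defined through a resolution picked by \<open>SOME\<close> over one fixed
  type of generators, whereas \<open>colimE\<close> turns a resolution of \<open>A\<close> into one
  whose elements are cosets. So the comparison of resolutions has to work for two resolutions over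
  unrelated types; it is done over an arbitrary small category and applied to \<open>LL G\<close>
  and to \<open>LL Q\<close>. The left adjoint can be computed one class at a time because morphisms
  of the quotient lift: for a class \<open>\<gamma>\<close> and any identity \<open>e\<close> in its
  domain class, some representative of \<open>\<gamma>\<close> has its domain below
  \<open>e\<close>. Principal directedness makes \<beta> transitive, so two members of a class are
  \<beta>-related and have a common lower bound, again in the class. Hence the action of
  \<open>\<gamma>\<close> may be computed with any such representative, and passing to a smaller one
  changes the result only by a map of the poset, which the colimit identifies with the identity. A
  map out of a colimit is determined on the canonical images of the fibres. Nearly every equation
  below is verified there, and cosets are handled only in the basic properties of
  \<open>colim\<close>.\<close>

lemma group_hom_comm: "\<lbrakk>comm_group G; comm_group H; h \<in> hom G H\<rbrakk> \<Longrightarrow> group_hom G H h"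
  by (simp add: group_hom_def group_hom_axioms_def comm_group_def)

lemma comm_group_sum_group:
  assumes "\<And>i. i \<in> I \<Longrightarrow> comm_group (A i)"
  shows "comm_group (sum_group I A)"
proof (rule group.group_comm_groupI)
  have g: "group (A i)" if "i \<in> I" for i using assms[OF that] by (simp add: comm_group_def)
  then show "group (sum_group I A)" by simp
  fix x y assume "x \<in> carrier (sum_group I A)" "y \<in> carrier (sum_group I A)"
  then have "x i \<in> carrier (A i)" "y i \<in> carrier (A i)" if "i \<in> I" for i
    using that g by (auto simp: carrier_sum_group)
  then show "x \<otimes>\<^bsub>sum_group I A\<^esub> y = y \<otimes>\<^bsub>sum_group I A\<^esub> x"
    using assms by (auto simp: comm_group_def comm_monoid.m_comm)
qed

lemma generate_subset_kernel:
  assumes "group_hom G H h" "S \<subseteq> kernel G H h"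
  shows "generate G S \<subseteq> kernel G H h"
  using assms group_hom.subgroup_kernel group_hom.axioms(1) group.generate_subgroup_incl by metis

context category begin

lemma cat_module_comm_group: "\<lbrakk>cat_module C A; x \<in> objs C\<rbrakk> \<Longrightarrow> comm_group (fib A x)"
  by (simp add: cat_module_def)

lemma cat_module_group: "\<lbrakk>cat_module C A; x \<in> objs C\<rbrakk> \<Longrightarrow> group (fib A x)"
  by (simp add: cat_module_def comm_group_def)

lemma cat_module_act_hom: "\<lbrakk>cat_module C A; m \<in> mors C\<rbrakk> \<Longrightarrow> act A m \<in> hom (fib A (src C m)) (fib A (tgt C m))"
  by (simp add: cat_module_def)

lemma nat_trans_hom: "\<lbrakk>nat_trans C A B \<phi>; x \<in> objs C\<rbrakk> \<Longrightarrow> \<phi> x \<in> hom (fib A x) (fib B x)"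
  by (simp add: nat_trans_def)

lemma nat_trans_act: "\<lbrakk>nat_trans C A B \<phi>; m \<in> mors C; a \<in> carrier (fib A (src C m))\<rbrakk>
    \<Longrightarrow> \<phi> (tgt C m) (act A m a) = act B m (\<phi> (src C m) a)"
  by (simp add: nat_trans_def)

lemma comm_group_colim_sum: "cat_module C A \<Longrightarrow> comm_group (colim_sum C A)"
  unfolding colim_sum_def by (rule comm_group_sum_group) (rule cat_module_comm_group)

lemma carrier_colim_sum:
  assumes "cat_module C A"
  shows "carrier (colim_sum C A) =
    {u \<in> \<Pi>\<^sub>E x\<in>objs C. carrier (fib A x). finite {x \<in> objs C. u x \<noteq> \<one>\<^bsub>fib A x\<^esub>}}"
  unfolding colim_sum_def by (rule carrier_sum_group) (rule cat_module_group[OF assms])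

lemma sum_in_hom:
  assumes A: "cat_module C A" and x: "x \<in> objs C"
  shows "sum_in C A x \<in> hom (fib A x) (colim_sum C A)"
proof (rule homI)
  note g = cat_module_group[OF A]
  show "sum_in C A x a \<in> carrier (colim_sum C A)" if "a \<in> carrier (fib A x)" for a
  proof -
    have "{y \<in> objs C. sum_in C A x a y \<noteq> \<one>\<^bsub>fib A y\<^esub>} \<subseteq> {x}" by (auto simp: sum_in_def)
    then show ?thesis using that g
      by (auto simp: carrier_colim_sum[OF A] sum_in_def group.is_monoid intro: finite_subset)
  qed
  show "sum_in C A x (a \<otimes>\<^bsub>fib A x\<^esub> b) = sum_in C A x a \<otimes>\<^bsub>colim_sum C A\<^esub> sum_in C A x b" for a b
    using g by (auto simp: sum_in_def colim_sum_def group.is_monoid)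
qed

text \<open>Elements of the direct sum have finite support. Cutting \<open>u\<close> down to a
  finite set \<open>F\<close> of coordinates gives \<open>r F\<close>, which is built from the unit
  one coordinate at a time and equals \<open>u\<close> once \<open>F\<close> is the support.\<close>

lemma colim_sum_induct:
  assumes A: "cat_module C A" and u: "u \<in> carrier (colim_sum C A)"
    and one: "P \<one>\<^bsub>colim_sum C A\<^esub>"
    and mult: "\<And>x a v. \<lbrakk>x \<in> objs C; a \<in> carrier (fib A x); v \<in> carrier (colim_sum C A); P v\<rbrakk>
        \<Longrightarrow> P (sum_in C A x a \<otimes>\<^bsub>colim_sum C A\<^esub> v)"
  shows "P u"
proof -
  note g = cat_module_group[OF A]
  define r where "r F = (\<lambda>y\<in>objs C. if y \<in> F then u y else \<one>\<^bsub>fib A y\<^esub>)" for F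
  have ux: "u x \<in> carrier (fib A x)" if "x \<in> objs C" for x
    using u that by (auto simp: carrier_colim_sum[OF A])
  have r: "r F \<in> carrier (colim_sum C A)" for F
  proof -
    have "finite {y \<in> objs C. r F y \<noteq> \<one>\<^bsub>fib A y\<^esub>}"
      by (rule finite_subset[of _ "{y \<in> objs C. u y \<noteq> \<one>\<^bsub>fib A y\<^esub>}"])
        (use u in \<open>auto simp: r_def carrier_colim_sum[OF A]\<close>)
    moreover have "r F \<in> (\<Pi>\<^sub>E x\<in>objs C. carrier (fib A x))" using ux g by (auto simp: r_def group.is_monoid)
    ultimately show ?thesis by (simp add: carrier_colim_sum[OF A])
  qed
  have "P (r F)" if "finite F" "F \<subseteq> objs C" for F
    using that
  proof (induction F rule: finite_induct)
    case empty
    then show ?case using one by (simp add: r_def colim_sum_def restrict_def)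
  next
    case (insert x F)
    have "r (insert x F) = sum_in C A x (u x) \<otimes>\<^bsub>colim_sum C A\<^esub> r F"
      using insert.hyps insert.prems g ux
      by (auto simp: r_def sum_in_def colim_sum_def fun_eq_iff group.is_monoid)
    then show ?case using mult insert ux r by simp
  qed
  moreover have "r {y \<in> objs C. u y \<noteq> \<one>\<^bsub>fib A y\<^esub>} = u"
    using u by (auto simp: r_def carrier_colim_sum[OF A] PiE_def extensional_def)
  ultimately show ?thesis using u by (metis (no_types, lifting) carrier_colim_sum[OF A] mem_Collect_eq subsetI)
qed

text \<open>The map multiplies the values \<open>f x (u x)\<close>. \<open>gfinprod\<close> ignores
  trivial factors, so the product makes sense over an infinite set of objects.\<close>

lemma colim_sum_universal:
  assumes A: "cat_module C A" and H: "comm_group H"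
    and f: "\<And>x. x \<in> objs C \<Longrightarrow> f x \<in> hom (fib A x) H"
  obtains h where "h \<in> hom (colim_sum C A) H"
    and "\<And>x a. \<lbrakk>x \<in> objs C; a \<in> carrier (fib A x)\<rbrakk> \<Longrightarrow> h (sum_in C A x a) = f x a"
proof
  interpret H: comm_group H by fact
  let ?h = "\<lambda>u. gfinprod H (\<lambda>x. f x (u x)) (objs C)"
  show "?h \<in> hom (colim_sum C A) H"
    unfolding colim_sum_def by (rule H.hom_group_sum) (use f cat_module_group[OF A] in auto)
  fix x a assume x: "x \<in> objs C" and a: "a \<in> carrier (fib A x)"
  have one: "f y \<one>\<^bsub>fib A y\<^esub> = \<one>\<^bsub>H\<^esub>" if "y \<in> objs C" for y
    using f that cat_module_group[OF A] by (simp add: hom_one)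
  have fa: "f x a \<in> carrier H" using f x a by (auto simp: hom_def)
  have "?h (sum_in C A x a) = gfinprod H (\<lambda>y. f y (sum_in C A x a y)) {x}"
    by (rule H.gfinprod_mono_neutral_cong_right)
      (use x fa one in \<open>auto simp: sum_in_def\<close>)
  also have "\<dots> = f x a" using x fa by (simp add: sum_in_def H.gfinprod_eq_finprod)
  finally show "?h (sum_in C A x a) = f x a" .
qed

lemma subgroup_colim_rel:
  assumes A: "cat_module C A"
  shows "subgroup (colim_rel C A) (colim_sum C A)"
proof -
  interpret S: comm_group "colim_sum C A" by (rule comm_group_colim_sum[OF A])
  show ?thesis
    unfolding colim_rel_def
  proof (rule S.generate_is_subgroup, clarify)
    fix m a assume m: "m \<in> mors C" and a: "a \<in> carrier (fib A (src C m))"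
    have "sum_in C A (src C m) a \<in> carrier (colim_sum C A)"
      "sum_in C A (tgt C m) (act A m a) \<in> carrier (colim_sum C A)"
      using sum_in_hom[OF A] src_in[OF m] tgt_in[OF m] a cat_module_act_in[OF A m a]
      by (auto simp: hom_def)
    then show "sum_in C A (src C m) a \<otimes>\<^bsub>colim_sum C A\<^esub>
        inv\<^bsub>colim_sum C A\<^esub> sum_in C A (tgt C m) (act A m a) \<in> carrier (colim_sum C A)" by simp
  qed
qed

lemma normal_colim_rel: "cat_module C A \<Longrightarrow> colim_rel C A \<lhd> colim_sum C A"
  by (meson comm_group.normal_iff_subgroup comm_group_colim_sum subgroup_colim_rel)

lemma comm_group_colim: "cat_module C A \<Longrightarrow> comm_group (colim C A)"
  unfolding colim_def by (intro comm_group.abelian_FactGroup comm_group_colim_sum subgroup_colim_rel)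

lemma colim_proj_hom:
  "cat_module C A \<Longrightarrow> (\<lambda>u. colim_rel C A #>\<^bsub>colim_sum C A\<^esub> u) \<in> hom (colim_sum C A) (colim C A)"
  unfolding colim_def by (intro normal.r_coset_hom_Mod normal_colim_rel)

lemma colim_in_hom: "\<lbrakk>cat_module C A; x \<in> objs C\<rbrakk> \<Longrightarrow> colim_in C A x \<in> hom (fib A x) (colim C A)"
  using hom_compose[OF sum_in_hom colim_proj_hom] unfolding colim_in_def comp_def by blast

lemma colim_in_in: "\<lbrakk>cat_module C A; x \<in> objs C; a \<in> carrier (fib A x)\<rbrakk> \<Longrightarrow> colim_in C A x a \<in> carrier (colim C A)"
  using colim_in_hom by (fastforce simp: hom_def)

text \<open>Representatives of the two sides differ by one of the generators of
  \<open>colim_rel\<close>.\<close>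

lemma colim_in_act:
  assumes A: "cat_module C A" and m: "m \<in> mors C" and a: "a \<in> carrier (fib A (src C m))"
  shows "colim_in C A (tgt C m) (act A m a) = colim_in C A (src C m) a"
proof -
  interpret S: comm_group "colim_sum C A" by (rule comm_group_colim_sum[OF A])
  have s: "sum_in C A (src C m) a \<in> carrier (colim_sum C A)" (is "?s \<in> _")
    "sum_in C A (tgt C m) (act A m a) \<in> carrier (colim_sum C A)" (is "?t \<in> _")
    using sum_in_hom[OF A] src_in[OF m] tgt_in[OF m] a cat_module_act_in[OF A m a]
    by (auto simp: hom_def)
  have "?s \<otimes>\<^bsub>colim_sum C A\<^esub> inv\<^bsub>colim_sum C A\<^esub> ?t \<in> colim_rel C A"
    unfolding colim_rel_def using m a by (intro generate.incl) blast
  then have "?s \<in> colim_rel C A #>\<^bsub>colim_sum C A\<^esub> ?t"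
    using subgroup.rcos_module_rev[OF subgroup_colim_rel[OF A] S.is_group s(2,1)] by simp
  then show ?thesis
    unfolding colim_in_def
    using S.repr_independence[OF _ s(2) subgroup_colim_rel[OF A], of ?s] by simp
qed

lemma colim_induct:
  assumes A: "cat_module C A" and X: "X \<in> carrier (colim C A)"
    and one: "P \<one>\<^bsub>colim C A\<^esub>"
    and mult: "\<And>x a Y. \<lbrakk>x \<in> objs C; a \<in> carrier (fib A x); Y \<in> carrier (colim C A); P Y\<rbrakk>
        \<Longrightarrow> P (colim_in C A x a \<otimes>\<^bsub>colim C A\<^esub> Y)"
  shows "P X"
proof -
  let ?q = "\<lambda>u. colim_rel C A #>\<^bsub>colim_sum C A\<^esub> u"
  interpret q: group_hom "colim_sum C A" "colim C A" ?q
    by (intro group_hom_comm comm_group_colim_sum comm_group_colim colim_proj_hom A)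
  obtain u where u: "u \<in> carrier (colim_sum C A)" "X = ?q u"
    using X by (auto simp: colim_def carrier_FactGroup)
  show ?thesis
    unfolding u(2)
  proof (rule colim_sum_induct[OF A u(1)])
    show "P (?q \<one>\<^bsub>colim_sum C A\<^esub>)" using one by simp
    fix x a v assume x: "x \<in> objs C" "a \<in> carrier (fib A x)" and v: "v \<in> carrier (colim_sum C A)" "P (?q v)"
    have "sum_in C A x a \<in> carrier (colim_sum C A)" using sum_in_hom[OF A x(1)] x(2) by (auto simp: hom_def)
    then show "P (?q (sum_in C A x a \<otimes>\<^bsub>colim_sum C A\<^esub> v))"
      using mult[OF x _ v(2)] v(1) by (simp add: colim_in_def)
  qed
qed

text \<open>The canonical images of the fibres generate the colimit, by \<open>colim_induct\<close>.
  This is the way in which equations between maps out of a colimit are proved from here on.\<close>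

lemma colim_hom_eqI:
  assumes A: "cat_module C A" and H: "group H" and f: "f \<in> hom (colim C A) H" and g: "g \<in> hom (colim C A) H"
    and eq: "\<And>x a. \<lbrakk>x \<in> objs C; a \<in> carrier (fib A x)\<rbrakk> \<Longrightarrow> f (colim_in C A x a) = g (colim_in C A x a)"
    and X: "X \<in> carrier (colim C A)"
  shows "f X = g X"
proof -
  interpret f: group_hom "colim C A" H f
    using f H comm_group_colim[OF A] by (simp add: group_hom_def group_hom_axioms_def comm_group_def)
  interpret g: group_hom "colim C A" H g
    using g H comm_group_colim[OF A] by (simp add: group_hom_def group_hom_axioms_def comm_group_def)
  show ?thesis
    by (rule colim_induct[OF A X]) (use eq colim_in_in[OF A] in auto)
qed

text \<open>A kernel is a subgroup, so it is enough that it contains the generators of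
  \<open>colim_rel\<close>. Both the universal property and the induced maps descend to the quotient
  by this.\<close>

lemma colim_rel_kernel:
  assumes A: "cat_module C A" and H: "comm_group H" and h: "h \<in> hom (colim_sum C A) H"
    and eq: "\<And>m a. \<lbrakk>m \<in> mors C; a \<in> carrier (fib A (src C m))\<rbrakk>
        \<Longrightarrow> h (sum_in C A (tgt C m) (act A m a)) = h (sum_in C A (src C m) a)"
  shows "colim_rel C A \<subseteq> kernel (colim_sum C A) H h"
  unfolding colim_rel_def
proof (rule generate_subset_kernel)
  interpret h: group_hom "colim_sum C A" H h
    by (intro group_hom_comm comm_group_colim_sum A H h)
  show "group_hom (colim_sum C A) H h" ..
  show "{sum_in C A (src C m) a \<otimes>\<^bsub>colim_sum C A\<^esub> inv\<^bsub>colim_sum C A\<^esub> sum_in C A (tgt C m) (act A m a) |m a.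
     m \<in> mors C \<and> a \<in> carrier (fib A (src C m))} \<subseteq> kernel (colim_sum C A) H h"
  proof clarify
    fix m a assume m: "m \<in> mors C" and a: "a \<in> carrier (fib A (src C m))"
    have "sum_in C A (src C m) a \<in> carrier (colim_sum C A)"
      "sum_in C A (tgt C m) (act A m a) \<in> carrier (colim_sum C A)"
      using sum_in_hom[OF A] src_in[OF m] tgt_in[OF m] a cat_module_act_in[OF A m a]
      by (auto simp: hom_def)
    then show "sum_in C A (src C m) a \<otimes>\<^bsub>colim_sum C A\<^esub> inv\<^bsub>colim_sum C A\<^esub> sum_in C A (tgt C m) (act A m a)
        \<in> kernel (colim_sum C A) H h"
      using eq[OF m a] by (simp add: kernel_def)
  qed
qed

lemma colim_universal:
  assumes A: "cat_module C A" and H: "comm_group H"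
    and f: "\<And>x. x \<in> objs C \<Longrightarrow> f x \<in> hom (fib A x) H"
    and eq: "\<And>m a. \<lbrakk>m \<in> mors C; a \<in> carrier (fib A (src C m))\<rbrakk> \<Longrightarrow> f (tgt C m) (act A m a) = f (src C m) a"
  obtains h where "h \<in> hom (colim C A) H"
    and "\<And>x a. \<lbrakk>x \<in> objs C; a \<in> carrier (fib A x)\<rbrakk> \<Longrightarrow> h (colim_in C A x a) = f x a"
proof -
  obtain k where k: "k \<in> hom (colim_sum C A) H"
    "\<And>x a. \<lbrakk>x \<in> objs C; a \<in> carrier (fib A x)\<rbrakk> \<Longrightarrow> k (sum_in C A x a) = f x a"
    using colim_sum_universal[OF A H f] by metis
  interpret k: group_hom "colim_sum C A" H k
    by (intro group_hom_comm comm_group_colim_sum A H k)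
  have "colim_rel C A \<subseteq> kernel (colim_sum C A) H k"
    by (rule colim_rel_kernel[OF A H k(1)]) (simp add: k(2) src_in tgt_in cat_module_act_in[OF A] eq)
  then obtain h where h: "h \<in> hom (colim_sum C A Mod colim_rel C A) H"
    "\<And>u. u \<in> carrier (colim_sum C A) \<Longrightarrow> h (colim_rel C A #>\<^bsub>colim_sum C A\<^esub> u) = k u"
    using k.FactGroup_universal_kernel[OF normal_colim_rel[OF A]] by metis
  show thesis
  proof
    show "h \<in> hom (colim C A) H" using h(1) by (simp add: colim_def)
    fix x a assume x: "x \<in> objs C" "a \<in> carrier (fib A x)"
    then have "sum_in C A x a \<in> carrier (colim_sum C A)" using sum_in_hom[OF A x(1)] by (auto simp: hom_def)
    then show "h (colim_in C A x a) = f x a" using h(2) k(2)[OF x] by (simp add: colim_in_def)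
  qed
qed

text \<open>Applying \<phi> in each coordinate and projecting is trivial on
  \<open>colim_rel C A\<close>, hence induces a homomorphism \<open>h\<close> on the quotient. As
  \<open>h\<close> takes one value on a coset, all members of the union that defines
  \<open>colim_map\<close> are the same coset, and the union is the value of
  \<open>h\<close>.\<close>

lemma
  assumes A: "cat_module C A" and B: "cat_module C B" and \<phi>: "nat_trans C A B \<phi>"
  shows colim_map_hom: "colim_map C A B \<phi> \<in> hom (colim C A) (colim C B)"
    and colim_map_in: "\<And>x a. \<lbrakk>x \<in> objs C; a \<in> carrier (fib A x)\<rbrakk>
      \<Longrightarrow> colim_map C A B \<phi> (colim_in C A x a) = colim_in C B x (\<phi> x a)"
proof -
  let ?SA = "colim_sum C A" and ?SB = "colim_sum C B"
  let ?q = "\<lambda>v. colim_rel C B #>\<^bsub>?SB\<^esub> v"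
  define F where "F u = (\<lambda>x\<in>objs C. \<phi> x (u x))" for u
  note gA = cat_module_group[OF A] and gB = cat_module_group[OF B]
  have \<phi>1: "\<phi> x \<one>\<^bsub>fib A x\<^esub> = \<one>\<^bsub>fib B x\<^esub>" if "x \<in> objs C" for x
    using hom_one[OF nat_trans_hom[OF \<phi> that] gA[OF that] gB[OF that]] .
  have F: "F \<in> hom ?SA ?SB"
  proof (rule homI)
    fix u assume u: "u \<in> carrier ?SA"
    have "finite {x \<in> objs C. F u x \<noteq> \<one>\<^bsub>fib B x\<^esub>}"
      by (rule finite_subset[of _ "{x \<in> objs C. u x \<noteq> \<one>\<^bsub>fib A x\<^esub>}"])
        (use u \<phi>1 in \<open>auto simp: F_def carrier_colim_sum[OF A]\<close>)
    moreover have "F u \<in> (\<Pi>\<^sub>E x\<in>objs C. carrier (fib B x))"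
      using u nat_trans_in[OF \<phi>] by (auto simp: F_def carrier_colim_sum[OF A])
    ultimately show "F u \<in> carrier ?SB" by (simp add: carrier_colim_sum[OF B])
    fix v assume v: "v \<in> carrier ?SA"
    show "F (u \<otimes>\<^bsub>?SA\<^esub> v) = F u \<otimes>\<^bsub>?SB\<^esub> F v"
      using u v hom_mult[OF nat_trans_hom[OF \<phi>]]
      by (auto simp: F_def fun_eq_iff carrier_colim_sum[OF A] PiE_iff) (auto simp: colim_sum_def)
  qed
  have F_in: "F (sum_in C A x a) = sum_in C B x (\<phi> x a)" if "x \<in> objs C" for x a
    using \<phi>1 by (auto simp: F_def sum_in_def)
  interpret k: group_hom ?SA "colim C B" "?q \<circ> F"
    by (intro group_hom_comm comm_group_colim_sum A comm_group_colim B hom_compose[OF F colim_proj_hom[OF B]])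
  have kin: "(?q \<circ> F) (sum_in C A x a) = colim_in C B x (\<phi> x a)" if "x \<in> objs C" for x a
    by (simp add: F_in that colim_in_def)
  have ker: "colim_rel C A \<subseteq> kernel ?SA (colim C B) (?q \<circ> F)"
    by (rule colim_rel_kernel[OF A comm_group_colim[OF B] k.homh])
      (simp only: kin src_in tgt_in nat_trans_act[OF \<phi>] colim_in_act[OF B] nat_trans_in[OF \<phi>])
  then obtain h where h: "h \<in> hom (colim C A) (colim C B)"
    "\<And>u. u \<in> carrier ?SA \<Longrightarrow> h (colim_rel C A #>\<^bsub>?SA\<^esub> u) = (?q \<circ> F) u"
    using k.FactGroup_universal_kernel[OF normal_colim_rel[OF A]] unfolding colim_def by metis
  have map: "colim_map C A B \<phi> (colim_rel C A #>\<^bsub>?SA\<^esub> u) = (?q \<circ> F) u" if u: "u \<in> carrier ?SA" for u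
  proof -
    have "(?q \<circ> F) v = (?q \<circ> F) u" if v: "v \<in> colim_rel C A #>\<^bsub>?SA\<^esub> u" for v
    proof -
      have "v \<in> carrier ?SA"
        using v u subgroup_colim_rel[OF A] k.G.r_coset_subset_G subgroup.subset by blast
      moreover have "colim_rel C A #>\<^bsub>?SA\<^esub> v = colim_rel C A #>\<^bsub>?SA\<^esub> u"
        using k.G.repr_independence[OF v u subgroup_colim_rel[OF A]] by simp
      ultimately show ?thesis using h(2) u by metis
    qed
    moreover have "u \<in> colim_rel C A #>\<^bsub>?SA\<^esub> u"
      by (rule k.G.rcos_self[OF u subgroup_colim_rel[OF A]])
    ultimately show ?thesis unfolding colim_map_def F_def comp_def by blast
  qed
  have "colim_map C A B \<phi> X = h X" if "X \<in> carrier (colim C A)" for X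
    using that map h(2) by (auto simp: colim_def carrier_FactGroup)
  then show "colim_map C A B \<phi> \<in> hom (colim C A) (colim C B)"
    using h(1) monoid.m_closed[OF group.is_monoid[OF comm_group.axioms(2)[OF comm_group_colim[OF A]]]]
    by (simp add: hom_def Pi_iff)
  fix x a assume x: "x \<in> objs C" "a \<in> carrier (fib A x)"
  then have "sum_in C A x a \<in> carrier ?SA" using sum_in_hom[OF A x(1)] by (auto simp: hom_def)
  then show "colim_map C A B \<phi> (colim_in C A x a) = colim_in C B x (\<phi> x a)"
    using map kin[OF x(1)] by (simp add: colim_in_def)
qed

end

section \<open>Chain homotopy equivalences\<close>

text \<open>The composite of \<open>f\<close> with the projection of \<open>Z'\<close> modulo
  \<open>B'\<close> is onto and has kernel \<open>B\<close>, so the first isomorphism theorem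
  applies. The map \<open>f\<close> itself may be far from bijective; \<open>onto\<close> asks only
  that each coset of \<open>B'\<close> be met.\<close>

lemma FactGroup_iso_of_hom:
  assumes Z: "comm_group Z" and Z': "comm_group Z'" and B: "subgroup B Z" and B': "subgroup B' Z'"
    and f: "f \<in> hom Z Z'"
    and ker: "\<And>z. z \<in> carrier Z \<Longrightarrow> f z \<in> B' \<longleftrightarrow> z \<in> B"
    and onto: "\<And>z'. z' \<in> carrier Z' \<Longrightarrow> \<exists>z\<in>carrier Z. \<exists>b\<in>B'. f z = b \<otimes>\<^bsub>Z'\<^esub> z'"
  shows "Z Mod B \<cong> Z' Mod B'"
proof -
  interpret Z: comm_group Z by fact
  interpret Z': comm_group Z' by fact
  let ?q = "\<lambda>z. B' #>\<^bsub>Z'\<^esub> z"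
  have n: "B' \<lhd> Z'" using B' Z'.normal_iff_subgroup by simp
  interpret q: group_hom Z "Z' Mod B'" "?q \<circ> f"
    by (intro group_hom_comm Z Z'.abelian_FactGroup Z' B' hom_compose[OF f] normal.r_coset_hom_Mod n)
  have f_in: "f z \<in> carrier Z'" if "z \<in> carrier Z" for z using f that by (auto simp: hom_def)
  have "?q (f z) = B' \<longleftrightarrow> z \<in> B" if "z \<in> carrier Z" for z
    using ker[OF that] Z'.coset_join1[OF _ f_in[OF that] B'] Z'.coset_join2[OF f_in[OF that] B']
    by auto
  then have kernel: "kernel Z (Z' Mod B') (?q \<circ> f) = B"
    using subgroup.subset[OF B] by (auto simp: kernel_def)
  have "(?q \<circ> f) ` carrier Z = carrier (Z' Mod B')"
  proof (intro equalityI subsetI)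
    fix X assume "X \<in> carrier (Z' Mod B')"
    then obtain z' where z': "z' \<in> carrier Z'" "X = ?q z'" by (auto simp: carrier_FactGroup)
    obtain z b where zb: "z \<in> carrier Z" "b \<in> B'" "f z = b \<otimes>\<^bsub>Z'\<^esub> z'" using onto[OF z'(1)] by blast
    have "f z \<in> ?q z'" using zb by (auto simp: r_coset_def)
    then have "?q (f z) = X" using Z'.repr_independence[OF _ z'(1) B', of "f z"] z'(2) by simp
    then show "X \<in> (?q \<circ> f) ` carrier Z" by (intro image_eqI[OF _ zb(1)]) simp
  qed (use q.hom_closed in blast)
  then show ?thesis using q.FactGroup_iso unfolding kernel by blast
qed

locale ab_complex =
  fixes K :: "nat \<Rightarrow> 'a monoid" and d :: "nat \<Rightarrow> 'a \<Rightarrow> 'a"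
  assumes comm: "comm_group (K n)"
    and d_hom: "d n \<in> hom (K (Suc n)) (K n)"
    and d_d: "x \<in> carrier (K (Suc (Suc n))) \<Longrightarrow> d n (d (Suc n) x) = \<one>\<^bsub>K n\<^esub>"
begin

definition cycles where
  "cycles n = (case n of 0 \<Rightarrow> carrier (K 0) | Suc k \<Rightarrow> kernel (K n) (K k) (d k))"

definition boundaries where "boundaries n = d n ` carrier (K (Suc n))"

lemma d_group_hom: "group_hom (K (Suc n)) (K n) (d n)"
  by (intro group_hom_comm comm d_hom)

text \<open>With all of degree 0 counted as cycles, the two cases of the definition become one
  formula, and later arguments treat all degrees alike.\<close>

lemma chain_homology_eq: "chain_homology K d n = (K n)\<lparr>carrier := cycles n\<rparr> Mod boundaries n"
  by (cases n) (simp_all add: chain_homology_def cycles_def boundaries_def)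

lemma subgroup_cycles: "subgroup (cycles n) (K n)"
  unfolding cycles_def using comm_group.axioms(2)[OF comm] group.subgroup_self group_hom.subgroup_kernel[OF d_group_hom]
  by (cases n) auto

lemma subgroup_boundaries: "subgroup (boundaries n) (K n)"
  unfolding boundaries_def by (rule group_hom.img_is_subgroup[OF d_group_hom])

lemma boundaries_subset_cycles: "boundaries n \<subseteq> cycles n"
  using subgroup.subset[OF subgroup_boundaries] d_d d_hom
  by (cases n) (auto simp: boundaries_def cycles_def kernel_def hom_def Pi_iff)

lemma comm_group_cycles: "comm_group ((K n)\<lparr>carrier := cycles n\<rparr>)"
proof (rule group.group_comm_groupI)
  interpret comm_group "K n" by (rule comm)
  show "group ((K n)\<lparr>carrier := cycles n\<rparr>)" by (rule subgroup.subgroup_is_group[OF subgroup_cycles is_group])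
  show "x \<otimes>\<^bsub>(K n)\<lparr>carrier := cycles n\<rparr>\<^esub> y = y \<otimes>\<^bsub>(K n)\<lparr>carrier := cycles n\<rparr>\<^esub> x"
    if "x \<in> carrier ((K n)\<lparr>carrier := cycles n\<rparr>)" "y \<in> carrier ((K n)\<lparr>carrier := cycles n\<rparr>)" for x y
    using that subgroup.subset[OF subgroup_cycles] by (simp add: m_comm subset_iff)
qed

lemma subgroup_boundaries_cycles: "subgroup (boundaries n) ((K n)\<lparr>carrier := cycles n\<rparr>)"
  using group.subgroup_incl[OF comm_group.axioms(2)[OF comm] subgroup_boundaries subgroup_cycles boundaries_subset_cycles] .

end

text \<open>If \<open>f n z\<close> is a boundary, so is \<open>g n (f n z)\<close>; this is a
  boundary times \<open>z\<close>, so \<open>z\<close> is a boundary. A cycle \<open>y\<close> of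
  the other complex is reached from \<open>g n y\<close> up to a boundary. The conditions
  \<open>gf\<close> and \<open>fg\<close> concern cycles only, which is exactly what a chain
  homotopy provides, since one of its two terms vanishes there.\<close>

lemma (in ab_complex) chain_homology_iso:
  fixes L :: "nat \<Rightarrow> 'b monoid"
  assumes L: "ab_complex L d'"
    and f: "\<And>n. f n \<in> hom (K n) (L n)" and g: "\<And>n. g n \<in> hom (L n) (K n)"
    and fd: "\<And>n x. x \<in> carrier (K (Suc n)) \<Longrightarrow> d' n (f (Suc n) x) = f n (d n x)"
    and gd: "\<And>n y. y \<in> carrier (L (Suc n)) \<Longrightarrow> d n (g (Suc n) y) = g n (d' n y)"
    and gf: "\<And>n x. x \<in> cycles n \<Longrightarrow> \<exists>b\<in>boundaries n. g n (f n x) = b \<otimes>\<^bsub>K n\<^esub> x"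
    and fg: "\<And>n y. y \<in> ab_complex.cycles L d' n \<Longrightarrow> \<exists>b\<in>ab_complex.boundaries L d' n. f n (g n y) = b \<otimes>\<^bsub>L n\<^esub> y"
  shows "chain_homology K d n \<cong> chain_homology L d' n"
proof -
  interpret L: ab_complex L d' by fact
  have f_in: "f n x \<in> carrier (L n)" if "x \<in> carrier (K n)" for n x using f that by (auto simp: hom_def)
  have g_in: "g n x \<in> carrier (K n)" if "x \<in> carrier (L n)" for n x using g that by (auto simp: hom_def)
  have f1: "f n \<one>\<^bsub>K n\<^esub> = \<one>\<^bsub>L n\<^esub>" and g1: "g n \<one>\<^bsub>L n\<^esub> = \<one>\<^bsub>K n\<^esub>" for n
    using hom_one[OF f] hom_one[OF g] comm L.comm by (auto simp: comm_group_def)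
  have cf: "f n x \<in> L.cycles n" if "x \<in> cycles n" for n x
    using that by (cases n) (auto simp: cycles_def L.cycles_def kernel_def f_in fd f1)
  have cg: "g n x \<in> cycles n" if "x \<in> L.cycles n" for n x
    using that by (cases n) (auto simp: cycles_def L.cycles_def kernel_def g_in gd g1)
  have bf: "f n x \<in> L.boundaries n" if "x \<in> boundaries n" for n x
    using that fd[symmetric] f_in by (auto simp: boundaries_def L.boundaries_def)
  have bg: "g n x \<in> boundaries n" if "x \<in> L.boundaries n" for n x
    using that gd[symmetric] g_in by (auto simp: boundaries_def L.boundaries_def)
  interpret Kn: comm_group "K n" by (rule comm)
  note cK = subgroup.subset[OF subgroup_cycles] and bK = subgroup.subset[OF subgroup_boundaries]
  show ?thesis
    unfolding chain_homology_eq L.chain_homology_eq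
  proof (rule FactGroup_iso_of_hom[OF comm_group_cycles L.comm_group_cycles subgroup_boundaries_cycles
        L.subgroup_boundaries_cycles])
    show "f n \<in> hom ((K n)\<lparr>carrier := cycles n\<rparr>) ((L n)\<lparr>carrier := L.cycles n\<rparr>)"
      using hom_mult[OF f[of n]] cf cK by (intro homI) (auto simp: subset_iff)
  next
    fix z assume "z \<in> carrier ((K n)\<lparr>carrier := cycles n\<rparr>)"
    then have z: "z \<in> cycles n" by simp
    show "f n z \<in> L.boundaries n \<longleftrightarrow> z \<in> boundaries n"
    proof
      assume "f n z \<in> L.boundaries n"
      then have gfz: "g n (f n z) \<in> boundaries n" by (rule bg)
      obtain b where b: "b \<in> boundaries n" "g n (f n z) = b \<otimes>\<^bsub>K n\<^esub> z" using gf[OF z] by blast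
      have "z = inv\<^bsub>K n\<^esub> b \<otimes>\<^bsub>K n\<^esub> g n (f n z)"
        using b z cK bK by (metis Kn.inv_solve_left subsetD Kn.m_closed)
      then show "z \<in> boundaries n"
        using gfz b(1) subgroup.m_closed[OF subgroup_boundaries] subgroup.m_inv_closed[OF subgroup_boundaries] by metis
    qed (rule bf)
  next
    fix z' assume "z' \<in> carrier ((L n)\<lparr>carrier := L.cycles n\<rparr>)"
    then show "\<exists>z\<in>carrier ((K n)\<lparr>carrier := cycles n\<rparr>). \<exists>b\<in>L.boundaries n.
        f n z = b \<otimes>\<^bsub>(L n)\<lparr>carrier := L.cycles n\<rparr>\<^esub> z'"
      using cg fg by fastforce
  qed
qed

section \<open>Comparison of projective resolutions\<close>

context category begin

text \<open>Together with inverses this makes the natural maps between two modules an abelian group,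
  in which the differences needed for chain homotopies can be formed.\<close>

lemma nat_trans_mult:
  assumes A: "cat_module C A" and B: "cat_module C B" and f: "nat_trans C A B f" and g: "nat_trans C A B g"
  shows "nat_trans C A B (\<lambda>x a. f x a \<otimes>\<^bsub>fib B x\<^esub> g x a)"
  unfolding nat_trans_def
proof (intro conjI ballI)
  fix x assume x: "x \<in> objs C"
  interpret comm_group "fib B x" by (rule cat_module_comm_group[OF B x])
  show "(\<lambda>a. f x a \<otimes>\<^bsub>fib B x\<^esub> g x a) \<in> hom (fib A x) (fib B x)"
    using hom_mult[OF nat_trans_hom[OF f x]] hom_mult[OF nat_trans_hom[OF g x]]
      nat_trans_in[OF f x] nat_trans_in[OF g x]
    by (intro homI) (auto simp: m_ac)
next
  fix m a assume m: "m \<in> mors C" and a: "a \<in> carrier (fib A (src C m))"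
  then show "f (tgt C m) (act A m a) \<otimes>\<^bsub>fib B (tgt C m)\<^esub> g (tgt C m) (act A m a) =
      act B m (f (src C m) a \<otimes>\<^bsub>fib B (src C m)\<^esub> g (src C m) a)"
    using hom_mult[OF cat_module_act_hom[OF B m]] nat_trans_in[OF f src_in[OF m]] nat_trans_in[OF g src_in[OF m]]
      nat_trans_act[OF f] nat_trans_act[OF g] by simp
qed

lemma nat_trans_m_inv:
  assumes A: "cat_module C A" and B: "cat_module C B" and f: "nat_trans C A B f"
  shows "nat_trans C A B (\<lambda>x a. inv\<^bsub>fib B x\<^esub> f x a)"
  unfolding nat_trans_def
proof (intro conjI ballI)
  fix x assume x: "x \<in> objs C"
  interpret comm_group "fib B x" by (rule cat_module_comm_group[OF B x])
  show "(\<lambda>a. inv\<^bsub>fib B x\<^esub> f x a) \<in> hom (fib A x) (fib B x)"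
    using hom_mult[OF nat_trans_hom[OF f x]] nat_trans_in[OF f x]
    by (intro homI) (auto simp: inv_mult)
next
  fix m a assume m: "m \<in> mors C" and a: "a \<in> carrier (fib A (src C m))"
  interpret b: group_hom "fib B (src C m)" "fib B (tgt C m)" "act B m"
    by (intro group_hom_comm cat_module_comm_group[OF B] src_in tgt_in m cat_module_act_hom[OF B])
  show "inv\<^bsub>fib B (tgt C m)\<^esub> f (tgt C m) (act A m a) = act B m (inv\<^bsub>fib B (src C m)\<^esub> f (src C m) a)"
    using nat_trans_act[OF f m a] nat_trans_in[OF f src_in[OF m] a] by simp
qed

lemma nat_trans_ident: "nat_trans C A A (\<lambda>x a. a)"
  by (auto simp: nat_trans_def hom_def)

text \<open>By \<open>g\<phi>\<close> the map \<open>\<phi>\<close> lands in the kernel module of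
  \<open>g\<close>, and exactness says that \<open>f\<close> maps onto that module. So the lift
  exists by projectivity, applied to the surjection from \<open>L\<close> to the kernel
  module.\<close>

lemma projective_lifts_exact:
  assumes P: "projective C P" and L: "cat_module C L" and M: "cat_module C M" and N: "cat_module C N"
    and f: "nat_trans C L M f" and g: "nat_trans C M N g"
    and exact: "\<And>x. x \<in> objs C \<Longrightarrow> f x ` carrier (fib L x) = kernel (fib M x) (fib N x) (g x)"
    and \<phi>: "nat_trans C P M \<phi>"
    and g\<phi>: "\<And>x p. \<lbrakk>x \<in> objs C; p \<in> carrier (fib P x)\<rbrakk> \<Longrightarrow> g x (\<phi> x p) = \<one>\<^bsub>fib N x\<^esub>"
  obtains \<psi> where "nat_trans C P L \<psi>"
    and "\<And>x p. \<lbrakk>x \<in> objs C; p \<in> carrier (fib P x)\<rbrakk> \<Longrightarrow> f x (\<psi> x p) = \<phi> x p"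
proof -
  let ?K = "ker_module M N g"
  have K: "cat_module C ?K" by (rule cat_module_ker_module[OF M N g])
  have carK: "carrier (fib ?K x) = kernel (fib M x) (fib N x) (g x)"
    and multK: "(\<otimes>\<^bsub>fib ?K x\<^esub>) = (\<otimes>\<^bsub>fib M x\<^esub>)" and actK: "act ?K = act M" for x
    by (simp_all add: ker_module_def)
  have fK: "f x a \<in> carrier (fib ?K x)" if "x \<in> objs C" "a \<in> carrier (fib L x)" for x a
    unfolding carK using exact that by blast
  have "nat_trans C L ?K f"
    using f fK by (auto simp: nat_trans_def actK hom_def multK)
  moreover have "surjective C L ?K f" by (simp add: surjective_def exact carK)
  moreover have "\<phi> x p \<in> carrier (fib ?K x)" if "x \<in> objs C" "p \<in> carrier (fib P x)" for x p
    using g\<phi> nat_trans_in[OF \<phi>] that by (simp add: carK kernel_def)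
  then have "nat_trans C P ?K \<phi>"
    using \<phi> by (auto simp: nat_trans_def actK hom_def multK)
  ultimately show thesis
    using projective_lifts[OF P L K] that by metis
qed

lemma
  assumes R: "projective_resolution C A P d \<epsilon>"
  shows projective_resolution_projective: "projective C (P n)"
    and projective_resolution_module: "cat_module C (P n)"
    and projective_resolution_d: "nat_trans C (P (Suc n)) (P n) (d n)"
    and projective_resolution_eps: "nat_trans C (P 0) A \<epsilon>"
    and projective_resolution_onto: "surjective C (P 0) A \<epsilon>"
    and projective_resolution_exact_0: "x \<in> objs C \<Longrightarrow>
      d 0 x ` carrier (fib (P (Suc 0)) x) = kernel (fib (P 0) x) (fib A x) (\<epsilon> x)"
    and projective_resolution_exact: "x \<in> objs C \<Longrightarrow>
      d (Suc n) x ` carrier (fib (P (Suc (Suc n))) x) = kernel (fib (P (Suc n)) x) (fib (P n) x) (d n x)"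
    and projective_resolution_eps_d: "\<lbrakk>x \<in> objs C; p \<in> carrier (fib (P (Suc 0)) x)\<rbrakk> \<Longrightarrow> \<epsilon> x (d 0 x p) = \<one>\<^bsub>fib A x\<^esub>"
    and projective_resolution_d_d: "\<lbrakk>x \<in> objs C; q \<in> carrier (fib (P (Suc (Suc n))) x)\<rbrakk>
      \<Longrightarrow> d n x (d (Suc n) x q) = \<one>\<^bsub>fib (P n) x\<^esub>"
proof -
  show "projective C (P n)" for n using R by (simp add: projective_resolution_def)
  then show "cat_module C (P n)" by (simp add: projective_def)
  show "nat_trans C (P (Suc n)) (P n) (d n)" "nat_trans C (P 0) A \<epsilon>" "surjective C (P 0) A \<epsilon>"
    using R by (simp_all add: projective_resolution_def)
  show e0: "d 0 x ` carrier (fib (P (Suc 0)) x) = kernel (fib (P 0) x) (fib A x) (\<epsilon> x)" if "x \<in> objs C" for x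
    using R that by (simp add: projective_resolution_def)
  show eS: "d (Suc n) x ` carrier (fib (P (Suc (Suc n))) x) = kernel (fib (P (Suc n)) x) (fib (P n) x) (d n x)"
    if "x \<in> objs C" for x n using R that by (simp add: projective_resolution_def)
  show "\<epsilon> x (d 0 x p) = \<one>\<^bsub>fib A x\<^esub>" if "x \<in> objs C" "p \<in> carrier (fib (P (Suc 0)) x)"
    using e0[OF that(1)] that(2) by (auto simp: kernel_def)
  show "d n x (d (Suc n) x q) = \<one>\<^bsub>fib (P n) x\<^esub>" if "x \<in> objs C" "q \<in> carrier (fib (P (Suc (Suc n))) x)"
    using eS[OF that(1), of n] that(2) by (auto simp: kernel_def)
qed

lemma nat_trans_one:
  "\<lbrakk>cat_module C A; cat_module C B; nat_trans C A B f; x \<in> objs C\<rbrakk> \<Longrightarrow> f x \<one>\<^bsub>fib A x\<^esub> = \<one>\<^bsub>fib B x\<^esub>"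
  by (rule hom_one[OF nat_trans_hom cat_module_group cat_module_group])

text \<open>Each map lifts the composite of the previous one with the differential, through the
  exact resolution \<open>R\<close>. The two resolutions may have different element types, since
  \<open>projective_lifts\<close> is not tied to the types in the definition of
  \<open>projective\<close>.\<close>

lemma projective_resolution_chain_map:
  assumes A: "cat_module C A"
    and P: "projective_resolution C A P d \<epsilon>" and R: "projective_resolution C A R d' \<epsilon>'"
  obtains f where "\<And>n. nat_trans C (P n) (R n) (f n)"
    and "\<And>x p. \<lbrakk>x \<in> objs C; p \<in> carrier (fib (P 0) x)\<rbrakk> \<Longrightarrow> \<epsilon>' x (f 0 x p) = \<epsilon> x p"
    and "\<And>n x p. \<lbrakk>x \<in> objs C; p \<in> carrier (fib (P (Suc n)) x)\<rbrakk> \<Longrightarrow> d' n x (f (Suc n) x p) = f n x (d n x p)"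
proof -
  \<comment> \<open>The family is built from the latest map alone, so \<open>ok\<close> has to carry
    whatever the next lift uses: cycles go to cycles. In degree 0 the augmentations take the place
    of the differential, and compatibility with them is kept because it is part of the
    conclusion.\<close>
  define ok where "ok n f \<longleftrightarrow> nat_trans C (P n) (R n) f \<and> (case n of
      0 \<Rightarrow> \<forall>x\<in>objs C. \<forall>p\<in>carrier (fib (P 0) x). \<epsilon>' x (f x p) = \<epsilon> x p
    | Suc k \<Rightarrow> \<forall>x\<in>objs C. \<forall>p\<in>carrier (fib (P n) x). d k x p = \<one>\<^bsub>fib (P k) x\<^esub> \<longrightarrow> d' k x (f x p) = \<one>\<^bsub>fib (R k) x\<^esub>)"
    for n f
  define step where "step n f f' \<longleftrightarrow> (\<forall>x\<in>objs C. \<forall>p\<in>carrier (fib (P (Suc n)) x). d' n x (f' x p) = f x (d n x p))"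
    for n f f'
  note mP = projective_resolution_module[OF P] and mR = projective_resolution_module[OF R]
  have "\<exists>f. \<forall>n. ok n (f n) \<and> step n (f n) (f (Suc n))"
  proof (rule dependent_nat_choice)
    obtain f where "nat_trans C (P 0) (R 0) f"
      "\<And>x p. \<lbrakk>x \<in> objs C; p \<in> carrier (fib (P 0) x)\<rbrakk> \<Longrightarrow> \<epsilon>' x (f x p) = \<epsilon> x p"
      by (rule projective_lifts[OF projective_resolution_projective[OF P] mR A projective_resolution_eps[OF R]
        projective_resolution_onto[OF R] projective_resolution_eps[OF P]]) blast
    then show "\<exists>f. ok 0 f" by (auto simp: ok_def)
  next
    fix f n assume f: "ok n f"
    have fn: "nat_trans C (P n) (R n) f" using f by (simp add: ok_def)
    note \<phi> = nat_trans_comp[OF projective_resolution_d[OF P, of n] fn]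
    have "\<exists>f'. nat_trans C (P (Suc n)) (R (Suc n)) f' \<and> step n f f'"
    proof (cases n)
      case 0
      have "\<epsilon>' x ((f x \<circ> d n x) p) = \<one>\<^bsub>fib A x\<^esub>" if "x \<in> objs C" "p \<in> carrier (fib (P (Suc n)) x)" for x p
        using f that projective_resolution_eps_d[OF P, of x p] nat_trans_in[OF projective_resolution_d[OF P, of 0], of x p]
        by (simp add: ok_def 0)
      then obtain f' where "nat_trans C (P (Suc 0)) (R (Suc 0)) f'"
        "\<And>x p. \<lbrakk>x \<in> objs C; p \<in> carrier (fib (P (Suc 0)) x)\<rbrakk> \<Longrightarrow> d' 0 x (f' x p) = (f x \<circ> d 0 x) p"
        using projective_lifts_exact[OF projective_resolution_projective[OF P, of "Suc 0"] mR mR A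
            projective_resolution_d[OF R] projective_resolution_eps[OF R] projective_resolution_exact_0[OF R] \<phi>[unfolded 0]]
        unfolding 0 by blast
      then show ?thesis unfolding step_def 0 by (metis comp_apply)
    next
      case (Suc k)
      have "d' k x ((f x \<circ> d n x) p) = \<one>\<^bsub>fib (R k) x\<^esub>" if "x \<in> objs C" "p \<in> carrier (fib (P (Suc n)) x)" for x p
        using f that projective_resolution_d_d[OF P, of x p k] nat_trans_in[OF projective_resolution_d[OF P, of "Suc k"], of x p]
        by (simp add: ok_def Suc)
      then obtain f' where "nat_trans C (P (Suc n)) (R (Suc n)) f'"
        "\<And>x p. \<lbrakk>x \<in> objs C; p \<in> carrier (fib (P (Suc n)) x)\<rbrakk> \<Longrightarrow> d' n x (f' x p) = (f x \<circ> d n x) p"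
        using projective_lifts_exact[OF projective_resolution_projective[OF P, of "Suc (Suc k)"] mR mR mR
            projective_resolution_d[OF R] projective_resolution_d[OF R] projective_resolution_exact[OF R] \<phi>[unfolded Suc]]
        unfolding Suc by blast
      then show ?thesis unfolding step_def by (metis comp_apply)
    qed
    then obtain f' where f': "nat_trans C (P (Suc n)) (R (Suc n)) f'" "step n f f'" by blast
    then have "ok (Suc n) f'" using nat_trans_one[OF mP mR fn] unfolding ok_def step_def by simp
    with f' show "\<exists>f'. ok (Suc n) f' \<and> step n f f'" by blast
  qed
  then obtain f where f: "\<And>n. ok n (f n)" "\<And>n. step n (f n) (f (Suc n))" by blast
  show thesis
  proof
    show "nat_trans C (P n) (R n) (f n)" for n using f(1) unfolding ok_def by blast
    show "\<epsilon>' x (f 0 x p) = \<epsilon> x p" if "x \<in> objs C" "p \<in> carrier (fib (P 0) x)" for x p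
      using f(1)[of 0] that by (simp add: ok_def)
    show "d' n x (f (Suc n) x p) = f n x (d n x p)" if "x \<in> objs C" "p \<in> carrier (fib (P (Suc n)) x)" for n x p
      using f(2) that by (simp add: step_def)
  qed
qed

text \<open>In additive notation the conclusion is \<open>h - id = d s + s d\<close>, where the
  second term is absent in degree 0. Once \<open>s\<close> is known below,
  \<open>h - id - s d\<close> consists of cycles and lifts through the next differential. The lemma
  is meant for \<open>h\<close> the composite of two comparison maps, which lies over the identity
  of \<open>A\<close>.\<close>

lemma projective_resolution_homotopy:
  assumes A: "cat_module C A" and P: "projective_resolution C A P d \<epsilon>"
    and h: "\<And>n. nat_trans C (P n) (P n) (h n)"
    and eps_h: "\<And>x p. \<lbrakk>x \<in> objs C; p \<in> carrier (fib (P 0) x)\<rbrakk> \<Longrightarrow> \<epsilon> x (h 0 x p) = \<epsilon> x p"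
    and d_h: "\<And>n x p. \<lbrakk>x \<in> objs C; p \<in> carrier (fib (P (Suc n)) x)\<rbrakk> \<Longrightarrow> d n x (h (Suc n) x p) = h n x (d n x p)"
  obtains s where "\<And>n. nat_trans C (P n) (P (Suc n)) (s n)"
    and "\<And>x p. \<lbrakk>x \<in> objs C; p \<in> carrier (fib (P 0) x)\<rbrakk> \<Longrightarrow> h 0 x p = d 0 x (s 0 x p) \<otimes>\<^bsub>fib (P 0) x\<^esub> p"
    and "\<And>n x p. \<lbrakk>x \<in> objs C; p \<in> carrier (fib (P (Suc n)) x)\<rbrakk> \<Longrightarrow>
      h (Suc n) x p = d (Suc n) x (s (Suc n) x p) \<otimes>\<^bsub>fib (P (Suc n)) x\<^esub> (s n x (d n x p) \<otimes>\<^bsub>fib (P (Suc n)) x\<^esub> p)"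
proof -
  note mP = projective_resolution_module[OF P] and dP = projective_resolution_d[OF P]
    and pP = projective_resolution_projective[OF P] and \<epsilon> = projective_resolution_eps[OF P]
  \<comment> \<open>On cycles the term \<open>s d\<close> of the previous degree drops out, so
    \<open>ok n s\<close> speaks of \<open>s\<close> alone. In degree 0 its premise is vacuous, and
    the formula is demanded of all elements.\<close>
  define ok where "ok n s \<longleftrightarrow> nat_trans C (P n) (P (Suc n)) s \<and> (\<forall>x\<in>objs C. \<forall>p\<in>carrier (fib (P n) x).
      (\<forall>k. n = Suc k \<longrightarrow> d k x p = \<one>\<^bsub>fib (P k) x\<^esub>) \<longrightarrow> h n x p = d n x (s x p) \<otimes>\<^bsub>fib (P n) x\<^esub> p)" for n s
  define step where "step n s s' \<longleftrightarrow> (\<forall>x\<in>objs C. \<forall>p\<in>carrier (fib (P (Suc n)) x).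
      h (Suc n) x p = d (Suc n) x (s' x p) \<otimes>\<^bsub>fib (P (Suc n)) x\<^esub> (s x (d n x p) \<otimes>\<^bsub>fib (P (Suc n)) x\<^esub> p))" for n s s'
  have "\<exists>s. \<forall>n. ok n (s n) \<and> step n (s n) (s (Suc n))"
  proof (rule dependent_nat_choice)
    let ?\<phi> = "\<lambda>x p. h 0 x p \<otimes>\<^bsub>fib (P 0) x\<^esub> inv\<^bsub>fib (P 0) x\<^esub> p"
    have \<phi>: "nat_trans C (P 0) (P 0) ?\<phi>"
      by (intro nat_trans_mult nat_trans_m_inv mP h nat_trans_ident)
    have "\<epsilon> x (?\<phi> x p) = \<one>\<^bsub>fib A x\<^esub>" if x: "x \<in> objs C" and p: "p \<in> carrier (fib (P 0) x)" for x p
    proof -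
      interpret e: group_hom "fib (P 0) x" "fib A x" "\<epsilon> x" by (rule nat_trans_group_hom[OF mP A \<epsilon> x])
      show ?thesis using eps_h[OF x p] p nat_trans_in[OF h x p] by simp
    qed
    then obtain s where s: "nat_trans C (P 0) (P (Suc 0)) s"
      "\<And>x p. \<lbrakk>x \<in> objs C; p \<in> carrier (fib (P 0) x)\<rbrakk> \<Longrightarrow> d 0 x (s x p) = ?\<phi> x p"
      using projective_lifts_exact[OF pP mP mP A dP \<epsilon> projective_resolution_exact_0[OF P] \<phi>] by blast
    have "h 0 x p = d 0 x (s x p) \<otimes>\<^bsub>fib (P 0) x\<^esub> p" if x: "x \<in> objs C" and p: "p \<in> carrier (fib (P 0) x)" for x p
    proof -
      interpret comm_group "fib (P 0) x" by (rule cat_module_comm_group[OF mP x])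
      show ?thesis using s(2)[OF x p] p nat_trans_in[OF h x p] by (simp add: m_assoc)
    qed
    with s(1) show "\<exists>s. ok 0 s" unfolding ok_def by blast
  next
    fix s n assume s: "ok n s"
    have sn: "nat_trans C (P n) (P (Suc n)) s" using s by (simp add: ok_def)
    let ?N = "Suc n"
    \<comment> \<open>Additively this is \<open>h - s d - id\<close>. Its image under
      \<open>d\<close> is trivial because \<open>d (h p) = h (d p)\<close>, while
      \<open>ok n s\<close>, applied to the element \<open>d p\<close>, gives
      \<open>h (d p) = d (s (d p)) + d p\<close>.\<close>
    let ?\<phi> = "\<lambda>x p. h ?N x p \<otimes>\<^bsub>fib (P ?N) x\<^esub> inv\<^bsub>fib (P ?N) x\<^esub> (s x (d n x p) \<otimes>\<^bsub>fib (P ?N) x\<^esub> p)"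
    have sd: "nat_trans C (P ?N) (P ?N) (\<lambda>x p. s x (d n x p))"
      using nat_trans_comp[OF dP sn] by (simp add: comp_def)
    have \<phi>: "nat_trans C (P ?N) (P ?N) ?\<phi>"
      by (intro nat_trans_mult nat_trans_m_inv mP h nat_trans_ident sd)
    have "d n x (?\<phi> x p) = \<one>\<^bsub>fib (P n) x\<^esub>" if x: "x \<in> objs C" and p: "p \<in> carrier (fib (P ?N) x)" for x p
    proof -
      interpret d: group_hom "fib (P ?N) x" "fib (P n) x" "d n x" by (rule nat_trans_group_hom[OF mP mP dP x])
      have dp: "d n x p \<in> carrier (fib (P n) x)" using p by simp
      have "h n x (d n x p) = d n x (s x (d n x p)) \<otimes>\<^bsub>fib (P n) x\<^esub> d n x p"
      proof -
        have "d k x (d n x p) = \<one>\<^bsub>fib (P k) x\<^esub>" if "n = Suc k" for k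
          using projective_resolution_d_d[OF P x] p that by blast
        then show ?thesis using s x dp unfolding ok_def by blast
      qed
      then show ?thesis using d_h[OF x p] p nat_trans_in[OF h x p] nat_trans_in[OF sd x p] nat_trans_in[OF h x dp] by simp
    qed
    then obtain s' where s': "nat_trans C (P ?N) (P (Suc ?N)) s'"
      "\<And>x p. \<lbrakk>x \<in> objs C; p \<in> carrier (fib (P ?N) x)\<rbrakk> \<Longrightarrow> d ?N x (s' x p) = ?\<phi> x p"
      using projective_lifts_exact[OF pP mP mP mP dP dP projective_resolution_exact[OF P] \<phi>] by blast
    have "h ?N x p = d ?N x (s' x p) \<otimes>\<^bsub>fib (P ?N) x\<^esub> (s x (d n x p) \<otimes>\<^bsub>fib (P ?N) x\<^esub> p)"
      if x: "x \<in> objs C" and p: "p \<in> carrier (fib (P ?N) x)" for x p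
    proof -
      interpret comm_group "fib (P ?N) x" by (rule cat_module_comm_group[OF mP x])
      show ?thesis using s'(2)[OF x p] p nat_trans_in[OF h x p] nat_trans_in[OF sd x p]
        by (simp add: m_assoc del: inv_mult_group)
    qed
    then have step: "step n s s'" by (simp add: step_def)
    have "h ?N x p = d ?N x (s' x p) \<otimes>\<^bsub>fib (P ?N) x\<^esub> p"
      if x: "x \<in> objs C" and p: "p \<in> carrier (fib (P ?N) x)" and "d n x p = \<one>\<^bsub>fib (P n) x\<^esub>" for x p
    proof -
      interpret comm_group "fib (P ?N) x" by (rule cat_module_comm_group[OF mP x])
      show ?thesis using step x p that(3) nat_trans_one[OF mP mP sn x] by (simp add: step_def)
    qed
    then have "ok ?N s'" using s'(1) by (simp add: ok_def)
    with step show "\<exists>s'. ok (Suc n) s' \<and> step n s s'" by blast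
  qed
  then obtain s where s: "\<And>n. ok n (s n)" "\<And>n. step n (s n) (s (Suc n))" by blast
  show thesis
  proof
    show "nat_trans C (P n) (P (Suc n)) (s n)" for n using s(1) unfolding ok_def by blast
    show "h 0 x p = d 0 x (s 0 x p) \<otimes>\<^bsub>fib (P 0) x\<^esub> p" if "x \<in> objs C" "p \<in> carrier (fib (P 0) x)" for x p
      using s(1)[of 0] that by (simp add: ok_def)
    show "h (Suc n) x p = d (Suc n) x (s (Suc n) x p) \<otimes>\<^bsub>fib (P (Suc n)) x\<^esub> (s n x (d n x p) \<otimes>\<^bsub>fib (P (Suc n)) x\<^esub> p)"
      if "x \<in> objs C" "p \<in> carrier (fib (P (Suc n)) x)" for n x p
      using s(2) that by (simp add: step_def)
  qed
qed

section \<open>The colimit as an additive functor\<close>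

lemma colim_map_comp:
  assumes L: "cat_module C L" and M: "cat_module C M" and N: "cat_module C N"
    and f: "nat_trans C L M f" and g: "nat_trans C M N g" and X: "X \<in> carrier (colim C L)"
  shows "colim_map C M N g (colim_map C L M f X) = colim_map C L N (\<lambda>x. g x \<circ> f x) X"
proof -
  have "(colim_map C M N g \<circ> colim_map C L M f) X = colim_map C L N (\<lambda>x. g x \<circ> f x) X"
    by (rule colim_hom_eqI[OF L _ hom_compose[OF colim_map_hom[OF L M f] colim_map_hom[OF M N g]]
        colim_map_hom[OF L N nat_trans_comp[OF f g]] _ X])
      (simp_all add: comm_group.axioms(2)[OF comm_group_colim[OF N]] colim_map_in[OF L M f] colim_map_in[OF M N g]
        colim_map_in[OF L N nat_trans_comp[OF f g]] nat_trans_in[OF f])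
  then show ?thesis by simp
qed

lemma colim_map_cong:
  assumes L: "cat_module C L" and M: "cat_module C M"
    and f: "nat_trans C L M f" and g: "nat_trans C L M g"
    and eq: "\<And>x a. \<lbrakk>x \<in> objs C; a \<in> carrier (fib L x)\<rbrakk> \<Longrightarrow> f x a = g x a"
    and X: "X \<in> carrier (colim C L)"
  shows "colim_map C L M f X = colim_map C L M g X"
  by (rule colim_hom_eqI[OF L _ colim_map_hom[OF L M f] colim_map_hom[OF L M g] _ X])
    (simp_all add: comm_group.axioms(2)[OF comm_group_colim[OF M]] colim_map_in[OF L M f] colim_map_in[OF L M g] eq)

lemma colim_map_mult:
  assumes L: "cat_module C L" and M: "cat_module C M"
    and f: "nat_trans C L M f" and g: "nat_trans C L M g" and X: "X \<in> carrier (colim C L)"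
  shows "colim_map C L M (\<lambda>x a. f x a \<otimes>\<^bsub>fib M x\<^esub> g x a) X = colim_map C L M f X \<otimes>\<^bsub>colim C M\<^esub> colim_map C L M g X"
proof -
  interpret comm_group "colim C M" by (rule comm_group_colim[OF M])
  note fg = nat_trans_mult[OF L M f g]
  have h: "(\<lambda>X. colim_map C L M f X \<otimes>\<^bsub>colim C M\<^esub> colim_map C L M g X) \<in> hom (colim C L) (colim C M)"
    using hom_mult[OF colim_map_hom[OF L M f]] hom_mult[OF colim_map_hom[OF L M g]]
      hom_in_carrier[OF colim_map_hom[OF L M f]] hom_in_carrier[OF colim_map_hom[OF L M g]]
    by (intro homI) (auto simp: m_ac)
  show ?thesis
    by (rule colim_hom_eqI[OF L _ colim_map_hom[OF L M fg] h _ X])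
      (simp_all add: colim_map_in[OF L M f] colim_map_in[OF L M g] colim_map_in[OF L M fg]
        hom_mult[OF colim_in_hom[OF M]] nat_trans_in[OF f] nat_trans_in[OF g])
qed

lemma colim_map_ident:
  assumes L: "cat_module C L" and X: "X \<in> carrier (colim C L)"
  shows "colim_map C L L (\<lambda>x a. a) X = X"
proof -
  have "colim_map C L L (\<lambda>x a. a) X = id X"
    by (rule colim_hom_eqI[OF L _ colim_map_hom[OF L L nat_trans_ident] _ _ X])
      (simp_all add: comm_group.axioms(2)[OF comm_group_colim[OF L]] colim_map_in[OF L L nat_trans_ident] hom_def)
  then show ?thesis by simp
qed

lemma colim_map_trivial:
  assumes L: "cat_module C L" and M: "cat_module C M" and f: "nat_trans C L M f"
    and eq: "\<And>x a. \<lbrakk>x \<in> objs C; a \<in> carrier (fib L x)\<rbrakk> \<Longrightarrow> f x a = \<one>\<^bsub>fib M x\<^esub>"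
    and X: "X \<in> carrier (colim C L)"
  shows "colim_map C L M f X = \<one>\<^bsub>colim C M\<^esub>"
proof -
  interpret comm_group "colim C M" by (rule comm_group_colim[OF M])
  have h: "(\<lambda>_. \<one>\<^bsub>colim C M\<^esub>) \<in> hom (colim C L) (colim C M)" by (auto simp: hom_def)
  show ?thesis
    by (rule colim_hom_eqI[OF L _ colim_map_hom[OF L M f] h _ X])
      (simp_all add: colim_map_in[OF L M f] eq hom_one[OF colim_in_hom[OF M] cat_module_group[OF M]] is_group)
qed

section \<open>Independence of the homology from the resolution\<close>

lemma ab_complex_colim:
  assumes P: "projective_resolution C A P d \<epsilon>"
  shows "ab_complex (\<lambda>n. colim C (P n)) (\<lambda>n. colim_map C (P (Suc n)) (P n) (d n))"
proof (rule ab_complex.intro)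
  note mP = projective_resolution_module[OF P] and dP = projective_resolution_d[OF P]
  show "comm_group (colim C (P n))" for n by (rule comm_group_colim[OF mP])
  show "colim_map C (P (Suc n)) (P n) (d n) \<in> hom (colim C (P (Suc n))) (colim C (P n))" for n
    by (rule colim_map_hom[OF mP mP dP])
  show "colim_map C (P (Suc n)) (P n) (d n) (colim_map C (P (Suc (Suc n))) (P (Suc n)) (d (Suc n)) X) = \<one>\<^bsub>colim C (P n)\<^esub>"
    if "X \<in> carrier (colim C (P (Suc (Suc n))))" for n X
    unfolding colim_map_comp[OF mP mP mP dP dP that]
    by (rule colim_map_trivial[OF mP mP nat_trans_comp[OF dP dP] _ that])
      (simp add: projective_resolution_d_d[OF P])
qed

text \<open>An additive functor preserves chain homotopies, so the homotopy from \<open>h\<close> to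
  the identity passes to the complex of colimits. On a cycle \<open>X\<close> its summand through
  the outgoing differential is trivial, and what remains is the boundary \<open>?b\<close> of the
  image of \<open>X\<close> under \<open>s\<close>.\<close>

lemma colim_homotopy:
  assumes A: "cat_module C A" and P: "projective_resolution C A P d \<epsilon>"
    and h: "\<And>n. nat_trans C (P n) (P n) (h n)"
    and eps_h: "\<And>x p. \<lbrakk>x \<in> objs C; p \<in> carrier (fib (P 0) x)\<rbrakk> \<Longrightarrow> \<epsilon> x (h 0 x p) = \<epsilon> x p"
    and d_h: "\<And>n x p. \<lbrakk>x \<in> objs C; p \<in> carrier (fib (P (Suc n)) x)\<rbrakk> \<Longrightarrow> d n x (h (Suc n) x p) = h n x (d n x p)"
    and X: "X \<in> ab_complex.cycles (\<lambda>n. colim C (P n)) (\<lambda>n. colim_map C (P (Suc n)) (P n) (d n)) n"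
  shows "\<exists>b\<in>ab_complex.boundaries (\<lambda>n. colim C (P n)) (\<lambda>n. colim_map C (P (Suc n)) (P n) (d n)) n.
    colim_map C (P n) (P n) (h n) X = b \<otimes>\<^bsub>colim C (P n)\<^esub> X"
proof -
  note mP = projective_resolution_module[OF P] and dP = projective_resolution_d[OF P]
  interpret K: ab_complex "\<lambda>n. colim C (P n)" "\<lambda>n. colim_map C (P (Suc n)) (P n) (d n)"
    by (rule ab_complex_colim[OF P])
  obtain s where s: "\<And>n. nat_trans C (P n) (P (Suc n)) (s n)"
    and s0: "\<And>x p. \<lbrakk>x \<in> objs C; p \<in> carrier (fib (P 0) x)\<rbrakk> \<Longrightarrow> h 0 x p = d 0 x (s 0 x p) \<otimes>\<^bsub>fib (P 0) x\<^esub> p"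
    and sS: "\<And>n x p. \<lbrakk>x \<in> objs C; p \<in> carrier (fib (P (Suc n)) x)\<rbrakk> \<Longrightarrow>
      h (Suc n) x p = d (Suc n) x (s (Suc n) x p) \<otimes>\<^bsub>fib (P (Suc n)) x\<^esub> (s n x (d n x p) \<otimes>\<^bsub>fib (P (Suc n)) x\<^esub> p)"
    using projective_resolution_homotopy[of A P d \<epsilon> h, OF A P h eps_h d_h] by metis
  have Xc: "X \<in> carrier (colim C (P n))" using X subgroup.subset[OF K.subgroup_cycles] by blast
  interpret comm_group "colim C (P n)" by (rule K.comm)
  let ?b = "colim_map C (P (Suc n)) (P n) (d n) (colim_map C (P n) (P (Suc n)) (s n) X)"
  have ds: "nat_trans C (P n) (P n) (\<lambda>x. d n x \<circ> s n x)" by (rule nat_trans_comp[OF s dP])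
  have b: "?b = colim_map C (P n) (P n) (\<lambda>x. d n x \<circ> s n x) X"
    by (rule colim_map_comp[OF mP mP mP s dP Xc])
  have "colim_map C (P n) (P n) (h n) X = ?b \<otimes>\<^bsub>colim C (P n)\<^esub> X"
  proof (cases n)
    case 0
    have "colim_map C (P n) (P n) (h n) X = colim_map C (P n) (P n) (\<lambda>x p. (d n x \<circ> s n x) p \<otimes>\<^bsub>fib (P n) x\<^esub> p) X"
      by (rule colim_map_cong[OF mP mP h nat_trans_mult[OF mP mP ds nat_trans_ident] _ Xc])
        (simp add: 0 s0)
    then show ?thesis
      by (simp only: b colim_map_mult[OF mP mP ds nat_trans_ident Xc] colim_map_ident[OF mP Xc])
  next
    case (Suc k)
    have sd: "nat_trans C (P n) (P n) (\<lambda>x. s k x \<circ> d k x)" unfolding Suc by (rule nat_trans_comp[OF dP s])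
    have "colim_map C (P n) (P n) (\<lambda>x. s k x \<circ> d k x) X =
        colim_map C (P k) (P n) (s k) (colim_map C (P n) (P k) (d k) X)"
      using colim_map_comp[OF mP mP mP dP s, of X k] Xc unfolding Suc by simp
    also have "colim_map C (P n) (P k) (d k) X = \<one>\<^bsub>colim C (P k)\<^esub>"
      using X by (simp add: K.cycles_def Suc kernel_def)
    also have "colim_map C (P k) (P n) (s k) \<one>\<^bsub>colim C (P k)\<^esub> = \<one>\<^bsub>colim C (P n)\<^esub>"
      unfolding Suc
      by (rule hom_one[OF colim_map_hom[OF mP mP s]]) (simp_all add: comm_group.axioms(2)[OF K.comm])
    finally have 1: "colim_map C (P n) (P n) (\<lambda>x. s k x \<circ> d k x) X = \<one>\<^bsub>colim C (P n)\<^esub>" .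
    note t = nat_trans_mult[OF mP mP sd nat_trans_ident]
    have "colim_map C (P n) (P n) (h n) X = colim_map C (P n) (P n)
        (\<lambda>x p. (d n x \<circ> s n x) p \<otimes>\<^bsub>fib (P n) x\<^esub> ((s k x \<circ> d k x) p \<otimes>\<^bsub>fib (P n) x\<^esub> p)) X"
      by (rule colim_map_cong[OF mP mP h nat_trans_mult[OF mP mP ds t] _ Xc])
        (simp add: Suc sS)
    then show ?thesis
      using Xc by (simp only: b colim_map_mult[OF mP mP ds t Xc] colim_map_mult[OF mP mP sd nat_trans_ident Xc]
          colim_map_ident[OF mP Xc] 1 l_one)
  qed
  moreover have "?b \<in> K.boundaries n"
    unfolding K.boundaries_def using hom_in_carrier[OF colim_map_hom[OF mP mP s] Xc] by blast
  ultimately show ?thesis by blast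
qed

text \<open>The identity of \<open>A\<close> lifts to chain maps \<open>f\<close> and
  \<open>g\<close> in both directions. Their composites lie over the identity again, hence are
  homotopic to it, and \<open>colim_homotopy\<close> supplies the hypotheses of
  \<open>chain_homology_iso\<close>.\<close>

theorem projective_resolution_homology_iso:
  assumes A: "cat_module C A"
    and P: "projective_resolution C A P d \<epsilon>" and R: "projective_resolution C A R d' \<epsilon>'"
  shows "chain_homology (\<lambda>n. colim C (P n)) (\<lambda>n. colim_map C (P (Suc n)) (P n) (d n)) n \<cong>
    chain_homology (\<lambda>n. colim C (R n)) (\<lambda>n. colim_map C (R (Suc n)) (R n) (d' n)) n"
proof -
  note mP = projective_resolution_module[OF P] and dP = projective_resolution_d[OF P]
  note mR = projective_resolution_module[OF R] and dR = projective_resolution_d[OF R]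
  interpret K: ab_complex "\<lambda>n. colim C (P n)" "\<lambda>n. colim_map C (P (Suc n)) (P n) (d n)"
    by (rule ab_complex_colim[OF P])
  interpret L: ab_complex "\<lambda>n. colim C (R n)" "\<lambda>n. colim_map C (R (Suc n)) (R n) (d' n)"
    by (rule ab_complex_colim[OF R])
  obtain f where f: "\<And>n. nat_trans C (P n) (R n) (f n)"
    and f0: "\<And>x p. \<lbrakk>x \<in> objs C; p \<in> carrier (fib (P 0) x)\<rbrakk> \<Longrightarrow> \<epsilon>' x (f 0 x p) = \<epsilon> x p"
    and fS: "\<And>n x p. \<lbrakk>x \<in> objs C; p \<in> carrier (fib (P (Suc n)) x)\<rbrakk> \<Longrightarrow> d' n x (f (Suc n) x p) = f n x (d n x p)"
    using projective_resolution_chain_map[OF A P R] by metis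
  obtain g where g: "\<And>n. nat_trans C (R n) (P n) (g n)"
    and g0: "\<And>x p. \<lbrakk>x \<in> objs C; p \<in> carrier (fib (R 0) x)\<rbrakk> \<Longrightarrow> \<epsilon> x (g 0 x p) = \<epsilon>' x p"
    and gS: "\<And>n x p. \<lbrakk>x \<in> objs C; p \<in> carrier (fib (R (Suc n)) x)\<rbrakk> \<Longrightarrow> d n x (g (Suc n) x p) = g n x (d' n x p)"
    using projective_resolution_chain_map[OF A R P] by metis
  show ?thesis
  proof (rule K.chain_homology_iso[OF L.ab_complex_axioms,
        of "\<lambda>n. colim_map C (P n) (R n) (f n)" "\<lambda>n. colim_map C (R n) (P n) (g n)"])
    show "colim_map C (P n) (R n) (f n) \<in> hom (colim C (P n)) (colim C (R n))" for n
      by (rule colim_map_hom[OF mP mR f])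
    show "colim_map C (R n) (P n) (g n) \<in> hom (colim C (R n)) (colim C (P n))" for n
      by (rule colim_map_hom[OF mR mP g])
    show "colim_map C (R (Suc n)) (R n) (d' n) (colim_map C (P (Suc n)) (R (Suc n)) (f (Suc n)) X) =
        colim_map C (P n) (R n) (f n) (colim_map C (P (Suc n)) (P n) (d n) X)"
      if X: "X \<in> carrier (colim C (P (Suc n)))" for n X
      unfolding colim_map_comp[OF mP mR mR f dR X] colim_map_comp[OF mP mP mR dP f X]
      by (rule colim_map_cong[OF mP mR nat_trans_comp[OF f dR] nat_trans_comp[OF dP f] _ X]) (simp add: fS)
    show "colim_map C (P (Suc n)) (P n) (d n) (colim_map C (R (Suc n)) (P (Suc n)) (g (Suc n)) X) =
        colim_map C (R n) (P n) (g n) (colim_map C (R (Suc n)) (R n) (d' n) X)"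
      if X: "X \<in> carrier (colim C (R (Suc n)))" for n X
      unfolding colim_map_comp[OF mR mP mP g dP X] colim_map_comp[OF mR mR mP dR g X]
      by (rule colim_map_cong[OF mR mP nat_trans_comp[OF g dP] nat_trans_comp[OF dR g] _ X]) (simp add: gS)
    show "\<exists>b\<in>K.boundaries n. colim_map C (R n) (P n) (g n) (colim_map C (P n) (R n) (f n) X) = b \<otimes>\<^bsub>colim C (P n)\<^esub> X"
      if X: "X \<in> K.cycles n" for n X
    proof -
      have "X \<in> carrier (colim C (P n))" using X subgroup.subset[OF K.subgroup_cycles] by blast
      then show ?thesis
        unfolding colim_map_comp[OF mP mR mP f g \<open>X \<in> carrier (colim C (P n))\<close>]
        by (intro colim_homotopy[OF A P _ _ _ X] nat_trans_comp[OF f g])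
          (simp_all add: f0 g0 fS gS nat_trans_in[OF f] nat_trans_in[OF g])
    qed
    show "\<exists>b\<in>L.boundaries n. colim_map C (P n) (R n) (f n) (colim_map C (R n) (P n) (g n) X) = b \<otimes>\<^bsub>colim C (R n)\<^esub> X"
      if X: "X \<in> L.cycles n" for n X
    proof -
      have "X \<in> carrier (colim C (R n))" using X subgroup.subset[OF L.subgroup_cycles] by blast
      then show ?thesis
        unfolding colim_map_comp[OF mR mP mR g f \<open>X \<in> carrier (colim C (R n))\<close>]
        by (intro colim_homotopy[OF A R _ _ _ X] nat_trans_comp[OF g f])
          (simp_all add: f0 g0 fS gS nat_trans_in[OF f] nat_trans_in[OF g])
    qed
  qed
qed

text \<open>The resolution chosen in \<open>cat_homology\<close> is a genuine one because some
  resolution over the type of generators exists; the given \<open>P\<close> may be over any type.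
  Both directions are recorded so that the final chain of isomorphisms closes by
  transitivity.\<close>

corollary
  assumes A: "cat_module C A" and P: "projective_resolution C A P d \<epsilon>"
  shows cat_homology_iso: "cat_homology n C A \<cong>
      chain_homology (\<lambda>n. colim C (P n)) (\<lambda>n. colim_map C (P (Suc n)) (P n) (d n)) n" (is "?l \<cong> ?r")
    and iso_cat_homology:
      "chain_homology (\<lambda>n. colim C (P n)) (\<lambda>n. colim_map C (P (Suc n)) (P n) (d n)) n \<cong> cat_homology n C A"
proof -
  obtain R d' where R: "some_resolution C A = (R, d')" by fastforce
  have "\<exists>\<epsilon>'. projective_resolution C A R d' \<epsilon>'"
    using R someI_ex[of "\<lambda>(P, d). \<exists>\<epsilon>. projective_resolution C A P d \<epsilon>"] projective_resolution_exists[OF A]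
    unfolding some_resolution_def by fastforce
  then show "?l \<cong> ?r" "?r \<cong> ?l"
    using projective_resolution_homology_iso[OF A _ P] projective_resolution_homology_iso[OF A P]
    by (auto simp: cat_homology_def R)
qed

end

section \<open>Directed colimits\<close>

text \<open>A directed preorder, seen as a category. Its morphisms point towards the common bounds;
  in \<open>class_poset\<close> they point from larger to smaller identities, so that directedness
  there means having lower bounds.\<close>

locale directed_category = category +
  assumes thin: "\<lbrakk>m \<in> mors C; n \<in> mors C; src C m = src C n; tgt C m = tgt C n\<rbrakk> \<Longrightarrow> m = n"
    and directed: "\<lbrakk>x \<in> objs C; y \<in> objs C\<rbrakk> \<Longrightarrow>
      \<exists>m\<in>mors C. \<exists>n\<in>mors C. src C m = x \<and> src C n = y \<and> tgt C m = tgt C n"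
    and nonempty: "objs C \<noteq> {}"
begin

text \<open>Two canonical images can be moved along morphisms to a common target and multiplied in
  that one fibre, so a single fibre always suffices. The unit comes from any fibre, one existing by
  \<open>nonempty\<close>.\<close>

lemma colim_in_cases:
  assumes A: "cat_module C A" and X: "X \<in> carrier (colim C A)"
  obtains x a where "x \<in> objs C" "a \<in> carrier (fib A x)" "X = colim_in C A x a"
proof -
  have "\<exists>x\<in>objs C. \<exists>a\<in>carrier (fib A x). X = colim_in C A x a"
  proof (rule colim_induct[OF A X])
    obtain x where x: "x \<in> objs C" using nonempty by blast
    interpret i: group_hom "fib A x" "colim C A" "colim_in C A x"
      by (intro group_hom_comm cat_module_comm_group[OF A] comm_group_colim A x colim_in_hom)
    show "\<exists>x\<in>objs C. \<exists>a\<in>carrier (fib A x). \<one>\<^bsub>colim C A\<^esub> = colim_in C A x a"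
      using x i.hom_one i.G.one_closed by metis
  next
    fix x a Y assume x: "x \<in> objs C" "a \<in> carrier (fib A x)"
      and "\<exists>x\<in>objs C. \<exists>a\<in>carrier (fib A x). Y = colim_in C A x a"
    then obtain y b where y: "y \<in> objs C" "b \<in> carrier (fib A y)" and Y: "Y = colim_in C A y b" by blast
    obtain m n where m: "m \<in> mors C" "src C m = x" and n: "n \<in> mors C" "src C n = y" and mn: "tgt C m = tgt C n"
      using directed[OF x(1) y(1)] by blast
    let ?z = "tgt C m"
    have z: "?z \<in> objs C" using m by (simp add: tgt_in)
    have a: "act A m a \<in> carrier (fib A ?z)" using cat_module_act_in[OF A m(1)] x m by simp
    have b: "act A n b \<in> carrier (fib A ?z)" using cat_module_act_in[OF A n(1)] y n mn by simp
    interpret comm_group "fib A ?z" by (rule cat_module_comm_group[OF A z])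
    have "colim_in C A x a \<otimes>\<^bsub>colim C A\<^esub> Y = colim_in C A ?z (act A m a \<otimes>\<^bsub>fib A ?z\<^esub> act A n b)"
      using colim_in_act[OF A m(1), of a] colim_in_act[OF A n(1), of b] x y m n mn
        hom_mult[OF colim_in_hom[OF A z] a b] by (simp add: Y)
    then show "\<exists>z\<in>objs C. \<exists>c\<in>carrier (fib A z). colim_in C A x a \<otimes>\<^bsub>colim C A\<^esub> Y = colim_in C A z c"
      using z a b by blast
  qed
  then show thesis using that by blast
qed

text \<open>An element is detected in the group of families indexed by the objects, modulo those
  families that are eventually trivial: this group receives compatible maps from all fibres.\<close>

lemma colim_in_eq_one:
  assumes A: "cat_module C A" and x: "x \<in> objs C" and a: "a \<in> carrier (fib A x)"
    and eq: "colim_in C A x a = \<one>\<^bsub>colim C A\<^esub>"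
  obtains m where "m \<in> mors C" "src C m = x" "act A m a = \<one>\<^bsub>fib A (tgt C m)\<^esub>"
proof -
  let ?P = "product_group (objs C) (fib A)"
  note gA = cat_module_group[OF A]
  interpret P: comm_group ?P
  proof (rule group.group_comm_groupI)
    show "group ?P" by (simp add: gA)
    fix u v assume "u \<in> carrier ?P" "v \<in> carrier ?P"
    then show "u \<otimes>\<^bsub>?P\<^esub> v = v \<otimes>\<^bsub>?P\<^esub> u"
      using cat_module_comm_group[OF A] by (auto simp: comm_group_def comm_monoid.m_comm PiE_iff)
  qed
  \<comment> \<open>A family counts as eventually trivial if it is trivial at everything reachable
    from some object \<open>z\<close>. Two such objects have a common target, which gives closure
    under products.\<close>
  define E where "E = {u \<in> carrier ?P. \<exists>z\<in>objs C. \<forall>m\<in>mors C. src C m = z \<longrightarrow> u (tgt C m) = \<one>\<^bsub>fib A (tgt C m)\<^esub>}"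
  have E: "subgroup E ?P"
  proof (rule P.subgroupI)
    show "E \<subseteq> carrier ?P" by (auto simp: E_def)
    have "\<one>\<^bsub>?P\<^esub> \<in> E" unfolding E_def using nonempty tgt_in P.one_closed by auto
    then show "E \<noteq> {}" by blast
    fix u assume u: "u \<in> E"
    have "inv\<^bsub>fib A (tgt C m)\<^esub> \<one>\<^bsub>fib A (tgt C m)\<^esub> = \<one>\<^bsub>fib A (tgt C m)\<^esub>" if "m \<in> mors C" for m
      using gA[OF tgt_in[OF that]] by (simp add: group.is_monoid monoid.inv_one)
    moreover have "(inv\<^bsub>?P\<^esub> u) y = inv\<^bsub>fib A y\<^esub> u y" if "y \<in> objs C" for y
      using u that gA by (subst inv_product_group) (auto simp: E_def)
    moreover obtain z where "z \<in> objs C" "\<forall>m\<in>mors C. src C m = z \<longrightarrow> u (tgt C m) = \<one>\<^bsub>fib A (tgt C m)\<^esub>"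
      using u unfolding E_def by blast
    ultimately have "\<exists>z\<in>objs C. \<forall>m\<in>mors C. src C m = z \<longrightarrow> (inv\<^bsub>?P\<^esub> u) (tgt C m) = \<one>\<^bsub>fib A (tgt C m)\<^esub>"
      using tgt_in by (intro bexI[of _ z]) simp_all
    then show "inv\<^bsub>?P\<^esub> u \<in> E" using u P.inv_closed[of u] unfolding E_def by blast
    fix v assume v: "v \<in> E"
    obtain y z where y: "y \<in> objs C" "\<And>m. \<lbrakk>m \<in> mors C; src C m = y\<rbrakk> \<Longrightarrow> u (tgt C m) = \<one>\<^bsub>fib A (tgt C m)\<^esub>"
      and z: "z \<in> objs C" "\<And>m. \<lbrakk>m \<in> mors C; src C m = z\<rbrakk> \<Longrightarrow> v (tgt C m) = \<one>\<^bsub>fib A (tgt C m)\<^esub>"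
      using u v unfolding E_def by blast
    obtain k l where k: "k \<in> mors C" "src C k = y" and l: "l \<in> mors C" "src C l = z" and kl: "tgt C k = tgt C l"
      using directed[OF y(1) z(1)] by blast
    have "(u \<otimes>\<^bsub>?P\<^esub> v) (tgt C m) = \<one>\<^bsub>fib A (tgt C m)\<^esub>" if m: "m \<in> mors C" "src C m = tgt C k" for m
    proof -
      have "u (tgt C m) = \<one>\<^bsub>fib A (tgt C m)\<^esub>" "v (tgt C m) = \<one>\<^bsub>fib A (tgt C m)\<^esub>"
        using y(2)[of "cmp C k m"] z(2)[of "cmp C l m"] k l kl m by (simp_all add: cmp_in src_cmp tgt_cmp)
      then show ?thesis using gA[OF tgt_in[OF m(1)]] tgt_in[OF m(1)] by (simp add: group.is_monoid)
    qed
    then show "u \<otimes>\<^bsub>?P\<^esub> v \<in> E"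
      using u v tgt_in[OF k(1)] P.m_closed[of u v] unfolding E_def by blast
  qed
  let ?H = "?P Mod E"
  let ?q = "\<lambda>u. E #>\<^bsub>?P\<^esub> u"
  \<comment> \<open>The family of all transports of \<open>a\<close> along morphisms out of
    \<open>x\<close>, trivial at objects that cannot be reached. By \<open>thin\<close> there is
    only one morphism for \<open>SOME\<close> to choose.\<close>
  define t where "t x a = (\<lambda>y\<in>objs C. if \<exists>m\<in>mors C. src C m = x \<and> tgt C m = y
      then act A (SOME m. m \<in> mors C \<and> src C m = x \<and> tgt C m = y) a else \<one>\<^bsub>fib A y\<^esub>)" for x a
  have t_tgt: "t (src C m) a (tgt C m) = act A m a" if m: "m \<in> mors C" for m a
  proof -
    have "(SOME n. n \<in> mors C \<and> src C n = src C m \<and> tgt C n = tgt C m) = m"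
      using m thin by (intro some_equality) auto
    then show ?thesis using m tgt_in by (auto simp: t_def)
  qed
  have t_other: "t x a y = \<one>\<^bsub>fib A y\<^esub>" if "y \<in> objs C" "\<nexists>m. m \<in> mors C \<and> src C m = x \<and> tgt C m = y" for x a y
    using that by (auto simp: t_def)
  have t_hom: "t x \<in> hom (fib A x) ?P" if x: "x \<in> objs C" for x
  proof (rule homI)
    show "t x a \<in> carrier ?P" if a: "a \<in> carrier (fib A x)" for a
    proof -
      have "t x a y \<in> carrier (fib A y)" if y: "y \<in> objs C" for y
      proof (cases "\<exists>m. m \<in> mors C \<and> src C m = x \<and> tgt C m = y")
        case True
        then show ?thesis using t_tgt cat_module_act_in[OF A] a by auto
      next
        case False
        then show ?thesis using t_other[OF y, of x] gA[OF y] by (simp add: group.is_monoid)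
      qed
      then show ?thesis by (auto simp: t_def)
    qed
    fix a b assume a: "a \<in> carrier (fib A x)" "b \<in> carrier (fib A x)"
    have "t x (a \<otimes>\<^bsub>fib A x\<^esub> b) y = t x a y \<otimes>\<^bsub>fib A y\<^esub> t x b y" if y: "y \<in> objs C" for y
    proof (cases "\<exists>m. m \<in> mors C \<and> src C m = x \<and> tgt C m = y")
      case True
      then show ?thesis using t_tgt hom_mult[OF cat_module_act_hom[OF A]] a by auto
    next
      case False
      then show ?thesis using t_other[OF y, of x] gA[OF y] by (simp add: group.is_monoid)
    qed
    then show "t x (a \<otimes>\<^bsub>fib A x\<^esub> b) = t x a \<otimes>\<^bsub>?P\<^esub> t x b"
      by (auto simp: fun_eq_iff) (simp add: t_def)
  qed
  have n: "E \<lhd> ?P" using E P.normal_iff_subgroup by simp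
  have H: "comm_group ?H" by (rule P.abelian_FactGroup[OF E])
  have t_in: "t x a \<in> carrier ?P" if "x \<in> objs C" "a \<in> carrier (fib A x)" for x a
    using t_hom that by (auto simp: hom_def)
  obtain h where h: "h \<in> hom (colim C A) ?H"
    and h_in: "\<And>x a. \<lbrakk>x \<in> objs C; a \<in> carrier (fib A x)\<rbrakk> \<Longrightarrow> h (colim_in C A x a) = (?q \<circ> t x) a"
  proof (rule colim_universal[OF A H, of "\<lambda>x. ?q \<circ> t x"])
    show "?q \<circ> t x \<in> hom (fib A x) ?H" if "x \<in> objs C" for x
      by (rule hom_compose[OF t_hom[OF that] normal.r_coset_hom_Mod[OF n]])
    fix m a assume m: "m \<in> mors C" and a: "a \<in> carrier (fib A (src C m))"
    let ?u = "t (tgt C m) (act A m a)" and ?v = "t (src C m) a"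
    have u: "?u \<in> carrier ?P" and v: "?v \<in> carrier ?P"
      using t_in tgt_in[OF m] src_in[OF m] cat_module_act_in[OF A m a] a by blast+
    \<comment> \<open>The families \<open>?u\<close> and \<open>?v\<close> may differ at objects
      reachable from \<open>src C m\<close> but not from \<open>tgt C m\<close>. They agree at
      everything reachable from \<open>tgt C m\<close>, and that is enough modulo
      \<open>E\<close>.\<close>
    have "(?u \<otimes>\<^bsub>?P\<^esub> inv\<^bsub>?P\<^esub> ?v) (tgt C n) = \<one>\<^bsub>fib A (tgt C n)\<^esub>" if n: "n \<in> mors C" "src C n = tgt C m" for n
    proof -
      have "?u (tgt C n) = act A (cmp C m n) a"
        using t_tgt[OF n(1), of "act A m a"] A n m a by (simp add: cat_module_def)
      also have "\<dots> = ?v (tgt C n)"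
        using t_tgt[of "cmp C m n" a] n m by (simp add: cmp_in src_cmp tgt_cmp)
      finally have "?u (tgt C n) = ?v (tgt C n)" .
      moreover have "?v (tgt C n) \<in> carrier (fib A (tgt C n))"
        using v tgt_in[OF n(1)] by auto
      moreover have "(inv\<^bsub>?P\<^esub> ?v) (tgt C n) = inv\<^bsub>fib A (tgt C n)\<^esub> ?v (tgt C n)"
        using v gA tgt_in[OF n(1)] by (subst inv_product_group) auto
      ultimately show ?thesis using tgt_in[OF n(1)] gA by (simp add: group.r_inv)
    qed
    then have "?u \<otimes>\<^bsub>?P\<^esub> inv\<^bsub>?P\<^esub> ?v \<in> E"
      unfolding E_def using P.m_closed[OF u P.inv_closed[OF v]] tgt_in[OF m] by blast
    then have "?u \<in> ?q ?v" using subgroup.rcos_module_rev[OF E P.is_group v u] by simp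
    then show "(?q \<circ> t (tgt C m)) (act A m a) = (?q \<circ> t (src C m)) a"
      using P.repr_independence[OF _ v E] by simp
  qed blast
  have "h (colim_in C A x a) = \<one>\<^bsub>?H\<^esub>"
    unfolding eq by (rule hom_one[OF h]) (use comm_group_colim[OF A] H in \<open>simp_all add: comm_group_def\<close>)
  then have "E #>\<^bsub>?P\<^esub> t x a = E" using h_in[OF x a] by simp
  then have "t x a \<in> E" using P.coset_join1[OF _ t_in[OF x a] E] by simp
  \<comment> \<open>The family of \<open>a\<close> is trivial beyond \<open>z\<close>. At a common
    target of \<open>x\<close> and \<open>z\<close> its coordinate is the transport of
    \<open>a\<close>, which is therefore trivial.\<close>
  then obtain z where z: "z \<in> objs C" "\<And>m. \<lbrakk>m \<in> mors C; src C m = z\<rbrakk> \<Longrightarrow> t x a (tgt C m) = \<one>\<^bsub>fib A (tgt C m)\<^esub>"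
    unfolding E_def by blast
  obtain k l where k: "k \<in> mors C" "src C k = x" and l: "l \<in> mors C" "src C l = z" and kl: "tgt C k = tgt C l"
    using directed[OF x z(1)] by blast
  have "act A k a = \<one>\<^bsub>fib A (tgt C k)\<^esub>" using z(2)[OF l] t_tgt[OF k(1), of a] k kl by simp
  with k show thesis using that by blast
qed

lemma colim_map_onto:
  assumes L: "cat_module C L" and M: "cat_module C M" and f: "nat_trans C L M f" and "surjective C L M f"
  shows "colim_map C L M f ` carrier (colim C L) = carrier (colim C M)"
proof (intro equalityI subsetI)
  fix X assume "X \<in> colim_map C L M f ` carrier (colim C L)"
  then show "X \<in> carrier (colim C M)" using hom_in_carrier[OF colim_map_hom[OF L M f]] by blast
next
  fix X assume "X \<in> carrier (colim C M)"
  then obtain x b where x: "x \<in> objs C" "b \<in> carrier (fib M x)" "X = colim_in C M x b"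
    using colim_in_cases[OF M] by blast
  obtain a where a: "a \<in> carrier (fib L x)" "f x a = b"
    using assms(4) x unfolding surjective_def by (metis imageE)
  have "X = colim_map C L M f (colim_in C L x a)" by (simp add: colim_map_in[OF L M f] x a)
  then show "X \<in> colim_map C L M f ` carrier (colim C L)" using colim_in_in[OF L x(1) a(1)] by blast
qed

text \<open>An element of the kernel has a representative \<open>b\<close> in one fibre whose image
  under \<open>g\<close> dies in the colimit. By \<open>colim_in_eq_one\<close> it already dies
  along some morphism \<open>m\<close>, so \<open>act M m b\<close> lies in the kernel at the target
  of \<open>m\<close> and exactness of the fibres applies there.\<close>

lemma colim_map_exact:
  assumes L: "cat_module C L" and M: "cat_module C M" and N: "cat_module C N"
    and f: "nat_trans C L M f" and g: "nat_trans C M N g"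
    and exact: "\<And>x. x \<in> objs C \<Longrightarrow> f x ` carrier (fib L x) = kernel (fib M x) (fib N x) (g x)"
  shows "colim_map C L M f ` carrier (colim C L) = kernel (colim C M) (colim C N) (colim_map C M N g)"
proof (intro equalityI subsetI)
  fix X assume "X \<in> colim_map C L M f ` carrier (colim C L)"
  then obtain Y where Y: "Y \<in> carrier (colim C L)" "X = colim_map C L M f Y" by blast
  have "g x (f x a) = \<one>\<^bsub>fib N x\<^esub>" if "x \<in> objs C" "a \<in> carrier (fib L x)" for x a
    using exact that by (auto simp: kernel_def)
  then have "colim_map C M N g X = \<one>\<^bsub>colim C N\<^esub>"
    unfolding Y(2) colim_map_comp[OF L M N f g Y(1)]
    by (intro colim_map_trivial[OF L N nat_trans_comp[OF f g] _ Y(1)]) simp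
  then show "X \<in> kernel (colim C M) (colim C N) (colim_map C M N g)"
    using Y hom_in_carrier[OF colim_map_hom[OF L M f]] by (simp add: kernel_def)
next
  fix X assume "X \<in> kernel (colim C M) (colim C N) (colim_map C M N g)"
  then have X: "X \<in> carrier (colim C M)" "colim_map C M N g X = \<one>\<^bsub>colim C N\<^esub>" by (simp_all add: kernel_def)
  then obtain x b where x: "x \<in> objs C" "b \<in> carrier (fib M x)" "X = colim_in C M x b"
    using colim_in_cases[OF M] by blast
  have "colim_in C N x (g x b) = \<one>\<^bsub>colim C N\<^esub>" using X(2) x by (simp add: colim_map_in[OF M N g])
  then obtain m where m: "m \<in> mors C" "src C m = x" "act N m (g x b) = \<one>\<^bsub>fib N (tgt C m)\<^esub>"
    using colim_in_eq_one[OF N x(1) nat_trans_in[OF g x(1,2)]] by blast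
  have "act M m b \<in> kernel (fib M (tgt C m)) (fib N (tgt C m)) (g (tgt C m))"
    using nat_trans_act[OF g m(1)] m x cat_module_act_in[OF M m(1)] by (simp add: kernel_def)
  then obtain a where a: "a \<in> carrier (fib L (tgt C m))" "f (tgt C m) a = act M m b"
    using exact[OF tgt_in[OF m(1)]] by (metis imageE)
  have "X = colim_map C L M f (colim_in C L (tgt C m) a)"
    using colim_in_act[OF M m(1)] m x a tgt_in[OF m(1)] by (simp add: colim_map_in[OF L M f])
  then show "X \<in> colim_map C L M f ` carrier (colim C L)" using colim_in_in[OF L tgt_in[OF m(1)] a(1)] by blast
qed

end

section \<open>The module \<open>colimE G A\<close>\<close>

lemma class_poset_simps [simp]:
  "objs (class_poset G x) = x \<inter> idents G"
  "(e, f) \<in> mors (class_poset G x) \<longleftrightarrow> e \<in> x \<inter> idents G \<and> f \<in> x \<inter> idents G \<and> gle G f e"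
  "src (class_poset G x) = fst" "tgt (class_poset G x) = snd"
  "ident (class_poset G x) e = (e, e)" "cmp (class_poset G x) (e, f) (f', h) = (e, h)"
  by (auto simp: class_poset_def)

lemma LL_simps [simp]:
  "objs (LL G) = idents G"
  "(e, g) \<in> mors (LL G) \<longleftrightarrow> e \<in> idents G \<and> g \<in> elts G \<and> gle G (gdom G g) e"
  "src (LL G) = fst" "tgt (LL G) (e, g) = gran G g" "ident (LL G) e = (e, e)"
  "cmp (LL G) (e, g) (f, h) = (e, gmul G (corestriction G g (gdom G h)) h)"
  by (auto simp: LL_def)

lemma fib_colimE [simp]: "fib (colimE G A) x = colim (class_poset G x) A"
  by (simp add: colimE_def)

definition colimE_map :: "'g ogpd \<Rightarrow> ('g, 'g \<times> 'g, 'a) cmod \<Rightarrow> ('g, 'g \<times> 'g, 'b) cmod \<Rightarrow> ('g \<Rightarrow> 'a \<Rightarrow> 'b) \<Rightarrow>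
    'g set \<Rightarrow> ('g \<Rightarrow> 'a) set \<Rightarrow> ('g \<Rightarrow> 'b) set" where
  "colimE_map G A B \<phi> x = colim_map (class_poset G x) A B \<phi>"

context ordered_groupoid begin

lemma act_act:
  assumes M: "G_module G M" and "e \<in> idents G" "h \<in> elts G" "gle G (gdom G h) e"
    and "k \<in> elts G" "gle G (gdom G k) (gran G h)" and a: "a \<in> carrier (fib M e)"
  shows "act M (gran G h, k) (act M (e, h) a) = act M (e, gmul G (corestriction G h (gdom G k)) k) a"
proof -
  have "(e, h) \<in> mors (LL G)" "(gran G h, k) \<in> mors (LL G)" using assms by auto
  then have "act M (cmp (LL G) (e, h) (gran G h, k)) a = act M (gran G h, k) (act M (e, h) a)"
    using M a unfolding cat_module_def by (metis LL_simps(3,4) fst_conv)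
  then show ?thesis by simp
qed

text \<open>The corestriction of \<open>h\<close> to \<open>gran G k\<close> is \<open>k\<close>, so
  \<open>(e, h)\<close> followed by \<open>(gran G h, gran G k)\<close> is \<open>(e, k)\<close>.
  Thus passing to a smaller element changes the result only by a map of the poset of
  identities.\<close>

lemma act_below:
  assumes M: "G_module G M" and e: "e \<in> idents G" "h \<in> elts G" "gle G (gdom G h) e"
    and k: "k \<in> elts G" "gle G k h" and a: "a \<in> carrier (fib M e)"
  shows "act M (gran G h, gran G k) (act M (e, h) a) = act M (e, k) a"
  using act_act[OF M e gran_in[OF k(1)] _ a] k gran_mono[OF k(1) e(2) k(2)] corestr_eq[OF e(2) k]
  by (simp add: gdom_gran gran_gmul_right)

text \<open>Corestricting the identity \<open>f\<close> to \<open>gdom G h\<close> gives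
  \<open>gdom G h\<close>, which is neutral on the left of \<open>h\<close>; so
  \<open>(e, f)\<close> followed by \<open>(f, h)\<close> is \<open>(e, h)\<close>.\<close>

lemma act_ident_act:
  assumes M: "G_module G M" and e: "e \<in> idents G" "f \<in> idents G" "gle G f e"
    and h: "h \<in> elts G" "gle G (gdom G h) f" and a: "a \<in> carrier (fib M e)"
  shows "act M (f, h) (act M (e, f) a) = act M (e, h) a"
  using act_act[OF M e(1) ident_in_elts[OF e(2)] _ h(1) _ a] e h
    corestr_eq[OF ident_in_elts[OF e(2)] gdom_in[OF h(1)] h(2)]
  by (simp add: ident_gdom ident_gran gran_gdom gdom_gmul_left)

lemma act_in:
  assumes M: "G_module G M" and "e \<in> idents G" "h \<in> elts G" "gle G (gdom G h) e" "a \<in> carrier (fib M e)"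
  shows "act M (e, h) a \<in> carrier (fib M (gran G h))"
  using category.cat_module_act_in[OF category_LL M, of "(e, h)" a] assms by simp

lemma category_class_poset: "category (class_poset G x)"
proof
  fix m n p
  assume "m \<in> mors (class_poset G x)"
  then obtain e f where m: "m = (e, f)" "e \<in> x \<inter> idents G" "f \<in> x \<inter> idents G" "gle G f e" by (cases m) auto
  then show "src (class_poset G x) m \<in> objs (class_poset G x)" "tgt (class_poset G x) m \<in> objs (class_poset G x)"
    "cmp (class_poset G x) (ident (class_poset G x) (src (class_poset G x) m)) m = m"
    "cmp (class_poset G x) m (ident (class_poset G x) (tgt (class_poset G x) m)) = m" by auto
  assume "n \<in> mors (class_poset G x)" "tgt (class_poset G x) m = src (class_poset G x) n"
  then obtain h where n: "n = (f, h)" "h \<in> x \<inter> idents G" "gle G h f" using m by (cases n) auto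
  have "gle G h e" using gle_trans[of h f e] m n by (auto simp: ident_in_elts)
  then show "cmp (class_poset G x) m n \<in> mors (class_poset G x)"
    "src (class_poset G x) (cmp (class_poset G x) m n) = src (class_poset G x) m"
    "tgt (class_poset G x) (cmp (class_poset G x) m n) = tgt (class_poset G x) n" using m n by auto
  assume "p \<in> mors (class_poset G x)"
  show "cmp (class_poset G x) (cmp (class_poset G x) m n) p = cmp (class_poset G x) m (cmp (class_poset G x) n p)"
    using m n by (cases p) auto
qed (auto simp: ident_in_elts gle_refl)

text \<open>For identities \<open>f\<close> below \<open>e\<close> the pair \<open>(e, f)\<close> is
  a morphism of \<open>LL G\<close> from \<open>e\<close> to \<open>f\<close>, and such pairs
  compose there as they do in the poset.\<close>

lemma cat_module_class_poset:
  assumes M: "G_module G M"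
  shows "cat_module (class_poset G x) M"
  unfolding cat_module_def
proof (intro conjI ballI impI)
  interpret L: category "LL G" by (rule category_LL)
  show "comm_group (fib M e)" if "e \<in> objs (class_poset G x)" for e
    using L.cat_module_comm_group[OF M] that by simp
  show "act M (ident (class_poset G x) e) a = a" if "e \<in> objs (class_poset G x)" "a \<in> carrier (fib M e)" for e a
    using M that by (simp add: cat_module_def)
  fix m assume "m \<in> mors (class_poset G x)"
  then obtain e f where m: "m = (e, f)" "e \<in> idents G" "f \<in> idents G" "gle G f e" by (cases m) auto
  then show "act M m \<in> hom (fib M (src (class_poset G x) m)) (fib M (tgt (class_poset G x) m))"
    using L.cat_module_act_hom[OF M, of m] by (simp add: ident_in_elts ident_gdom ident_gran)
  fix n a assume "n \<in> mors (class_poset G x)" "tgt (class_poset G x) m = src (class_poset G x) n"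
    "a \<in> carrier (fib M (src (class_poset G x) m))"
  moreover from this obtain h where "n = (f, h)" "h \<in> idents G" "gle G h f" using m by (cases n) auto
  ultimately show "act M (cmp (class_poset G x) m n) a = act M n (act M m a)"
    using act_ident_act[OF M m(2-4), of h a] m by (simp add: ident_in_elts ident_gdom)
qed

lemma nat_trans_class_poset:
  assumes \<phi>: "nat_trans (LL G) M N \<phi>"
  shows "nat_trans (class_poset G x) M N \<phi>"
  unfolding nat_trans_def
proof (intro conjI ballI)
  show "\<phi> e \<in> hom (fib M e) (fib N e)" if "e \<in> objs (class_poset G x)" for e
    using \<phi> that by (simp add: nat_trans_def)
  fix m a assume "m \<in> mors (class_poset G x)" and a: "a \<in> carrier (fib M (src (class_poset G x) m))"
  then obtain e f where m: "m = (e, f)" "e \<in> idents G" "f \<in> idents G" "gle G f e" by (cases m) auto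
  then have "m \<in> mors (LL G)" "src (LL G) m = e" "tgt (LL G) m = f" by (simp_all add: ident_in_elts ident_gdom ident_gran)
  then show "\<phi> (tgt (class_poset G x) m) (act M m a) = act N m (\<phi> (src (class_poset G x) m) a)"
    using category.nat_trans_act[OF category_LL \<phi>, of m a] a m by simp
qed

end

section \<open>Lower bounds in \<beta>-classes and the action of the quotient\<close>

context principally_directed_groupoid begin

lemma mem_class: "\<lbrakk>x \<in> elts Q; g \<in> x\<rbrakk> \<Longrightarrow> g \<in> elts G \<and> x = cl g"
  unfolding elts_Q using cl_eq equiv_class_eq_iff[OF equiv_beta] by blast

lemma cl_self: "g \<in> elts G \<Longrightarrow> g \<in> cl g"
  by (auto intro: betaI gle_refl)

lemma cl_in: "g \<in> elts G \<Longrightarrow> cl g \<in> elts Q"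
  unfolding elts_Q by blast

lemma cl_below: "\<lbrakk>g \<in> elts G; k \<in> elts G; gle G k g\<rbrakk> \<Longrightarrow> cl k = cl g"
  by (rule cl_eq) (auto intro: betaI gle_refl)

lemma class_down: "\<lbrakk>x \<in> elts Q; g \<in> x; k \<in> elts G; gle G k g\<rbrakk> \<Longrightarrow> k \<in> x"
  using mem_class cl_below cl_self by metis

lemma class_lower:
  assumes "x \<in> elts Q" "g \<in> x" "h \<in> x"
  obtains k where "k \<in> x" "k \<in> elts G" "gle G k g" "gle G k h"
proof -
  have "h \<in> cl g" using mem_class[OF assms(1,2)] assms(3) by blast
  then obtain k where "k \<in> elts G" "gle G k g" "gle G k h" by (auto simp: beta_def)
  then show thesis using that class_down[OF assms(1,2)] by blast
qed

lemma idents_Q_in: "x \<in> idents Q \<Longrightarrow> x \<in> elts Q"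
  by (simp add: idents_def)

lemma cl_ident: "e \<in> idents G \<Longrightarrow> cl e \<in> idents Q"
  unfolding idents_Q by blast

lemma gran_class: "\<lbrakk>\<gamma> \<in> elts Q; g \<in> \<gamma>\<rbrakk> \<Longrightarrow> gran Q \<gamma> = cl (gran G g)"
  using mem_class gran_Q by metis

lemma gran_in_class: "\<lbrakk>\<gamma> \<in> elts Q; g \<in> \<gamma>\<rbrakk> \<Longrightarrow> gran G g \<in> gran Q \<gamma> \<inter> idents G"
  using gran_class[of \<gamma> g] mem_class[of \<gamma> g] cl_self[of "gran G g"] gran_in by auto

text \<open>The domain of any representative \<open>g\<close> lies in the same class as
  \<open>e\<close>, so the two have a common lower bound \<open>f\<close>. The restriction of
  \<open>g\<close> to \<open>f\<close> lies below \<open>g\<close>, hence still in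
  \<open>\<gamma>\<close>, and has domain \<open>f\<close>.\<close>

lemma class_lift:
  assumes \<gamma>: "\<gamma> \<in> elts Q" and e: "e \<in> gdom Q \<gamma> \<inter> idents G"
  obtains h where "h \<in> \<gamma>" "h \<in> elts G" "gle G (gdom G h) e"
proof -
  obtain g where g: "g \<in> elts G" "\<gamma> = cl g" using \<gamma> elts_Q by blast
  have "gdom Q \<gamma> \<in> elts Q" using g by (simp add: gdom_Q cl_in gdom_in)
  moreover have "gdom G g \<in> gdom Q \<gamma>" using g cl_self gdom_in by (simp add: gdom_Q)
  ultimately obtain f where f: "f \<in> elts G" "gle G f (gdom G g)" "gle G f e"
    using class_lower e by blast
  have fi: "f \<in> idents G" using ident_below[of e f] e f by blast
  note r = restr[OF g(1) fi f(2)]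
  show thesis
    by (rule that[of "restriction G f g"]) (use r f class_down[OF \<gamma> _ r(1,3)] cl_self g in auto)
qed

text \<open>Two identities of a class have a common lower bound, which lies in the same class and is
  an identity because it is below one.\<close>

lemma directed_class_poset:
  assumes x: "x \<in> idents Q"
  shows "directed_category (class_poset G x)"
proof (intro directed_category.intro category_class_poset directed_category_axioms.intro)
  show "m = n" if "m \<in> mors (class_poset G x)" "n \<in> mors (class_poset G x)"
    "src (class_poset G x) m = src (class_poset G x) n" "tgt (class_poset G x) m = tgt (class_poset G x) n" for m n
    using that by (simp add: prod_eq_iff)
  show "\<exists>m\<in>mors (class_poset G x). \<exists>n\<in>mors (class_poset G x).
      src (class_poset G x) m = e \<and> src (class_poset G x) n = f \<and> tgt (class_poset G x) m = tgt (class_poset G x) n"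
    if e: "e \<in> objs (class_poset G x)" and f: "f \<in> objs (class_poset G x)" for e f
  proof -
    obtain k where k: "k \<in> x" "k \<in> elts G" "gle G k e" "gle G k f"
      using class_lower[OF idents_Q_in[OF x], of e f] e f by auto
    then have "k \<in> idents G" using ident_below e by auto
    then have "(e, k) \<in> mors (class_poset G x)" "(f, k) \<in> mors (class_poset G x)" using e f k by auto
    then show ?thesis by (rule_tac bexI[of _ "(e, k)"], rule_tac bexI[of _ "(f, k)"]) simp_all
  qed
  show "objs (class_poset G x) \<noteq> {}"
    using x cl_self ident_in_elts by (auto simp: idents_Q)
qed

lemma mors_Q: "(x, \<gamma>) \<in> mors (LL Q) \<longleftrightarrow> \<gamma> \<in> elts Q \<and> x = gdom Q \<gamma>"
proof -
  interpret Q: ordered_groupoid Q by (rule ordered_groupoid_Q)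
  have "gle Q = (=)" by (simp add: beta_quotient_def)
  then show ?thesis by auto
qed

text \<open>The definition of the action involves a representative \<open>g\<close>, a lower bound
  \<open>l\<close> and the restriction of \<open>g\<close> to \<open>l\<close>. That restriction is
  itself a member of \<open>\<gamma>\<close> with domain below \<open>e\<close>, so the simpler
  formula over all such members \<open>h\<close> covers every value that the definition allows, and
  in particular shows that \<open>THE\<close> is well defined.\<close>

lemma
  assumes M: "G_module G M" and \<gamma>: "\<gamma> \<in> elts Q"
  shows act_colimE_hom: "act (colimE G M) (gdom Q \<gamma>, \<gamma>) \<in>
      hom (colim (class_poset G (gdom Q \<gamma>)) M) (colim (class_poset G (gran Q \<gamma>)) M)"
    and act_colimE: "\<And>e h a. \<lbrakk>e \<in> gdom Q \<gamma> \<inter> idents G; h \<in> \<gamma>; gle G (gdom G h) e; a \<in> carrier (fib M e)\<rbrakk> \<Longrightarrow>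
      act (colimE G M) (gdom Q \<gamma>, \<gamma>) (colim_in (class_poset G (gdom Q \<gamma>)) M e a) =
      colim_in (class_poset G (gran Q \<gamma>)) M (gran G h) (act M (e, h) a)"
proof -
  interpret Q: ordered_groupoid Q by (rule ordered_groupoid_Q)
  let ?x = "gdom Q \<gamma>" and ?y = "gran Q \<gamma>"
  interpret X: directed_category "class_poset G ?x" by (rule directed_class_poset[OF Q.gdom_idents[OF \<gamma>]])
  interpret Y: directed_category "class_poset G ?y" by (rule directed_class_poset[OF Q.gran_idents[OF \<gamma>]])
  note MX = cat_module_class_poset[OF M, of ?x] and MY = cat_module_class_poset[OF M, of ?y]
  define b where "b e h a = colim_in (class_poset G ?y) M (gran G h) (act M (e, h) a)" for e h a
  have el: "h \<in> elts G" if "h \<in> \<gamma>" for h using mem_class \<gamma> that by blast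
  have below: "b e k a = b e h a"
    if "e \<in> idents G" "h \<in> \<gamma>" "k \<in> \<gamma>" "gle G k h" "gle G (gdom G h) e" "a \<in> carrier (fib M e)" for e h k a
  proof -
    have "(gran G h, gran G k) \<in> mors (class_poset G ?y)"
      using gran_in_class[OF \<gamma>] gran_mono el that by auto
    from Y.colim_in_act[OF MY this, of "act M (e, h) a"] show ?thesis
      using act_below[OF M that(1) el[OF that(2)] that(5) el[OF that(3)] that(4,6)]
        act_in[OF M that(1) el[OF that(2)] that(5,6)] by (simp add: b_def)
  qed
  \<comment> \<open>Both representatives are compared with a common lower bound in
    \<open>\<gamma>\<close>.\<close>
  have indep: "b e h a = b e h' a"
    if e: "e \<in> idents G" and h: "h \<in> \<gamma>" "gle G (gdom G h) e" and h': "h' \<in> \<gamma>" "gle G (gdom G h') e"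
      and a: "a \<in> carrier (fib M e)" for e h h' a
  proof -
    obtain k where k: "k \<in> \<gamma>" "gle G k h" "gle G k h'" using class_lower[OF \<gamma> h(1) h'(1)] by blast
    show ?thesis using below[OF e h(1) k(1,2) h(2) a] below[OF e h'(1) k(1,3) h'(2) a] by simp
  qed
  \<comment> \<open>A lift of \<open>\<gamma>\<close> at each \<open>e\<close>, needed to write down
    a map on the fibre. By \<open>indep\<close> the choice does not affect the map, which is also
    why the maps on different fibres are compatible.\<close>
  define c where "c e = (SOME h. h \<in> \<gamma> \<and> gle G (gdom G h) e)" for e
  have c: "c e \<in> \<gamma> \<and> gle G (gdom G (c e)) e" if "e \<in> ?x \<inter> idents G" for e
    unfolding c_def by (rule someI_ex) (use class_lift[OF \<gamma> that] in blast)
  obtain H where H: "H \<in> hom (colim (class_poset G ?x) M) (colim (class_poset G ?y) M)"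
    and H_in: "\<And>e a. \<lbrakk>e \<in> objs (class_poset G ?x); a \<in> carrier (fib M e)\<rbrakk> \<Longrightarrow>
        H (colim_in (class_poset G ?x) M e a) = b e (c e) a"
  proof (rule X.colim_universal[OF MX Y.comm_group_colim[OF MY], of "\<lambda>e. b e (c e)"])
    fix e assume e: "e \<in> objs (class_poset G ?x)"
    have "act M (e, c e) \<in> hom (fib M e) (fib M (gran G (c e)))"
      using category.cat_module_act_hom[OF category_LL M, of "(e, c e)"] e c[of e] el by simp
    from hom_compose[OF this Y.colim_in_hom[OF MY]] show "b e (c e) \<in> hom (fib M e) (colim (class_poset G ?y) M)"
      using gran_in_class[OF \<gamma>, of "c e"] c[of e] e by (simp add: b_def[abs_def] comp_def)
  next
    fix m a assume "m \<in> mors (class_poset G ?x)" and a: "a \<in> carrier (fib M (src (class_poset G ?x) m))"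
    then obtain e f where m: "m = (e, f)" "e \<in> ?x \<inter> idents G" "f \<in> ?x \<inter> idents G" "gle G f e" by (cases m) auto
    note ce = c[OF m(2)] and cf = c[OF m(3)]
    have le: "gle G (gdom G (c f)) e" using gle_trans[of "gdom G (c f)" f e] cf m el gdom_in ident_in_elts by blast
    have "b f (c f) (act M (e, f) a) = b e (c f) a"
      using act_ident_act[OF M, of e f "c f" a] m a cf el by (simp add: b_def)
    also have "\<dots> = b e (c e) a" using indep[of e "c f" "c e" a] ce cf le m a by simp
    finally show "b (tgt (class_poset G ?x) m) (c (tgt (class_poset G ?x) m)) (act M m a) =
      b (src (class_poset G ?x) m) (c (src (class_poset G ?x) m)) a" by (simp add: m)
  qed blast
  have H_b: "H (colim_in (class_poset G ?x) M e a) = b e h a"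
    if "e \<in> ?x \<inter> idents G" "h \<in> \<gamma>" "gle G (gdom G h) e" "a \<in> carrier (fib M e)" for e h a
    using H_in[of e a] indep[of e "c e" h a] that c[of e] by simp
  have act: "act (colimE G M) (?x, \<gamma>) X = H X" if X: "X \<in> carrier (colim (class_poset G ?x) M)" for X
    unfolding colimE_def cmod.simps prod.case
  proof (rule the_equality)
    obtain e a where e: "e \<in> ?x \<inter> idents G" and a: "a \<in> carrier (fib M e)" and Xe: "X = colim_in (class_poset G ?x) M e a"
      using X.colim_in_cases[OF MX X] by auto
    obtain h where h: "h \<in> \<gamma>" "gle G (gdom G h) e" using class_lift[OF \<gamma> e] by blast
    \<comment> \<open>With \<open>l = gdom G h\<close> the restriction in the definition is
      \<open>h\<close> itself, so every lift yields an admissible choice.\<close>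
    have hh: "restriction G (gdom G h) h = h" using restr_eq[of h h] el[OF h(1)] gle_refl by simp
    have "H X = colim_in (class_poset G ?y) M (gran G (restriction G (gdom G h) h))
          (act M (gdom G h, restriction G (gdom G h) h) (act M (e, gdom G h) a))"
      using H_b[OF e h a] act_ident_act[OF M, of e "gdom G h" h a] e h a el[OF h(1)]
      by (simp add: Xe hh b_def gle_refl gdom_in)
    moreover have "gdom G h \<in> idents G" "gle G (gdom G h) (gdom G h)"
      using el[OF h(1)] by (simp_all add: gle_refl gdom_in)
    ultimately show "\<exists>g\<in>\<gamma>. \<exists>e\<in>?x \<inter> idents G. \<exists>a\<in>carrier (fib M e). \<exists>l\<in>idents G.
        gle G l (gdom G g) \<and> gle G l e \<and> X = colim_in (class_poset G ?x) M e a \<and>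
        H X = colim_in (class_poset G ?y) M (gran G (restriction G l g)) (act M (l, restriction G l g) (act M (e, l) a))"
      using h e a Xe by blast
    fix z assume "\<exists>g\<in>\<gamma>. \<exists>e\<in>?x \<inter> idents G. \<exists>a\<in>carrier (fib M e). \<exists>l\<in>idents G.
        gle G l (gdom G g) \<and> gle G l e \<and> X = colim_in (class_poset G ?x) M e a \<and>
        z = colim_in (class_poset G ?y) M (gran G (restriction G l g)) (act M (l, restriction G l g) (act M (e, l) a))"
    then obtain g e a l where g: "g \<in> \<gamma>" and e: "e \<in> ?x \<inter> idents G" and a: "a \<in> carrier (fib M e)"
      and l: "l \<in> idents G" "gle G l (gdom G g)" "gle G l e" and Xe: "X = colim_in (class_poset G ?x) M e a"
      and z: "z = colim_in (class_poset G ?y) M (gran G (restriction G l g)) (act M (l, restriction G l g) (act M (e, l) a))"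
      by blast
    note r = restr[OF el[OF g] l(1,2)]
    have "restriction G l g \<in> \<gamma>" using class_down[OF \<gamma> g r(1,3)] .
    then show "z = H X"
      using H_b[OF e, of "restriction G l g" a] act_ident_act[OF M, of e l "restriction G l g" a] e a l r
      by (simp add: z Xe b_def gle_refl ident_in_elts)
  qed
  have "monoid (colim (class_poset G ?x) M)"
    using X.comm_group_colim[OF MX] by (simp add: comm_group_def group.is_monoid)
  then show "act (colimE G M) (?x, \<gamma>) \<in> hom (colim (class_poset G ?x) M) (colim (class_poset G ?y) M)"
    using H act by (simp add: hom_def Pi_iff monoid.m_closed)
  show "act (colimE G M) (gdom Q \<gamma>, \<gamma>) (colim_in (class_poset G ?x) M e a) =
      colim_in (class_poset G ?y) M (gran G h) (act M (e, h) a)"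
    if "e \<in> ?x \<inter> idents G" "h \<in> \<gamma>" "gle G (gdom G h) e" "a \<in> carrier (fib M e)" for e h a
    using act X.colim_in_in[OF MX] H_b that by (simp add: b_def)
qed

lemma category_LL_Q: "category (LL Q)"
  using ordered_groupoid.category_LL[OF ordered_groupoid_Q] .

lemma idents_Q_gdom: "\<gamma> \<in> elts Q \<Longrightarrow> gdom Q \<gamma> \<in> idents Q" and idents_Q_gran: "\<gamma> \<in> elts Q \<Longrightarrow> gran Q \<gamma> \<in> idents Q"
  using ordered_groupoid.gdom_idents[OF ordered_groupoid_Q] ordered_groupoid.gran_idents[OF ordered_groupoid_Q] by blast+

lemma mors_QE:
  assumes "m \<in> mors (LL Q)"
  obtains \<gamma> where "\<gamma> \<in> elts Q" "m = (gdom Q \<gamma>, \<gamma>)"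
  using assms mors_Q by (cases m) auto

lemma cl_of_ident: "\<lbrakk>x \<in> idents Q; e \<in> x\<rbrakk> \<Longrightarrow> x = cl e"
  using mem_class idents_Q_in by blast

lemma colimE_eqI:
  assumes M: "G_module G M" and H: "group H" and x: "x \<in> idents Q"
    and f: "f \<in> hom (colim (class_poset G x) M) H" and g: "g \<in> hom (colim (class_poset G x) M) H"
    and eq: "\<And>e a. \<lbrakk>e \<in> idents G; x = cl e; a \<in> carrier (fib M e)\<rbrakk> \<Longrightarrow>
      f (colim_in (class_poset G (cl e)) M e a) = g (colim_in (class_poset G (cl e)) M e a)"
    and X: "X \<in> carrier (colim (class_poset G x) M)"
  shows "f X = g X"
proof (rule category.colim_hom_eqI[OF category_class_poset cat_module_class_poset[OF M] H f g _ X])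
  fix e a assume "e \<in> objs (class_poset G x)" "a \<in> carrier (fib M e)"
  moreover from this have "x = cl e" using cl_of_ident[OF x] by simp
  ultimately show "f (colim_in (class_poset G x) M e a) = g (colim_in (class_poset G x) M e a)"
    using eq[of e a] by simp
qed

text \<open>The corestriction of \<open>h\<close> stays in the class of \<open>h\<close> and is
  composable with \<open>k\<close> in \<open>G\<close>. So the composite formed in
  \<open>LL G\<close> represents the product of the two classes.\<close>

lemma cl_mult_lift:
  assumes "\<gamma> \<in> elts Q" "\<delta> \<in> elts Q" "h \<in> \<gamma>" "k \<in> \<delta>" "gle G (gdom G k) (gran G h)"
  shows "gmul G (corestriction G h (gdom G k)) k \<in> gmul Q \<gamma> \<delta>"
    and "gdom G (gmul G (corestriction G h (gdom G k)) k) = gdom G (corestriction G h (gdom G k))"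
    and "gran G (gmul G (corestriction G h (gdom G k)) k) = gran G k"
    and "gle G (gdom G (corestriction G h (gdom G k))) (gdom G h)"
proof -
  have h: "h \<in> elts G" "\<gamma> = cl h" and k: "k \<in> elts G" "\<delta> = cl k" using mem_class assms by blast+
  note c = corestr[OF h(1) gdom_idents[OF k(1)] assms(5)]
  have "\<gamma> = cl (corestriction G h (gdom G k))" using cl_below[OF h(1) c(1,3)] h(2) by simp
  then have "gmul Q \<gamma> \<delta> = cl (gmul G (corestriction G h (gdom G k)) k)"
    using gmul_Q'[OF c(1) k(1) c(2)] k(2) by simp
  then show "gmul G (corestriction G h (gdom G k)) k \<in> gmul Q \<gamma> \<delta>"
    using cl_self[OF gmul_in[OF c(1) k(1) c(2)]] by simp
  show "gdom G (gmul G (corestriction G h (gdom G k)) k) = gdom G (corestriction G h (gdom G k))"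
    "gran G (gmul G (corestriction G h (gdom G k)) k) = gran G k"
    "gle G (gdom G (corestriction G h (gdom G k))) (gdom G h)"
    using gdom_gmul[OF c(1) k(1) c(2)] gran_gmul[OF c(1) k(1) c(2)] gdom_mono[OF c(1) h(1) c(3)] by simp_all
qed

lemma cmp_LL_Q:
  assumes "\<gamma> \<in> elts Q" "\<delta> \<in> elts Q" "gran Q \<gamma> = gdom Q \<delta>"
  shows "cmp (LL Q) (gdom Q \<gamma>, \<gamma>) (gdom Q \<delta>, \<delta>) = (gdom Q (gmul Q \<gamma> \<delta>), gmul Q \<gamma> \<delta>)"
proof -
  interpret Q: ordered_groupoid Q by (rule ordered_groupoid_Q)
  show ?thesis
    using Q.corestr_eq[of \<gamma> \<gamma>] assms Q.gle_refl Q.gdom_gmul by simp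
qed

text \<open>For composites, lift \<open>\<gamma>\<close> to some \<open>h\<close> with domain below
  \<open>e\<close>, then \<open>\<delta>\<close> to some \<open>k\<close> with domain below
  \<open>gran G h\<close>. Their composite in \<open>LL G\<close> represents the product class and
  has domain below \<open>e\<close>, so all three actions are computed by the action of
  \<open>M\<close>.\<close>

lemma cat_module_colimE:
  assumes M: "G_module G M"
  shows "cat_module (LL Q) (colimE G M)"
  unfolding cat_module_def
proof (intro conjI ballI impI)
  have comm: "comm_group (colim (class_poset G x) M)" for x
    by (rule category.comm_group_colim[OF category_class_poset cat_module_class_poset[OF M]])
  show "comm_group (fib (colimE G M) x)" for x by (simp add: comm)
  show "act (colimE G M) m \<in> hom (fib (colimE G M) (src (LL Q) m)) (fib (colimE G M) (tgt (LL Q) m))"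
    if m: "m \<in> mors (LL Q)" for m
    using m by (rule mors_QE) (simp add: act_colimE_hom[OF M])
next
  fix x X assume "x \<in> objs (LL Q)" and X: "X \<in> carrier (fib (colimE G M) x)"
  then have x: "x \<in> idents Q" by simp
  interpret Q: ordered_groupoid Q by (rule ordered_groupoid_Q)
  have x': "x \<in> elts Q" "gdom Q x = x" "gran Q x = x"
    using x Q.ident_in_elts Q.ident_gdom Q.ident_gran by auto
  interpret X: comm_group "colim (class_poset G x) M"
    by (rule category.comm_group_colim[OF category_class_poset cat_module_class_poset[OF M]])
  have "act (colimE G M) (x, x) X = id X"
  proof (rule colimE_eqI[OF M X.is_group x, where f = "act (colimE G M) (x, x)" and g = id])
    show "act (colimE G M) (x, x) \<in> hom (colim (class_poset G x) M) (colim (class_poset G x) M)"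
      using act_colimE_hom[OF M x'(1)] x' by simp
    show "id \<in> hom (colim (class_poset G x) M) (colim (class_poset G x) M)" by (simp add: hom_def)
    fix e a assume e: "e \<in> idents G" "x = cl e" and a: "a \<in> carrier (fib M e)"
    have "act M (e, e) a = a" using M e a by (simp add: cat_module_def)
    then show "act (colimE G M) (x, x) (colim_in (class_poset G (cl e)) M e a) = id (colim_in (class_poset G (cl e)) M e a)"
      using act_colimE[OF M x'(1), of e e a] x' e a cl_self[of e]
      by (simp add: ident_in_elts ident_gdom ident_gran gle_refl)
  qed (use X in simp)
  then show "act (colimE G M) (ident (LL Q) x) X = X" by simp
next
  fix m n X assume m: "m \<in> mors (LL Q)" and n: "n \<in> mors (LL Q)" and mn: "tgt (LL Q) m = src (LL Q) n"
    and X: "X \<in> carrier (fib (colimE G M) (src (LL Q) m))"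
  interpret Q: ordered_groupoid Q by (rule ordered_groupoid_Q)
  obtain \<gamma> where \<gamma>: "\<gamma> \<in> elts Q" "m = (gdom Q \<gamma>, \<gamma>)" using m by (rule mors_QE)
  obtain \<delta> where \<delta>: "\<delta> \<in> elts Q" "n = (gdom Q \<delta>, \<delta>)" using n by (rule mors_QE)
  have \<gamma>\<delta>: "gran Q \<gamma> = gdom Q \<delta>" using mn \<gamma> \<delta> by simp
  let ?\<gamma>\<delta> = "gmul Q \<gamma> \<delta>"
  have p: "?\<gamma>\<delta> \<in> elts Q" "gdom Q ?\<gamma>\<delta> = gdom Q \<gamma>" "gran Q ?\<gamma>\<delta> = gran Q \<delta>"
    using \<gamma> \<delta> \<gamma>\<delta> by (simp_all add: Q.gmul_in Q.gdom_gmul Q.gran_gmul)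
  have "act (colimE G M) (gdom Q ?\<gamma>\<delta>, ?\<gamma>\<delta>) X = (act (colimE G M) n \<circ> act (colimE G M) m) X"
  proof (rule colimE_eqI[OF M _ idents_Q_gdom[OF \<gamma>(1)], where f = "act (colimE G M) (gdom Q ?\<gamma>\<delta>, ?\<gamma>\<delta>)" and g = "act (colimE G M) n \<circ> act (colimE G M) m"])
    show "group (colim (class_poset G (gran Q \<delta>)) M)"
      using category.comm_group_colim[OF category_class_poset cat_module_class_poset[OF M]] by (simp add: comm_group_def)
    show "act (colimE G M) (gdom Q ?\<gamma>\<delta>, ?\<gamma>\<delta>) \<in> hom (colim (class_poset G (gdom Q \<gamma>)) M) (colim (class_poset G (gran Q \<delta>)) M)"
      using act_colimE_hom[OF M p(1)] p by simp
    show "act (colimE G M) n \<circ> act (colimE G M) m \<in> hom (colim (class_poset G (gdom Q \<gamma>)) M) (colim (class_poset G (gran Q \<delta>)) M)"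
      by (rule hom_compose[of _ _ "colim (class_poset G (gdom Q \<delta>)) M"])
        (use act_colimE_hom[OF M \<gamma>(1)] act_colimE_hom[OF M \<delta>(1)] \<gamma> \<delta> \<gamma>\<delta> in simp_all)
    fix e a assume e: "e \<in> idents G" "gdom Q \<gamma> = cl e" and a: "a \<in> carrier (fib M e)"
    have e': "e \<in> gdom Q \<gamma> \<inter> idents G" using e cl_self[OF ident_in_elts] by simp
    obtain h where h: "h \<in> \<gamma>" "h \<in> elts G" "gle G (gdom G h) e" using class_lift[OF \<gamma>(1) e'] .
    have h': "gran G h \<in> gdom Q \<delta> \<inter> idents G" using gran_in_class[OF \<gamma>(1) h(1)] \<gamma>\<delta> by simp
    obtain k where k: "k \<in> \<delta>" "k \<in> elts G" "gle G (gdom G k) (gran G h)" using class_lift[OF \<delta>(1) h'] .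
    let ?hk = "gmul G (corestriction G h (gdom G k)) k"
    note hk = cl_mult_lift[OF \<gamma>(1) \<delta>(1) h(1) k(1,3)]
    have hkG: "?hk \<in> elts G" using mem_class[OF p(1) hk(1)] by blast
    have le: "gle G (gdom G ?hk) e"
      using gle_trans[OF gdom_in[OF hkG] gdom_in[OF h(2)] ident_in_elts[OF e(1)]] hk h(3) by simp
    have "act (colimE G M) n (act (colimE G M) m (colim_in (class_poset G (gdom Q \<gamma>)) M e a)) =
        colim_in (class_poset G (gran Q \<delta>)) M (gran G k) (act M (gran G h, k) (act M (e, h) a))"
      using act_colimE[OF M \<gamma>(1) e' h(1,3) a] act_colimE[OF M \<delta>(1) h' k(1,3) act_in[OF M e(1) h(2,3) a]] \<gamma> \<delta> \<gamma>\<delta> by simp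
    also have "\<dots> = act (colimE G M) (gdom Q ?\<gamma>\<delta>, ?\<gamma>\<delta>) (colim_in (class_poset G (gdom Q \<gamma>)) M e a)"
      using act_act[OF M e(1) h(2,3) k(2,3) a] act_colimE[OF M p(1) _ hk(1) le a] e' p hk(3) by simp
    finally show "act (colimE G M) (gdom Q ?\<gamma>\<delta>, ?\<gamma>\<delta>) (colim_in (class_poset G (cl e)) M e a) =
        (act (colimE G M) n \<circ> act (colimE G M) m) (colim_in (class_poset G (cl e)) M e a)" by (simp add: e(2))
  qed (use X \<gamma> in simp)
  then show "act (colimE G M) (cmp (LL Q) m n) X = act (colimE G M) n (act (colimE G M) m X)"
    using cmp_LL_Q[OF \<gamma>(1) \<delta>(1) \<gamma>\<delta>] \<gamma>(2) \<delta>(2) by simp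
qed

section \<open>Functoriality and exactness of \<open>colimE\<close>\<close>

context
  fixes M :: "('a, 'a \<times> 'a, 'b) cmod" and N :: "('a, 'a \<times> 'a, 'c) cmod" and \<phi>
  assumes M: "G_module G M" and N: "G_module G N" and \<phi>: "nat_trans (LL G) M N \<phi>"
begin

lemma colimE_map_hom:
  "colimE_map G M N \<phi> x \<in> hom (colim (class_poset G x) M) (colim (class_poset G x) N)"
  unfolding colimE_map_def
  by (rule category.colim_map_hom[OF category_class_poset cat_module_class_poset[OF M] cat_module_class_poset[OF N]
        nat_trans_class_poset[OF \<phi>]])

lemma colimE_map_in:
  "\<lbrakk>e \<in> x \<inter> idents G; a \<in> carrier (fib M e)\<rbrakk> \<Longrightarrow>
    colimE_map G M N \<phi> x (colim_in (class_poset G x) M e a) = colim_in (class_poset G x) N e (\<phi> e a)"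
  unfolding colimE_map_def
  by (rule category.colim_map_in[OF category_class_poset cat_module_class_poset[OF M] cat_module_class_poset[OF N]
        nat_trans_class_poset[OF \<phi>]]) simp_all

text \<open>On the canonical image of the fibre at \<open>e\<close>, both actions of
  \<open>\<gamma>\<close> are computed with one and the same representative \<open>h\<close>, and
  naturality of \<open>\<phi>\<close> at \<open>(e, h)\<close> compares them.\<close>

lemma nat_trans_colimE_map: "nat_trans (LL Q) (colimE G M) (colimE G N) (colimE_map G M N \<phi>)"
  unfolding nat_trans_def
proof (intro conjI ballI)
  show "colimE_map G M N \<phi> x \<in> hom (fib (colimE G M) x) (fib (colimE G N) x)" for x
    by (simp add: colimE_map_hom)
  fix m X assume m: "m \<in> mors (LL Q)" and X: "X \<in> carrier (fib (colimE G M) (src (LL Q) m))"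
  obtain \<gamma> where \<gamma>: "\<gamma> \<in> elts Q" "m = (gdom Q \<gamma>, \<gamma>)" using m by (rule mors_QE)
  have "(colimE_map G M N \<phi> (gran Q \<gamma>) \<circ> act (colimE G M) m) X = (act (colimE G N) m \<circ> colimE_map G M N \<phi> (gdom Q \<gamma>)) X"
  proof (rule colimE_eqI[OF M _ idents_Q_gdom[OF \<gamma>(1)], where f = "colimE_map G M N \<phi> (gran Q \<gamma>) \<circ> act (colimE G M) m" and g = "act (colimE G N) m \<circ> colimE_map G M N \<phi> (gdom Q \<gamma>)"])
    show "group (colim (class_poset G (gran Q \<gamma>)) N)"
      using category.comm_group_colim[OF category_class_poset cat_module_class_poset[OF N]] by (simp add: comm_group_def)
    show "colimE_map G M N \<phi> (gran Q \<gamma>) \<circ> act (colimE G M) m \<in>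
        hom (colim (class_poset G (gdom Q \<gamma>)) M) (colim (class_poset G (gran Q \<gamma>)) N)"
      unfolding \<gamma>(2) by (rule hom_compose[OF act_colimE_hom[OF M \<gamma>(1)] colimE_map_hom])
    show "act (colimE G N) m \<circ> colimE_map G M N \<phi> (gdom Q \<gamma>) \<in>
        hom (colim (class_poset G (gdom Q \<gamma>)) M) (colim (class_poset G (gran Q \<gamma>)) N)"
      unfolding \<gamma>(2) by (rule hom_compose[OF colimE_map_hom act_colimE_hom[OF N \<gamma>(1)]])
    fix e a assume e: "e \<in> idents G" "gdom Q \<gamma> = cl e" and a: "a \<in> carrier (fib M e)"
    have e': "e \<in> gdom Q \<gamma> \<inter> idents G" using e cl_self[OF ident_in_elts] by simp
    obtain h where h: "h \<in> \<gamma>" "h \<in> elts G" "gle G (gdom G h) e" using class_lift[OF \<gamma>(1) e'] .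
    have "\<phi> e a \<in> carrier (fib N e)" using category.nat_trans_in[OF category_LL \<phi>] e a by simp
    moreover have "\<phi> (gran G h) (act M (e, h) a) = act N (e, h) (\<phi> e a)"
      using category.nat_trans_act[OF category_LL \<phi>, of "(e, h)" a] e h a by simp
    ultimately show "(colimE_map G M N \<phi> (gran Q \<gamma>) \<circ> act (colimE G M) m) (colim_in (class_poset G (cl e)) M e a) =
        (act (colimE G N) m \<circ> colimE_map G M N \<phi> (gdom Q \<gamma>)) (colim_in (class_poset G (cl e)) M e a)"
      using act_colimE[OF M \<gamma>(1) e' h(1,3) a] act_colimE[OF N \<gamma>(1) e' h(1,3)] gran_in_class[OF \<gamma>(1) h(1)]
        colimE_map_in[OF e' a] act_in[OF M e(1) h(2,3) a] by (simp add: \<gamma>(2) colimE_map_in flip: e(2))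
  qed (use X \<gamma> in simp)
  then show "colimE_map G M N \<phi> (tgt (LL Q) m) (act (colimE G M) m X) =
      act (colimE G N) m (colimE_map G M N \<phi> (src (LL Q) m) X)" by (simp add: \<gamma>(2))
qed

lemma surjective_colimE_map:
  assumes "surjective (LL G) M N \<phi>"
  shows "surjective (LL Q) (colimE G M) (colimE G N) (colimE_map G M N \<phi>)"
  unfolding surjective_def
proof
  fix x assume "x \<in> objs (LL Q)"
  then interpret X: directed_category "class_poset G x" by (intro directed_class_poset) simp
  have "surjective (class_poset G x) M N \<phi>" using assms by (simp add: surjective_def)
  then show "colimE_map G M N \<phi> x ` carrier (fib (colimE G M) x) = carrier (fib (colimE G N) x)"
    unfolding colimE_map_def fib_colimE
    by (intro X.colim_map_onto cat_module_class_poset M N nat_trans_class_poset \<phi>)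
qed

lemma exact_colimE_map:
  fixes L :: "('a, 'a \<times> 'a, 'd) cmod"
  assumes L: "G_module G L" and \<psi>: "nat_trans (LL G) L M \<psi>"
    and exact: "\<And>e. e \<in> idents G \<Longrightarrow> \<psi> e ` carrier (fib L e) = kernel (fib M e) (fib N e) (\<phi> e)"
    and x: "x \<in> idents Q"
  shows "colimE_map G L M \<psi> x ` carrier (fib (colimE G L) x) =
    kernel (fib (colimE G M) x) (fib (colimE G N) x) (colimE_map G M N \<phi> x)"
proof -
  interpret X: directed_category "class_poset G x" by (rule directed_class_poset[OF x])
  show ?thesis
    unfolding colimE_map_def fib_colimE
    by (intro X.colim_map_exact cat_module_class_poset L M N nat_trans_class_poset \<phi> \<psi> exact) simp
qed

end

text \<open>Restriction along \<open>LL G \<rightarrow> LL Q\<close>, the right adjoint of \<open>colimE\<close>.\<close>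

definition pullback where
  "pullback R = \<lparr>fib = (\<lambda>e. fib R (cl e)), act = (\<lambda>(e, g). act R (cl e, cl g))\<rparr>"

lemma pullback_simps [simp]: "fib (pullback R) e = fib R (cl e)" "act (pullback R) (e, g) = act R (cl e, cl g)"
  by (simp_all add: pullback_def)

text \<open>In \<open>LL G\<close> the domain of \<open>g\<close> need only lie below
  \<open>e\<close>. Being below, it is in the same class, so in the quotient the domain of
  \<open>cl g\<close> is exactly \<open>cl e\<close>, as the trivial order there requires.\<close>

lemma mors_cl:
  assumes "(e, g) \<in> mors (LL G)"
  shows "(cl e, cl g) \<in> mors (LL Q)" and "gdom Q (cl g) = cl e" and "gran Q (cl g) = cl (gran G g)"
proof -
  have "cl (gdom G g) = cl e" using assms by (intro cl_below) (auto simp: ident_in_elts gdom_in)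
  then show d: "gdom Q (cl g) = cl e" "gran Q (cl g) = cl (gran G g)"
    using assms by (auto simp: gdom_Q gran_Q)
  show "(cl e, cl g) \<in> mors (LL Q)" unfolding mors_Q using assms d by (simp add: cl_in)
qed

text \<open>Composition in \<open>LL G\<close> corestricts its first factor, and corestriction does
  not leave the class. So passing to classes turns composites into products of the quotient.\<close>

lemma cat_module_pullback:
  assumes R: "cat_module (LL Q) R"
  shows "G_module G (pullback R)"
  unfolding cat_module_def
proof (intro conjI ballI impI)
  interpret Q: category "LL Q" by (rule category_LL_Q)
  show "comm_group (fib (pullback R) e)" if "e \<in> objs (LL G)" for e
    using Q.cat_module_comm_group[OF R] that by (simp add: cl_ident)
  show "act (pullback R) (ident (LL G) e) a = a" if "e \<in> objs (LL G)" "a \<in> carrier (fib (pullback R) e)" for e a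
    using R that cl_ident[of e] by (simp add: cat_module_def)
  fix m assume m: "m \<in> mors (LL G)"
  then obtain e g where eg: "m = (e, g)" by (cases m)
  note c = mors_cl[OF m[unfolded eg]]
  show "act (pullback R) m \<in> hom (fib (pullback R) (src (LL G) m)) (fib (pullback R) (tgt (LL G) m))"
    using Q.cat_module_act_hom[OF R c(1)] c by (simp add: eg)
  fix n a assume n: "n \<in> mors (LL G)" and mn: "tgt (LL G) m = src (LL G) n"
    and a: "a \<in> carrier (fib (pullback R) (src (LL G) m))"
  obtain h where h: "n = (gran G g, h)" using mn eg by (cases n) simp
  note d = mors_cl[OF n[unfolded h]]
  have gh: "g \<in> elts G" "h \<in> elts G" "gle G (gdom G h) (gran G g)" using m n by (simp_all add: eg h)
  note k = corestr[OF gh(1) gdom_idents[OF gh(2)] gh(3)]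
  have "gmul Q (cl g) (cl h) = cl (gmul G (corestriction G g (gdom G h)) h)"
    using gmul_Q'[OF k(1) gh(2) k(2)] cl_below[OF gh(1) k(1,3)] by simp
  moreover have "cmp (LL Q) (cl e, cl g) (cl (gran G g), cl h) = (gdom Q (gmul Q (cl g) (cl h)), gmul Q (cl g) (cl h))"
    using cmp_LL_Q[of "cl g" "cl h"] c d gh by (simp add: cl_in)
  moreover have "gdom Q (gmul Q (cl g) (cl h)) = cl e"
    using groupoid.gdom_gmul[of Q "cl g" "cl h"] ordered_groupoid_Q c d gh by (simp add: cl_in ordered_groupoid_def)
  moreover have "act R (cmp (LL Q) (cl e, cl g) (cl (gran G g), cl h)) a = act R (cl (gran G g), cl h) (act R (cl e, cl g) a)"
    using R c d a unfolding cat_module_def by (simp add: eg del: LL_simps(2,6))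
  ultimately show "act (pullback R) (cmp (LL G) m n) a = act (pullback R) n (act (pullback R) m a)"
    by (simp add: eg h)
qed

lemma nat_trans_pullback:
  assumes \<pi>: "nat_trans (LL Q) R S \<pi>"
  shows "nat_trans (LL G) (pullback R) (pullback S) (\<lambda>e. \<pi> (cl e))"
  unfolding nat_trans_def
proof (intro conjI ballI)
  show "\<pi> (cl e) \<in> hom (fib (pullback R) e) (fib (pullback S) e)" if "e \<in> objs (LL G)" for e
    using category.nat_trans_hom[OF category_LL_Q \<pi>, of "cl e"] that by (simp add: cl_ident)
  fix m a assume m: "m \<in> mors (LL G)" and a: "a \<in> carrier (fib (pullback R) (src (LL G) m))"
  obtain e g where eg: "m = (e, g)" by (cases m)
  note c = mors_cl[OF m[unfolded eg]]
  show "\<pi> (cl (tgt (LL G) m)) (act (pullback R) m a) = act (pullback S) m (\<pi> (cl (src (LL G) m)) a)"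
    using category.nat_trans_act[OF category_LL_Q \<pi> c(1), of a] a c by (simp add: eg)
qed

lemma act_colimE_cl:
  assumes M: "G_module G M" and m: "(e, g) \<in> mors (LL G)" and a: "a \<in> carrier (fib M e)"
  shows "act (colimE G M) (cl e, cl g) (colim_in (class_poset G (cl e)) M e a) =
    colim_in (class_poset G (cl (gran G g))) M (gran G g) (act M (e, g) a)"
  using act_colimE[OF M, of "cl g" e g a] mors_cl[OF m] m a cl_self[of g] cl_self[of e] cl_in[of g]
  by (simp add: ident_in_elts)

text \<open>One half of the adjunction: precomposition with the canonical maps of the fibres into
  the colimits over their classes, which form the unit.\<close>

lemma nat_trans_unit:
  assumes M: "G_module G M" and \<phi>: "nat_trans (LL Q) (colimE G M) R \<phi>"
  shows "nat_trans (LL G) M (pullback R) (\<lambda>e a. \<phi> (cl e) (colim_in (class_poset G (cl e)) M e a))"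
  unfolding nat_trans_def
proof (intro conjI ballI)
  interpret Q: category "LL Q" by (rule category_LL_Q)
  note MC = cat_module_class_poset[OF M]
  fix e assume "e \<in> objs (LL G)"
  then have e: "e \<in> idents G" "e \<in> cl e" using cl_self[OF ident_in_elts] by simp_all
  have "colim_in (class_poset G (cl e)) M e \<in> hom (fib M e) (colim (class_poset G (cl e)) M)"
    by (rule category.colim_in_hom[OF category_class_poset MC]) (use e in simp)
  moreover have "\<phi> (cl e) \<in> hom (colim (class_poset G (cl e)) M) (fib R (cl e))"
    using Q.nat_trans_hom[OF \<phi>, of "cl e"] e by (simp add: cl_ident)
  ultimately show "(\<lambda>a. \<phi> (cl e) (colim_in (class_poset G (cl e)) M e a)) \<in> hom (fib M e) (fib (pullback R) e)"
    using hom_compose unfolding comp_def by fastforce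
next
  interpret Q: category "LL Q" by (rule category_LL_Q)
  fix m a assume m: "m \<in> mors (LL G)" and a: "a \<in> carrier (fib M (src (LL G) m))"
  obtain e g where eg: "m = (e, g)" by (cases m)
  have e: "e \<in> idents G" "e \<in> cl e" using m cl_self[OF ident_in_elts] by (simp_all add: eg)
  note c = mors_cl[OF m[unfolded eg]]
  have "colim_in (class_poset G (cl e)) M e a \<in> carrier (colim (class_poset G (cl e)) M)"
    by (rule category.colim_in_in[OF category_class_poset cat_module_class_poset[OF M]]) (use e a eg in simp_all)
  then show "\<phi> (cl (tgt (LL G) m)) (colim_in (class_poset G (cl (tgt (LL G) m))) M (tgt (LL G) m) (act M m a)) =
      act (pullback R) m (\<phi> (cl (src (LL G) m)) (colim_in (class_poset G (cl (src (LL G) m))) M (src (LL G) m) a))"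
    using Q.nat_trans_act[OF \<phi> c(1), of "colim_in (class_poset G (cl e)) M e a"]
      act_colimE_cl[OF M m[unfolded eg], of a] a c by (simp add: eg)
qed

text \<open>The other half of the adjunction. Within a class \<open>x\<close> the pullback sends
  each poset morphism to \<open>(x, x)\<close>, which acts as the identity; so the components of
  \<open>\<psi>\<close> on the class form a cocone and factor through its colimit. Naturality in
  \<open>\<gamma>\<close> is checked with a lift \<open>h\<close>, where it is naturality of
  \<open>\<psi>\<close>.\<close>

lemma colimE_transpose:
  assumes M: "G_module G M" and R: "cat_module (LL Q) R" and \<psi>: "nat_trans (LL G) M (pullback R) \<psi>"
  obtains \<chi> where "nat_trans (LL Q) (colimE G M) R \<chi>"
    and "\<And>e a. \<lbrakk>e \<in> idents G; a \<in> carrier (fib M e)\<rbrakk> \<Longrightarrow> \<chi> (cl e) (colim_in (class_poset G (cl e)) M e a) = \<psi> e a"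
proof -
  interpret Q: category "LL Q" by (rule category_LL_Q)
  interpret L: category "LL G" by (rule category_LL)
  note MC = cat_module_class_poset[OF M]
  have "\<exists>h. h \<in> hom (colim (class_poset G x) M) (fib R x) \<and>
      (\<forall>e\<in>x \<inter> idents G. \<forall>a\<in>carrier (fib M e). h (colim_in (class_poset G x) M e a) = \<psi> e a)"
    if x: "x \<in> idents Q" for x
  proof -
    have xe: "cl e = x" if "e \<in> x" for e using cl_of_ident[OF x that] by simp
    have hom: "\<psi> e \<in> hom (fib M e) (fib R x)" if "e \<in> objs (class_poset G x)" for e
      using L.nat_trans_hom[OF \<psi>, of e] xe that by simp
    have compat: "\<psi> (tgt (class_poset G x) m) (act M m a) = \<psi> (src (class_poset G x) m) a"
      if m: "m \<in> mors (class_poset G x)" and a: "a \<in> carrier (fib M (src (class_poset G x) m))" for m a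
    proof -
      obtain e f where ef: "m = (e, f)" "e \<in> x \<inter> idents G" "f \<in> x \<inter> idents G" "gle G f e" using m by (cases m) auto
      have "m \<in> mors (LL G)" using ef by (simp add: ident_in_elts ident_gdom)
      then have "\<psi> f (act M m a) = act R (x, x) (\<psi> e a)"
        using L.nat_trans_act[OF \<psi>, of m a] a ef xe by (simp add: ident_gran)
      also have "\<dots> = \<psi> e a"
        using R x hom_in_carrier[OF hom, of e a] ef a by (simp add: cat_module_def)
      finally show ?thesis by (simp add: ef)
    qed
    have Rx: "comm_group (fib R x)" using Q.cat_module_comm_group[OF R] x by simp
    show ?thesis
      using category.colim_universal[OF category_class_poset MC Rx hom compat] by (metis class_poset_simps(1))
  qed
  then obtain \<chi> where \<chi>: "\<And>x. x \<in> idents Q \<Longrightarrow> \<chi> x \<in> hom (colim (class_poset G x) M) (fib R x)"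
    and \<chi>_in: "\<And>x e a. \<lbrakk>x \<in> idents Q; e \<in> x \<inter> idents G; a \<in> carrier (fib M e)\<rbrakk> \<Longrightarrow>
      \<chi> x (colim_in (class_poset G x) M e a) = \<psi> e a"
    by metis
  have \<chi>_cl: "\<chi> (cl e) (colim_in (class_poset G (cl e)) M e a) = \<psi> e a"
    if "e \<in> idents G" "a \<in> carrier (fib M e)" for e a
    using \<chi>_in[OF cl_ident, of e e a] cl_self[OF ident_in_elts] that by simp
  have "nat_trans (LL Q) (colimE G M) R \<chi>"
    unfolding nat_trans_def
  proof (intro conjI ballI)
    show "\<chi> x \<in> hom (fib (colimE G M) x) (fib R x)" if "x \<in> objs (LL Q)" for x using \<chi> that by simp
    fix m X assume m: "m \<in> mors (LL Q)" and X: "X \<in> carrier (fib (colimE G M) (src (LL Q) m))"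
    obtain \<gamma> where \<gamma>: "\<gamma> \<in> elts Q" "m = (gdom Q \<gamma>, \<gamma>)" using m by (rule mors_QE)
    have "(\<chi> (gran Q \<gamma>) \<circ> act (colimE G M) m) X = (act R m \<circ> \<chi> (gdom Q \<gamma>)) X"
    proof (rule colimE_eqI[OF M _ idents_Q_gdom[OF \<gamma>(1)], where f = "\<chi> (gran Q \<gamma>) \<circ> act (colimE G M) m" and g = "act R m \<circ> \<chi> (gdom Q \<gamma>)"])
      show "group (fib R (gran Q \<gamma>))" using Q.cat_module_group[OF R] idents_Q_gran[OF \<gamma>(1)] by simp
      show "\<chi> (gran Q \<gamma>) \<circ> act (colimE G M) m \<in> hom (colim (class_poset G (gdom Q \<gamma>)) M) (fib R (gran Q \<gamma>))"
        unfolding \<gamma>(2) by (rule hom_compose[OF act_colimE_hom[OF M \<gamma>(1)] \<chi>[OF idents_Q_gran[OF \<gamma>(1)]]])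
      show "act R m \<circ> \<chi> (gdom Q \<gamma>) \<in> hom (colim (class_poset G (gdom Q \<gamma>)) M) (fib R (gran Q \<gamma>))"
        using hom_compose[OF \<chi>[OF idents_Q_gdom[OF \<gamma>(1)]], of "act R m"] Q.cat_module_act_hom[OF R m] by (simp add: \<gamma>(2))
      fix e a assume e: "e \<in> idents G" "gdom Q \<gamma> = cl e" and a: "a \<in> carrier (fib M e)"
      have e': "e \<in> gdom Q \<gamma> \<inter> idents G" using e cl_self[OF ident_in_elts] by simp
      obtain h where h: "h \<in> \<gamma>" "h \<in> elts G" "gle G (gdom G h) e" using class_lift[OF \<gamma>(1) e'] .
      have \<gamma>h: "\<gamma> = cl h" using mem_class[OF \<gamma>(1) h(1)] by simp
      have eh: "(e, h) \<in> mors (LL G)" using e h by simp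
      show "(\<chi> (gran Q \<gamma>) \<circ> act (colimE G M) m) (colim_in (class_poset G (cl e)) M e a) =
          (act R m \<circ> \<chi> (gdom Q \<gamma>)) (colim_in (class_poset G (cl e)) M e a)"
        using act_colimE_cl[OF M eh a] \<chi>_cl[OF e(1) a] \<chi>_cl[OF gran_idents[OF h(2)] act_in[OF M e(1) h(2,3) a]]
          L.nat_trans_act[OF \<psi> eh, of a] a mors_cl[OF eh] by (simp add: \<gamma>(2) \<gamma>h)
    qed (use X \<gamma> in simp)
    then show "\<chi> (tgt (LL Q) m) (act (colimE G M) m X) = act R m (\<chi> (src (LL Q) m) X)" by (simp add: \<gamma>(2))
  qed
  with \<chi>_cl show thesis using that by blast
qed

text \<open>Transpose the map to be lifted, lift it through the pullback of \<open>\<pi>\<close>,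
  and transpose back. The pullback of \<open>\<pi>\<close> is still surjective because its
  components are components of \<open>\<pi>\<close>. As the pulled back modules have other types
  than the test modules for \<open>P\<close>, the lift comes from \<open>projective_lifts\<close>
  instead of the definition.\<close>

lemma projective_colimE:
  fixes P :: "('a, 'a \<times> 'a, 'p) cmod"
  assumes P: "projective (LL G) P"
  shows "projective (LL Q) (colimE G P)"
  unfolding projective_def
proof (intro conjI allI impI)
  interpret Q: category "LL Q" by (rule category_LL_Q)
  interpret L: category "LL G" by (rule category_LL)
  have MP: "G_module G P" using P by (simp add: projective_def)
  show "cat_module (LL Q) (colimE G P)" by (rule cat_module_colimE[OF MP])
  fix M :: "('a set, 'a set \<times> 'a set, ('a set \<times> 'a set) \<times> ('a \<Rightarrow> 'p) set \<Rightarrow>\<^sub>0 int) cmod"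
    and N :: "('a set, 'a set \<times> 'a set, ('a \<Rightarrow> 'p) set) cmod" and \<pi> \<phi>
  assume "cat_module (LL Q) M \<and> cat_module (LL Q) N \<and> nat_trans (LL Q) M N \<pi> \<and> surjective (LL Q) M N \<pi> \<and>
    nat_trans (LL Q) (colimE G P) N \<phi>"
  then have M: "cat_module (LL Q) M" and N: "cat_module (LL Q) N" and \<pi>: "nat_trans (LL Q) M N \<pi>"
    and surj: "surjective (LL Q) M N \<pi>" and \<phi>: "nat_trans (LL Q) (colimE G P) N \<phi>" by blast+
  have "surjective (LL G) (pullback M) (pullback N) (\<lambda>e. \<pi> (cl e))"
    using surj cl_ident by (simp add: surjective_def)
  then obtain \<psi> where \<psi>: "nat_trans (LL G) P (pullback M) \<psi>"
    and \<pi>\<psi>: "\<And>e p. \<lbrakk>e \<in> objs (LL G); p \<in> carrier (fib P e)\<rbrakk> \<Longrightarrow>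
      \<pi> (cl e) (\<psi> e p) = \<phi> (cl e) (colim_in (class_poset G (cl e)) P e p)"
    using L.projective_lifts[OF P cat_module_pullback[OF M] cat_module_pullback[OF N] nat_trans_pullback[OF \<pi>] _
        nat_trans_unit[OF MP \<phi>]] by blast
  obtain \<chi> where \<chi>: "nat_trans (LL Q) (colimE G P) M \<chi>"
    and \<chi>_in: "\<And>e a. \<lbrakk>e \<in> idents G; a \<in> carrier (fib P e)\<rbrakk> \<Longrightarrow>
      \<chi> (cl e) (colim_in (class_poset G (cl e)) P e a) = \<psi> e a"
    using colimE_transpose[OF MP M \<psi>] by metis
  have "\<pi> x (\<chi> x X) = \<phi> x X" if "x \<in> objs (LL Q)" "X \<in> carrier (fib (colimE G P) x)" for x X
  proof -
    have "(\<pi> x \<circ> \<chi> x) X = \<phi> x X"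
      by (rule colimE_eqI[OF MP Q.cat_module_group[OF N that(1)] _
            Q.nat_trans_hom[OF Q.nat_trans_comp[OF \<chi> \<pi>] that(1), simplified]
            Q.nat_trans_hom[OF \<phi> that(1), simplified]])
        (use that \<chi>_in \<pi>\<psi> in auto)
    then show ?thesis by simp
  qed
  with \<chi> show "\<exists>\<psi>. nat_trans (LL Q) (colimE G P) M \<psi> \<and>
      (\<forall>x\<in>objs (LL Q). \<forall>p\<in>carrier (fib (colimE G P) x). \<pi> x (\<psi> x p) = \<phi> x p)" by blast
qed

section \<open>Homology of the quotient\<close>

text \<open>Both groups are universal for cocones on \<open>M\<close>: the iterated colimit first
  collects the fibres within each class and then the classes. The maps \<open>i\<close> and
  \<open>j\<close> match canonical images, which makes them inverse to each other.\<close>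

lemma colim_colimE:
  assumes M: "G_module G M"
  obtains i j where "i \<in> hom (colim (LL G) M) (colim (LL Q) (colimE G M))"
    and "j \<in> hom (colim (LL Q) (colimE G M)) (colim (LL G) M)"
    and "\<And>e a. \<lbrakk>e \<in> idents G; a \<in> carrier (fib M e)\<rbrakk> \<Longrightarrow>
      i (colim_in (LL G) M e a) = colim_in (LL Q) (colimE G M) (cl e) (colim_in (class_poset G (cl e)) M e a)"
    and "\<And>e a. \<lbrakk>e \<in> idents G; a \<in> carrier (fib M e)\<rbrakk> \<Longrightarrow>
      j (colim_in (LL Q) (colimE G M) (cl e) (colim_in (class_poset G (cl e)) M e a)) = colim_in (LL G) M e a"
proof -
  interpret Q: category "LL Q" by (rule category_LL_Q)
  interpret L: category "LL G" by (rule category_LL)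
  note E = cat_module_colimE[OF M] and MC = cat_module_class_poset[OF M]
  have e_in: "e \<in> objs (class_poset G (cl e))" if "e \<in> idents G" for e
    using that cl_self[OF ident_in_elts] by simp
  note c_in = category.colim_in_in[OF category_class_poset MC e_in]
  note K = L.comm_group_colim[OF M]
  obtain i where i: "i \<in> hom (colim (LL G) M) (colim (LL Q) (colimE G M))"
    and i_in: "\<And>e a. \<lbrakk>e \<in> objs (LL G); a \<in> carrier (fib M e)\<rbrakk> \<Longrightarrow> i (colim_in (LL G) M e a) =
      (colim_in (LL Q) (colimE G M) (cl e) \<circ> colim_in (class_poset G (cl e)) M e) a"
  proof (rule L.colim_universal[OF M Q.comm_group_colim[OF E],
        of "\<lambda>e. colim_in (LL Q) (colimE G M) (cl e) \<circ> colim_in (class_poset G (cl e)) M e"])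
    show "colim_in (LL Q) (colimE G M) (cl e) \<circ> colim_in (class_poset G (cl e)) M e \<in>
        hom (fib M e) (colim (LL Q) (colimE G M))" if "e \<in> objs (LL G)" for e
      using hom_compose[OF category.colim_in_hom[OF category_class_poset MC e_in, of e], of "colim_in (LL Q) (colimE G M) (cl e)"]
        Q.colim_in_hom[OF E, of "cl e"] that by (simp add: cl_ident)
    fix m a assume m: "m \<in> mors (LL G)" and a: "a \<in> carrier (fib M (src (LL G) m))"
    obtain e g where eg: "m = (e, g)" by (cases m)
    have e: "e \<in> idents G" using m by (simp add: eg)
    note c = mors_cl[OF m[unfolded eg]]
    show "(colim_in (LL Q) (colimE G M) (cl (tgt (LL G) m)) \<circ> colim_in (class_poset G (cl (tgt (LL G) m))) M (tgt (LL G) m)) (act M m a) =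
        (colim_in (LL Q) (colimE G M) (cl (src (LL G) m)) \<circ> colim_in (class_poset G (cl (src (LL G) m))) M (src (LL G) m)) a"
      using Q.colim_in_act[OF E c(1), of "colim_in (class_poset G (cl e)) M e a"] act_colimE_cl[OF M m[unfolded eg], of a]
        a c c_in[OF e] by (simp add: eg)
  qed blast
  \<comment> \<open>The canonical maps to the colimit over \<open>LL G\<close> restrict to a cocone
    on each class, since the morphisms of the poset are morphisms of \<open>LL G\<close>.\<close>
  have down: "\<exists>h. h \<in> hom (colim (class_poset G x) M) (colim (LL G) M) \<and>
      (\<forall>e\<in>x \<inter> idents G. \<forall>a\<in>carrier (fib M e). h (colim_in (class_poset G x) M e a) = colim_in (LL G) M e a)" for x
  proof -
    have hom: "colim_in (LL G) M e \<in> hom (fib M e) (colim (LL G) M)" if "e \<in> objs (class_poset G x)" for e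
      using L.colim_in_hom[OF M, of e] that by simp
    have compat: "colim_in (LL G) M (tgt (class_poset G x) m) (act M m a) = colim_in (LL G) M (src (class_poset G x) m) a"
      if m: "m \<in> mors (class_poset G x)" and a: "a \<in> carrier (fib M (src (class_poset G x) m))" for m a
    proof -
      obtain e f where "m = (e, f)" "e \<in> idents G" "f \<in> idents G" "gle G f e" using m by (cases m) auto
      then show ?thesis using L.colim_in_act[OF M, of m a] a by (simp add: ident_in_elts ident_gdom ident_gran)
    qed
    show ?thesis
      using category.colim_universal[OF category_class_poset MC K hom compat] by (metis class_poset_simps(1))
  qed
  then obtain k where k: "\<And>x. k x \<in> hom (colim (class_poset G x) M) (colim (LL G) M)"
    and k_in: "\<And>x e a. \<lbrakk>e \<in> x \<inter> idents G; a \<in> carrier (fib M e)\<rbrakk> \<Longrightarrow> k x (colim_in (class_poset G x) M e a) = colim_in (LL G) M e a"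
    by metis
  have k_cl: "k (cl e) (colim_in (class_poset G (cl e)) M e a) = colim_in (LL G) M e a"
    if "e \<in> idents G" "a \<in> carrier (fib M e)" for e a
    using k_in[of e "cl e" a] e_in[OF that(1)] that by simp
  obtain j where j: "j \<in> hom (colim (LL Q) (colimE G M)) (colim (LL G) M)"
    and j_in: "\<And>x X. \<lbrakk>x \<in> objs (LL Q); X \<in> carrier (fib (colimE G M) x)\<rbrakk> \<Longrightarrow> j (colim_in (LL Q) (colimE G M) x X) = k x X"
  proof (rule Q.colim_universal[OF E K, of k])
    show "k x \<in> hom (fib (colimE G M) x) (colim (LL G) M)" for x by (simp add: k)
    fix m X assume m: "m \<in> mors (LL Q)" and X: "X \<in> carrier (fib (colimE G M) (src (LL Q) m))"
    obtain \<gamma> where \<gamma>: "\<gamma> \<in> elts Q" "m = (gdom Q \<gamma>, \<gamma>)" using m by (rule mors_QE)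
    \<comment> \<open>The maps \<open>k\<close> are compatible with the action of
      \<open>\<gamma>\<close>: with a lift \<open>h\<close>, the action becomes that of the morphism
      \<open>(e, h)\<close>, which the colimit over \<open>LL G\<close> already identifies with the
      identity.\<close>
    have "(k (gran Q \<gamma>) \<circ> act (colimE G M) m) X = k (gdom Q \<gamma>) X"
    proof (rule colimE_eqI[OF M _ idents_Q_gdom[OF \<gamma>(1)], where f = "k (gran Q \<gamma>) \<circ> act (colimE G M) m"])
      show "group (colim (LL G) M)" using K by (simp add: comm_group_def)
      show "k (gran Q \<gamma>) \<circ> act (colimE G M) m \<in> hom (colim (class_poset G (gdom Q \<gamma>)) M) (colim (LL G) M)"
        unfolding \<gamma>(2) by (rule hom_compose[OF act_colimE_hom[OF M \<gamma>(1)] k])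
      show "k (gdom Q \<gamma>) \<in> hom (colim (class_poset G (gdom Q \<gamma>)) M) (colim (LL G) M)" by (rule k)
      fix e a assume e: "e \<in> idents G" "gdom Q \<gamma> = cl e" and a: "a \<in> carrier (fib M e)"
      have e': "e \<in> gdom Q \<gamma> \<inter> idents G" using e cl_self[OF ident_in_elts] by simp
      obtain h where h: "h \<in> \<gamma>" "h \<in> elts G" "gle G (gdom G h) e" using class_lift[OF \<gamma>(1) e'] .
      have \<gamma>h: "\<gamma> = cl h" using mem_class[OF \<gamma>(1) h(1)] by simp
      have eh: "(e, h) \<in> mors (LL G)" using e h by simp
      show "(k (gran Q \<gamma>) \<circ> act (colimE G M) m) (colim_in (class_poset G (cl e)) M e a) =
          k (gdom Q \<gamma>) (colim_in (class_poset G (cl e)) M e a)"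
        using act_colimE_cl[OF M eh a] k_cl[OF e(1) a] k_cl[OF gran_idents[OF h(2)] act_in[OF M e(1) h(2,3) a]]
          L.colim_in_act[OF M eh, of a] a mors_cl[OF eh] by (simp add: \<gamma>(2) \<gamma>h)
    qed (use X \<gamma> in simp)
    then show "k (tgt (LL Q) m) (act (colimE G M) m X) = k (src (LL Q) m) X" by (simp add: \<gamma>(2))
  qed blast
  show thesis
    by (rule that[OF i j]) (use i_in j_in k_cl c_in cl_ident in simp_all)
qed

text \<open>The generators of the outer colimit come from fibres that are colimits themselves, so
  the determination by canonical images is used once for each layer.\<close>

lemma colim_colimE_eqI:
  assumes M: "G_module G M" and H: "group H"
    and f: "f \<in> hom (colim (LL Q) (colimE G M)) H" and g: "g \<in> hom (colim (LL Q) (colimE G M)) H"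
    and eq: "\<And>e a. \<lbrakk>e \<in> idents G; a \<in> carrier (fib M e)\<rbrakk> \<Longrightarrow>
      f (colim_in (LL Q) (colimE G M) (cl e) (colim_in (class_poset G (cl e)) M e a)) =
      g (colim_in (LL Q) (colimE G M) (cl e) (colim_in (class_poset G (cl e)) M e a))"
    and X: "X \<in> carrier (colim (LL Q) (colimE G M))"
  shows "f X = g X"
proof -
  interpret Q: category "LL Q" by (rule category_LL_Q)
  note E = cat_module_colimE[OF M]
  show ?thesis
  proof (rule Q.colim_hom_eqI[OF E H f g _ X])
    fix x Y assume x: "x \<in> objs (LL Q)" and Y: "Y \<in> carrier (fib (colimE G M) x)"
    have "(f \<circ> colim_in (LL Q) (colimE G M) x) Y = (g \<circ> colim_in (LL Q) (colimE G M) x) Y"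
    proof (rule colimE_eqI[OF M H, of x "f \<circ> colim_in (LL Q) (colimE G M) x" "g \<circ> colim_in (LL Q) (colimE G M) x"])
      show "f \<circ> colim_in (LL Q) (colimE G M) x \<in> hom (colim (class_poset G x) M) H"
        "g \<circ> colim_in (LL Q) (colimE G M) x \<in> hom (colim (class_poset G x) M) H"
        using hom_compose[OF Q.colim_in_hom[OF E x]] f g by simp_all
    qed (use x Y eq in simp_all)
    then show "f (colim_in (LL Q) (colimE G M) x Y) = g (colim_in (LL Q) (colimE G M) x Y)" by simp
  qed
qed

lemma projective_resolution_colimE:
  assumes A: "G_module G A" and P: "projective_resolution (LL G) A P d \<epsilon>"
  shows "projective_resolution (LL Q) (colimE G A) (\<lambda>n. colimE G (P n))
    (\<lambda>n. colimE_map G (P (Suc n)) (P n) (d n)) (colimE_map G (P 0) A \<epsilon>)"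
proof -
  interpret L: category "LL G" by (rule category_LL)
  note mP = L.projective_resolution_module[OF P] and dP = L.projective_resolution_d[OF P]
  note \<epsilon> = L.projective_resolution_eps[OF P]
  show ?thesis
    unfolding projective_resolution_def
  proof (intro conjI allI ballI)
    show "projective (LL Q) (colimE G (P n))" for n
      by (rule projective_colimE[OF L.projective_resolution_projective[OF P]])
    show "nat_trans (LL Q) (colimE G (P (Suc n))) (colimE G (P n)) (colimE_map G (P (Suc n)) (P n) (d n))" for n
      by (rule nat_trans_colimE_map[OF mP mP dP])
    show "nat_trans (LL Q) (colimE G (P 0)) (colimE G A) (colimE_map G (P 0) A \<epsilon>)"
      by (rule nat_trans_colimE_map[OF mP A \<epsilon>])
    show "surjective (LL Q) (colimE G (P 0)) (colimE G A) (colimE_map G (P 0) A \<epsilon>)"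
      by (rule surjective_colimE_map[OF mP A \<epsilon> L.projective_resolution_onto[OF P]])
    fix x assume "x \<in> objs (LL Q)"
    then have x: "x \<in> idents Q" by simp
    show "colimE_map G (P (Suc 0)) (P 0) (d 0) x ` carrier (fib (colimE G (P 1)) x) =
        kernel (fib (colimE G (P 0)) x) (fib (colimE G A) x) (colimE_map G (P 0) A \<epsilon> x)"
      using exact_colimE_map[OF mP A \<epsilon> mP dP _ x] L.projective_resolution_exact_0[OF P] by simp
    show "colimE_map G (P (Suc (Suc n))) (P (Suc n)) (d (Suc n)) x ` carrier (fib (colimE G (P (Suc (Suc n)))) x) =
        kernel (fib (colimE G (P (Suc n))) x) (fib (colimE G (P n)) x) (colimE_map G (P (Suc n)) (P n) (d n) x)" for n
      by (rule exact_colimE_map[OF mP mP dP mP dP _ x]) (simp add: L.projective_resolution_exact[OF P])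
  qed
qed

text \<open>The image of the resolution under \<open>colimE\<close> serves as the resolution over
  \<open>LL Q\<close>. The isomorphisms of \<open>colim_colimE\<close> are obtained in each degree
  separately; they commute with the differentials because on canonical images both differentials
  apply \<open>d n e\<close> to the representative.\<close>

lemma homology_colimE:
  assumes A: "G_module G A"
  shows "homology n G A \<cong> homology n Q (colimE G A)"
proof -
  interpret Q: category "LL Q" by (rule category_LL_Q)
  interpret L: category "LL G" by (rule category_LL)
  obtain P d \<epsilon> where P: "projective_resolution (LL G) A (P :: nat \<Rightarrow> ('a, 'a \<times> 'a, ('a \<times> 'a, 'b) gen \<Rightarrow>\<^sub>0 int) cmod) d \<epsilon>"
    using L.projective_resolution_exists[OF A] by blast
  define R where "R n = colimE G (P n)" for n
  define d' where "d' n = colimE_map G (P (Suc n)) (P n) (d n)" for n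
  note mP = L.projective_resolution_module[OF P] and dP = L.projective_resolution_d[OF P]
  have R: "projective_resolution (LL Q) (colimE G A) R d' (colimE_map G (P 0) A \<epsilon>)"
    using projective_resolution_colimE[OF A P] unfolding R_def d'_def by simp
  note mR = Q.projective_resolution_module[OF R] and dR = Q.projective_resolution_d[OF R]
  let ?K = "\<lambda>n. colim (LL G) (P n)" and ?d = "\<lambda>n. colim_map (LL G) (P (Suc n)) (P n) (d n)"
  let ?L = "\<lambda>n. colim (LL Q) (R n)" and ?e = "\<lambda>n. colim_map (LL Q) (R (Suc n)) (R n) (d' n)"
  interpret K: ab_complex ?K ?d by (rule L.ab_complex_colim[OF P])
  interpret E: ab_complex ?L ?e by (rule Q.ab_complex_colim[OF R])
  let ?in = "\<lambda>n e a. colim_in (LL Q) (R n) (cl e) (colim_in (class_poset G (cl e)) (P n) e a)"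
  have "\<forall>n. \<exists>i j. i \<in> hom (?K n) (?L n) \<and> j \<in> hom (?L n) (?K n) \<and>
      (\<forall>e\<in>idents G. \<forall>a\<in>carrier (fib (P n) e). i (colim_in (LL G) (P n) e a) = ?in n e a \<and> j (?in n e a) = colim_in (LL G) (P n) e a)"
    using colim_colimE[OF mP] unfolding R_def by metis
  then obtain i j where i: "\<And>n. i n \<in> hom (?K n) (?L n)" and j: "\<And>n. j n \<in> hom (?L n) (?K n)"
    and i_in: "\<And>n e a. \<lbrakk>e \<in> idents G; a \<in> carrier (fib (P n) e)\<rbrakk> \<Longrightarrow> i n (colim_in (LL G) (P n) e a) = ?in n e a"
    and j_in: "\<And>n e a. \<lbrakk>e \<in> idents G; a \<in> carrier (fib (P n) e)\<rbrakk> \<Longrightarrow> j n (?in n e a) = colim_in (LL G) (P n) e a"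
    by metis
  have e_in: "?e n (?in (Suc n) e a) = ?in n e (d n e a)" if e: "e \<in> idents G" and a: "a \<in> carrier (fib (P (Suc n)) e)" for n e a
  proof -
    have e': "e \<in> cl e \<inter> idents G" using e cl_self[OF ident_in_elts] by simp
    have "colim_in (class_poset G (cl e)) (P (Suc n)) e a \<in> carrier (fib (R (Suc n)) (cl e))"
      unfolding R_def fib_colimE
      by (rule category.colim_in_in[OF category_class_poset cat_module_class_poset[OF mP]]) (use e' a in simp_all)
    then show ?thesis
      using Q.colim_map_in[OF mR mR dR, of "cl e"] colimE_map_in[OF mP mP dP e' a] e by (simp add: d'_def cl_ident)
  qed
  have gK: "group (?K n)" and gL: "group (?L n)" for n
    using K.comm E.comm by (simp_all add: comm_group_def)
  have fd: "?e n (i (Suc n) X) = i n (?d n X)" if X: "X \<in> carrier (?K (Suc n))" for n X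
  proof -
    have "(?e n \<circ> i (Suc n)) X = (i n \<circ> ?d n) X"
      by (rule L.colim_hom_eqI[OF mP gL hom_compose[OF i E.d_hom] hom_compose[OF K.d_hom i] _ X])
        (simp add: i_in e_in L.colim_map_in[OF mP mP dP] L.nat_trans_in[OF dP])
    then show ?thesis by simp
  qed
  have gd: "?d n (j (Suc n) X) = j n (?e n X)" if X: "X \<in> carrier (?L (Suc n))" for n X
  proof -
    have "(?d n \<circ> j (Suc n)) X = (j n \<circ> ?e n) X"
      using colim_colimE_eqI[OF mP gK, of "?d n \<circ> j (Suc n)" "Suc n" n "j n \<circ> ?e n" X, folded R_def]
        hom_compose[OF j K.d_hom] hom_compose[OF E.d_hom j] X
      by (simp add: j_in e_in L.colim_map_in[OF mP mP dP] L.nat_trans_in[OF dP])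
    then show ?thesis by simp
  qed
  have gf: "j n (i n X) = X" if X: "X \<in> carrier (?K n)" for n X
  proof -
    have "(j n \<circ> i n) X = id X"
      by (rule L.colim_hom_eqI[OF mP gK hom_compose[OF i j] _ _ X]) (simp_all add: i_in j_in hom_def)
    then show ?thesis by simp
  qed
  have fg: "i n (j n X) = X" if X: "X \<in> carrier (?L n)" for n X
  proof -
    have "id \<in> hom (?L n) (?L n)" by (simp add: hom_def)
    then have "(i n \<circ> j n) X = id X"
      using colim_colimE_eqI[OF mP gL, of "i n \<circ> j n" n n id X, folded R_def] hom_compose[OF j i] X
      by (simp add: i_in j_in)
    then show ?thesis by simp
  qed
  have "homology n G A \<cong> chain_homology ?K ?d n"
    unfolding homology_def by (rule L.cat_homology_iso[OF A P])
  moreover have "chain_homology ?K ?d n \<cong> chain_homology ?L ?e n"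
  proof (rule K.chain_homology_iso[OF E.ab_complex_axioms, of i j])
    show "\<exists>b\<in>K.boundaries n. j n (i n X) = b \<otimes>\<^bsub>?K n\<^esub> X" if "X \<in> K.cycles n" for n X
    proof (rule bexI)
      \<comment> \<open>As \<open>i\<close> and \<open>j\<close> are strictly inverse, the trivial
        boundary is a sufficient witness.\<close>
      show "\<one>\<^bsub>?K n\<^esub> \<in> K.boundaries n" by (rule subgroup.one_closed[OF K.subgroup_boundaries])
      have "X \<in> carrier (?K n)" using that subgroup.subset[OF K.subgroup_cycles] by blast
      then show "j n (i n X) = \<one>\<^bsub>?K n\<^esub> \<otimes>\<^bsub>?K n\<^esub> X" using gf gK by (simp add: group.is_monoid)
    qed
    show "\<exists>b\<in>E.boundaries n. i n (j n X) = b \<otimes>\<^bsub>?L n\<^esub> X" if "X \<in> E.cycles n" for n X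
    proof (rule bexI)
      show "\<one>\<^bsub>?L n\<^esub> \<in> E.boundaries n" by (rule subgroup.one_closed[OF E.subgroup_boundaries])
      have "X \<in> carrier (?L n)" using that subgroup.subset[OF E.subgroup_cycles] by blast
      then show "i n (j n X) = \<one>\<^bsub>?L n\<^esub> \<otimes>\<^bsub>?L n\<^esub> X" using fg gL by (simp add: group.is_monoid)
    qed
  qed (use i j fd gd in blast)+
  moreover have "chain_homology ?L ?e n \<cong> homology n Q (colimE G A)"
    unfolding homology_def by (rule Q.iso_cat_homology[OF cat_module_colimE[OF A] R])
  ultimately show ?thesis by (meson iso_trans)
qed

end

theorem theorem5p1:
  fixes G :: "'g ogpd" and A :: "('g, 'g \<times> 'g, 'a) cmod" and n :: nat
  assumes "ordered_groupoid G" and "principally_directed G" and "G_module G A"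
  shows "homology n G A \<cong> homology n (beta_quotient G) (colimE G A)"
proof -
  interpret principally_directed_groupoid G
    using assms(1,2) by (simp add: principally_directed_groupoid_def principally_directed_groupoid_axioms_def)
  show ?thesis by (rule homology_colimE[OF assms(3)])
qed

end
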